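(* $H$ is a raviolo vertex algebra with spin grading that is strongly generated by the fields $$b(z)=\sum_{n\ge0}z^nb_n+\Omega_z^n\varphi_n,\qquad \nu(z)=\sum_{n\ge0}z^n\nu_n+\Omega_z^nc_n .$$
   Context: Conventions. Spaces are over $\mathbf C$ and $\mathbf Z$-graded (cohomological degree $|\cdot|$); $[x,y]=xy-(-1)^{|x||y|}yx$; Koszul signs throughout. Raviolo functions. $\mathcal K=\mathbf C\langle\!\langle z\rangle\!\rangle$: graded commutative algebra with degree 0 part $\mathbf C[\![z]\!]$ and degree 1 part the span (finite combinations) of symbols $\Omega_z^m$, $m\ge0$, with $z^n\Omega_z^m=\Omega_z^{m-n}$ ($n\le m$), $z^n\Omega_z^m=0$ ($n>m$), $\Omega_z^n\Omega_z^m=0$; $\mathcal K_{dist}$ is the same with infinite sums of the $\Omega_z^m$ allowed. $\partial_zz^n=nz^{n-1}$, $\partial_z\Omega_z^m=-(m+1)\Omega_z^{m+1}$. $R\langle\!\langle z\rangle\!\rangle$: series $\sum_{n<0}z^{-n-1}r_n+\sum_{n\ge0}\Omega_z^nr_n$, $r_n\in R$, $r_n=0$ for $n\gg0$; $R\langle\!\langle z\rangle\!\rangle\langle\!\langle w\rangle\!\rangle=(R\langle\!\langle z\rangle\!\rangle)\langle\!\langle w\rangle\!\rangle$. $\mathrm{End}(\mathcal V)\otimes\mathcal K_{dist}$ denotes $\mathrm{End}(\mathcal V)$-valued infinite series. $\mathcal K_{z,w,z-w}$ is the quotient of the free graded commutative algebra $\mathbf C[\![z,w]\!][\Omega_z^n,\Omega_w^m,\Omega_{z-w}^k]$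 ($\Omega$'s of degree 1) by: for $x\in\{z,w,z-w\}$, $x^n\Omega_x^m=\Omega_x^{m-n}$ ($n\le m$), $=0$ ($n>m$), $\Omega_x^n\Omega_x^m=0$; and $\Omega^0_{z-w}\Omega^0_z+\Omega^0_w\Omega^0_{z-w}+\Omega^0_z\Omega^0_w=0$ with all its $\partial_z,\partial_w$-derivatives. Expansions: (i) to $\mathbf C\langle\!\langle z\rangle\!\rangle\langle\!\langle w\rangle\!\rangle$: $\Omega_{z-w}^m\mapsto\sum_{n\ge0}\binom{m+n}{n}w^n\Omega_z^{m+n}$; (ii) to $\mathbf C\langle\!\langle w\rangle\!\rangle\langle\!\langle z\rangle\!\rangle$: $\Omega_{z-w}^m\mapsto(-1)^m\sum_{n\ge0}\binom{m+n}{n}z^n\Omega_w^{m+n}$; other generators fixed. Raviolo vertex algebras. A raviolo field on $\mathcal V$ is $A(z)=\sum_{m<0}z^{-m-1}A_m+\sum_{m\ge0}\Omega_z^mA_m$ with $A_m\in\mathrm{End}(\mathcal V)$, $A_mv=0$ for $m\gg0$ for each $v$; of degree $r$ if $A_m$ has degree $r$ for $m<0$, $r-1$ for $m\ge0$. $A,B$ are mutually local if for all $v\in\mathcal V$, $\varphi\in\mathcal V^*$, $\langle\varphi,A(z)B(w)v\rangle$ and $(-1)^{|A||B|}\langle\varphi,B(w)A(z)v\rangle$ are the expansions (i),(ii) of the same element of $\mathcal K_{z,w,z-w}$, with pole order in $z-w$ bounded uniformly in $v,\varphi$. A raviolo vertex algebra $(\mathcal V,|0\rangle,\partial,Y)$: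 graded space, $|0\rangle\in\mathcal V^0$, degree 0 endomorphism $\partial$, degree 0 linear map $Y(-,z):\mathcal V\to\mathrm{End}(\mathcal V)\otimes\mathcal K_{dist}$, $Y(a,z)=\sum_{m<0}z^{-m-1}a_{(m)}+\sum_{m\ge0}\Omega_z^ma_{(m)}$, with values raviolo fields, $[\partial,Y(a,z)]=\partial_zY(a,z)$, $\partial|0\rangle=0$, $Y(|0\rangle,z)=\mathrm{id}$, $Y(a,z)|0\rangle\in a+z\mathcal V[\![z]\!]$, all $Y(a,z),Y(b,w)$ mutually local. A spin grading is an extra grading $\mathcal V=\bigoplus_s\mathcal V^{(s)}$ with $|0\rangle$ of spin 0, $\partial$ raising spin by 1, and $a_{(n)}$ raising spin by $s-n-1$ for $a\in\mathcal V^{(s)}$. $\mathcal V$ is strongly generated by $\{a^i\}$ (or the fields $Y(a^i,z)$) if it is spanned by the monomials $a^{i_1}_{(j_1)}\cdots a^{i_l}_{(j_l)}|0\rangle$ with all $j_k<0$. The algebra $H$. $\widehat{\mathcal H}$ is the central extension of the abelian graded Lie algebra $\mathcal K\oplus\mathcal K[1]$ (variable $u$) by $\mathbf CK$ ($K$ of degree 0, spin 0). Generators ($n\ge0$): $c_n=u^n$ (degree 0, spin $-n$), $\nu_n=\Omega_u^n$ (degree 1, spin $n+1$) in $\mathcal K$; $\varphi_n=u^n$ (degree $-1$, spin $-n$), $b_n=\Omega_u^n$ (degree 0, spin $n+1$) in $\mathcal K[1]$. Non-zero brackets: $[c_n,b_m]=-n\delta_{n,m+1}K=-[b_m,c_n]$,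 $[\nu_n,\varphi_m]=m\delta_{n+1,m}K=[\varphi_m,\nu_n]$. The derivation $\partial$ is $\partial K=0$, $\partial\nu_n=(n+1)\nu_{n+1}$, $\partial c_n=-nc_{n-1}$, $\partial b_n=(n+1)b_{n+1}$, $\partial\varphi_n=-n\varphi_{n-1}$. $\widehat{\mathcal H}_{\ge0}$ consists of the $c$'s, the $\varphi$'s (including power series in $u$) and $K$; $\mathbf C_1$ is its one-dimensional module on which the $c$'s and $\varphi$'s act by 0 and $K$ by 1. $H=U\widehat{\mathcal H}\otimes_{U\widehat{\mathcal H}_{\ge0}}\mathbf C_1$, with vacuum $|0\rangle=1\otimes1$, translation operator induced by $\partial$ and $\partial1=0$, spin grading induced from $\widehat{\mathcal H}$, and $b(z)=Y(b_0|0\rangle,z)$, $\nu(z)=Y(\nu_0|0\rangle,z)$. *)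

theory Defs
  imports Complex_Main "HOL-Library.Poly_Mapping" "HOL-Library.Product_Plus"
    "HOL-Computational_Algebra.Formal_Power_Series"
begin

section \<open>Raviolo functions\<close>

unbundle fps_syntax

text \<open>Rings with a parity involution \<open>pari\<close>, which acts on homogeneous elements as
  x to (-1)^|x| x. The involution is all that the Koszul signs in products need.\<close>

class super_ring = ring_1 +
  fixes pari :: "'a \<Rightarrow> 'a"
  assumes pari_add: "pari (x + y) = pari x + pari y"
    and pari_mult: "pari (x * y) = pari x * pari y"
    and pari_one [simp]: "pari 1 = 1"
    and pari_pari [simp]: "pari (pari x) = x"
begin

lemma pari_zero [simp]: "pari 0 = 0"
  using pari_add[of 0 0] by simp

lemma pari_minus: "pari (- x) = - pari x"
  using pari_add[of x "- x"] by (simp add: eq_neg_iff_add_eq_0 add.commute)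

lemma pari_sum: "pari (sum f A) = (\<Sum>i\<in>A. pari (f i))"
  by (induction A rule: infinite_finite_induct) (simp_all add: pari_add)

end

instantiation complex :: super_ring
begin
definition pari_complex :: "complex \<Rightarrow> complex" where "pari_complex x = x"
instance by standard (simp_all add: pari_complex_def)
end

definition fps_map :: "('a \<Rightarrow> 'b) \<Rightarrow> 'a fps \<Rightarrow> 'b fps" where
  "fps_map h f = Abs_fps (\<lambda>n. h (f $ n))"

lemma fps_map_nth [simp]: "fps_map h f $ n = h (f $ n)"
  by (simp add: fps_map_def)

text \<open>\<open>'r rav\<close> is the ring of series in one variable z with coefficients in R:
  \<open>Rav f g\<close> stands for the sum of all \<open>z^n f_n\<close> and of the finitely many
  \<open>Omega_z^n g_n\<close>, with the coefficients written on the right. In \<open>rav_nth\<close> the index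
  \<open>m < 0\<close> refers to \<open>z^(-m-1)\<close> and \<open>m \<ge> 0\<close> to \<open>Omega_z^m\<close>. The algebra K of
  raviolo functions is \<open>complex rav\<close>. In \<open>complex rav rav\<close> the outer constructor carries
  the variable adjoined last.\<close>

context
  notes [[typedef_overloaded]]
begin

datatype 'r rav = Rav (reg: "'r fps") (sing: "nat \<Rightarrow>\<^sub>0 'r")

end

definition rav_nth :: "'r::zero rav \<Rightarrow> int \<Rightarrow> 'r" where
  "rav_nth x m = (if m < 0 then reg x $ nat (- m - 1) else Poly_Mapping.lookup (sing x) (nat m))"

lemma rav_eqI: "(\<And>n. reg x $ n = reg y $ n) \<Longrightarrow>
    (\<And>n. Poly_Mapping.lookup (sing x) n = Poly_Mapping.lookup (sing y) n) \<Longrightarrow> x = y"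
  by (cases x; cases y) (auto intro!: fps_ext poly_mapping_eqI)

text \<open>The products of a power series with a singular part, from
  \<open>z^i Omega^m = Omega^(m-i)\<close> for \<open>i \<le> m\<close> and 0 otherwise.\<close>

lift_definition sing_lmult :: "'r::semiring_0 fps \<Rightarrow> (nat \<Rightarrow>\<^sub>0 'r) \<Rightarrow> (nat \<Rightarrow>\<^sub>0 'r)" is
  "\<lambda>f g n. \<Sum>m | g m \<noteq> 0 \<and> n \<le> m. f $ (m - n) * g m"
proof -
  fix f :: "'r fps" and g :: "nat \<Rightarrow> 'r"
  assume fin: "finite {x. g x \<noteq> 0}"
  have "{n. (\<Sum>m | g m \<noteq> 0 \<and> n \<le> m. f $ (m - n) * g m) \<noteq> 0} \<subseteq> (\<Union>m\<in>{x. g x \<noteq> 0}. {..m})"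
    by (auto elim!: sum.not_neutral_contains_not_neutral)
  then show "finite {n. (\<Sum>m | g m \<noteq> 0 \<and> n \<le> m. f $ (m - n) * g m) \<noteq> 0}"
    by (rule finite_subset) (use fin in auto)
qed

lift_definition sing_rmult :: "(nat \<Rightarrow>\<^sub>0 'r::semiring_0) \<Rightarrow> 'r fps \<Rightarrow> (nat \<Rightarrow>\<^sub>0 'r)" is
  "\<lambda>g f n. \<Sum>m | g m \<noteq> 0 \<and> n \<le> m. g m * f $ (m - n)"
proof -
  fix f :: "'r fps" and g :: "nat \<Rightarrow> 'r"
  assume fin: "finite {x. g x \<noteq> 0}"
  have "{n. (\<Sum>m | g m \<noteq> 0 \<and> n \<le> m. g m * f $ (m - n)) \<noteq> 0} \<subseteq> (\<Union>m\<in>{x. g x \<noteq> 0}. {..m})"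
    by (auto elim!: sum.not_neutral_contains_not_neutral)
  then show "finite {n. (\<Sum>m | g m \<noteq> 0 \<and> n \<le> m. g m * f $ (m - n)) \<noteq> 0}"
    by (rule finite_subset) (use fin in auto)
qed

lemma sing_bound: "\<exists>N. \<forall>n\<ge>N. Poly_Mapping.lookup (g :: nat \<Rightarrow>\<^sub>0 'r::zero) n = 0"
proof -
  have "finite (Poly_Mapping.keys g)" by simp
  then obtain N where "\<forall>n\<in>Poly_Mapping.keys g. n < N"
    using finite_nat_set_iff_bounded by blast
  then show ?thesis by (metis in_keys_iff linorder_not_less)
qed

lemma shift_sum:
  fixes F :: "nat \<Rightarrow> nat \<Rightarrow> 'r::comm_monoid_add"
  assumes "\<And>m. m \<ge> N \<Longrightarrow> g m = (0::'s::zero)" and "\<And>i m. g m = 0 \<Longrightarrow> F i m = 0"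
  shows "(\<Sum>m | g m \<noteq> 0 \<and> n \<le> m. F (m - n) m) = (\<Sum>i<N. F i (n + i))"
proof -
  have "(\<Sum>m | g m \<noteq> 0 \<and> n \<le> m. F (m - n) m) = (\<Sum>m\<in>(+) n ` {..<N}. F (m - n) m)"
  proof (rule sum.mono_neutral_left)
    show "{m. g m \<noteq> 0 \<and> n \<le> m} \<subseteq> (+) n ` {..<N}"
    proof
      fix m assume "m \<in> {m. g m \<noteq> 0 \<and> n \<le> m}"
      then have "g m \<noteq> 0" "n \<le> m" by auto
      then have "m < N" using assms(1) by (meson not_le)
      then show "m \<in> (+) n ` {..<N}" using \<open>n \<le> m\<close> by (intro image_eqI[of _ _ "m - n"]) auto
    qed
  qed (use assms(2) in auto)
  also have "\<dots> = (\<Sum>i<N. F i (n + i))" by (subst sum.reindex) auto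
  finally show ?thesis .
qed

lemma lookup_sing_lmult:
  assumes "\<And>m. m \<ge> N \<Longrightarrow> Poly_Mapping.lookup g m = 0"
  shows "Poly_Mapping.lookup (sing_lmult f g) n = (\<Sum>i<N. f $ i * Poly_Mapping.lookup g (n + i))"
  unfolding sing_lmult.rep_eq
  by (rule shift_sum[where g = "Poly_Mapping.lookup g"]) (use assms in auto)

lemma lookup_sing_rmult:
  assumes "\<And>m. m \<ge> N \<Longrightarrow> Poly_Mapping.lookup g m = 0"
  shows "Poly_Mapping.lookup (sing_rmult g f) n = (\<Sum>i<N. Poly_Mapping.lookup g (n + i) * f $ i)"
  unfolding sing_rmult.rep_eq
  by (rule shift_sum[where g = "Poly_Mapping.lookup g" and F = "\<lambda>i m. Poly_Mapping.lookup g m * f $ i"])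
    (use assms in auto)

lemma sing_lmult_add_left: "sing_lmult (f + f') g = sing_lmult f g + sing_lmult f' g"
  by (rule poly_mapping_eqI) (simp add: sing_lmult.rep_eq lookup_add sum.distrib distrib_right)

lemma sing_rmult_add_right: "sing_rmult g (f + f') = sing_rmult g f + sing_rmult g f'"
  by (rule poly_mapping_eqI) (simp add: sing_rmult.rep_eq lookup_add sum.distrib distrib_left)

lemma sing_bound2:
  obtains N where "\<And>m. m \<ge> N \<Longrightarrow> Poly_Mapping.lookup (g :: nat \<Rightarrow>\<^sub>0 'r::zero) m = 0"
    "\<And>m. m \<ge> N \<Longrightarrow> Poly_Mapping.lookup (g' :: nat \<Rightarrow>\<^sub>0 'r::zero) m = 0"
proof -
  obtain N N' where "\<forall>n\<ge>N. Poly_Mapping.lookup g n = 0" "\<forall>n\<ge>N'. Poly_Mapping.lookup g' n = 0"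
    using sing_bound by meson
  then show ?thesis by (intro that[of "max N N'"]) auto
qed

lemma sing_lmult_add_right: "sing_lmult f (g + g') = sing_lmult f g + sing_lmult f g'"
proof -
  obtain N where N: "\<And>m. m \<ge> N \<Longrightarrow> Poly_Mapping.lookup g m = 0"
    "\<And>m. m \<ge> N \<Longrightarrow> Poly_Mapping.lookup g' m = 0"
    using sing_bound2[of g g'] by blast
  then have "\<And>m. m \<ge> N \<Longrightarrow> Poly_Mapping.lookup (g + g') m = 0" by (simp add: lookup_add)
  with N show ?thesis
    by (intro poly_mapping_eqI)
      (simp add: lookup_sing_lmult[of N] lookup_add distrib_left sum.distrib)
qed

lemma sing_rmult_add_left: "sing_rmult (g + g') f = sing_rmult g f + sing_rmult g' f"
proof -
  obtain N where N: "\<And>m. m \<ge> N \<Longrightarrow> Poly_Mapping.lookup g m = 0"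
    "\<And>m. m \<ge> N \<Longrightarrow> Poly_Mapping.lookup g' m = 0"
    using sing_bound2[of g g'] by blast
  then have "\<And>m. m \<ge> N \<Longrightarrow> Poly_Mapping.lookup (g + g') m = 0" by (simp add: lookup_add)
  with N show ?thesis
    by (intro poly_mapping_eqI)
      (simp add: lookup_sing_rmult[of N] lookup_add distrib_right sum.distrib)
qed

lemma triangle_square:
  fixes F :: "nat \<Rightarrow> nat \<Rightarrow> 'r::comm_monoid_add"
  assumes "\<And>i j. i + j \<ge> N \<Longrightarrow> F i j = 0"
  shows "(\<Sum>k<N. \<Sum>i\<le>k. F i (k - i)) = (\<Sum>i<N. \<Sum>j<N. F i j)"
proof -
  have "(\<Sum>i<N. \<Sum>j<N. F i j) = (\<Sum>(i,j)\<in>{..<N}\<times>{..<N}. F i j)"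
    by (simp add: sum.cartesian_product)
  also have "\<dots> = (\<Sum>(i,j)\<in>{(i,j). i + j < N}. F i j)"
    by (rule sum.mono_neutral_right) (auto, meson assms not_le)
  also have "\<dots> = (\<Sum>k<N. \<Sum>i\<le>k. F i (k - i))"
    by (rule sum.triangle_reindex)
  finally show ?thesis by simp
qed

lemma sing_lmult_mult: "sing_lmult (f * f') g = sing_lmult f (sing_lmult f' (g::nat \<Rightarrow>\<^sub>0 'r::semiring_0))"
proof (rule poly_mapping_eqI)
  fix n
  obtain N where N: "\<And>m. m \<ge> N \<Longrightarrow> Poly_Mapping.lookup g m = 0"
    using sing_bound by blast
  have N': "\<And>m. m \<ge> N \<Longrightarrow> Poly_Mapping.lookup (sing_lmult f' g) m = 0"
    by (simp add: lookup_sing_lmult[OF N] N)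
  have "Poly_Mapping.lookup (sing_lmult (f * f') g) n
      = (\<Sum>k<N. \<Sum>i\<le>k. f $ i * (f' $ (k - i) * Poly_Mapping.lookup g (n + i + (k - i))))"
    by (subst lookup_sing_lmult[OF N])
      (auto simp: fps_mult_nth sum_distrib_right mult.assoc atLeast0AtMost intro!: sum.cong)
  also have "\<dots> = (\<Sum>i<N. \<Sum>j<N. f $ i * (f' $ j * Poly_Mapping.lookup g (n + i + j)))"
    by (rule triangle_square) (simp add: N)
  also have "\<dots> = Poly_Mapping.lookup (sing_lmult f (sing_lmult f' g)) n"
    by (simp add: lookup_sing_lmult[OF N] lookup_sing_lmult[OF N'] sum_distrib_left)
  finally show "Poly_Mapping.lookup (sing_lmult (f * f') g) n
      = Poly_Mapping.lookup (sing_lmult f (sing_lmult f' g)) n" .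
qed

lemma sing_rmult_mult: "sing_rmult (g::nat \<Rightarrow>\<^sub>0 'r::semiring_0) (f * f') = sing_rmult (sing_rmult g f) f'"
proof (rule poly_mapping_eqI)
  fix n
  obtain N where N: "\<And>m. m \<ge> N \<Longrightarrow> Poly_Mapping.lookup g m = 0"
    using sing_bound by blast
  have N': "\<And>m. m \<ge> N \<Longrightarrow> Poly_Mapping.lookup (sing_rmult g f) m = 0"
    by (simp add: lookup_sing_rmult[OF N] N)
  have "Poly_Mapping.lookup (sing_rmult g (f * f')) n
      = (\<Sum>k<N. \<Sum>i\<le>k. Poly_Mapping.lookup g (n + (k - i) + i) * (f $ i * f' $ (k - i)))"
    by (subst lookup_sing_rmult[OF N])
      (auto simp: fps_mult_nth sum_distrib_left atLeast0AtMost intro!: sum.cong)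
  also have "\<dots> = (\<Sum>i<N. \<Sum>j<N. Poly_Mapping.lookup g (n + j + i) * (f $ i * f' $ j))"
    by (rule triangle_square) (simp add: N)
  also have "\<dots> = (\<Sum>j<N. \<Sum>i<N. Poly_Mapping.lookup g (n + j + i) * f $ i * f' $ j)"
    by (subst sum.swap) (simp add: mult.assoc)
  also have "\<dots> = Poly_Mapping.lookup (sing_rmult (sing_rmult g f) f') n"
    by (simp add: lookup_sing_rmult[OF N] lookup_sing_rmult[OF N'] sum_distrib_right)
  finally show "Poly_Mapping.lookup (sing_rmult g (f * f')) n
      = Poly_Mapping.lookup (sing_rmult (sing_rmult g f) f') n" .
qed

lemma sing_lmult_rmult: "sing_lmult f (sing_rmult g f') = sing_rmult (sing_lmult f g) (f' :: 'r::semiring_0 fps)"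
proof (rule poly_mapping_eqI)
  fix n
  obtain N where N: "\<And>m. m \<ge> N \<Longrightarrow> Poly_Mapping.lookup g m = 0"
    using sing_bound by blast
  have N': "\<And>m. m \<ge> N \<Longrightarrow> Poly_Mapping.lookup (sing_rmult g f') m = 0"
    by (simp add: lookup_sing_rmult[OF N] N)
  have N'': "\<And>m. m \<ge> N \<Longrightarrow> Poly_Mapping.lookup (sing_lmult f g) m = 0"
    by (simp add: lookup_sing_lmult[OF N] N)
  show "Poly_Mapping.lookup (sing_lmult f (sing_rmult g f')) n
      = Poly_Mapping.lookup (sing_rmult (sing_lmult f g) f') n"
    by (simp add: lookup_sing_lmult[OF N] lookup_sing_rmult[OF N] lookup_sing_rmult[OF N'']
        lookup_sing_lmult[OF N'] sum_distrib_left sum_distrib_right mult.assoc add_ac)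
      (subst sum.swap, simp add: add_ac)
qed

lemma sing_mult_zero [simp]: "sing_lmult f 0 = 0" "sing_rmult 0 f = 0"
    "sing_lmult 0 g = 0" "sing_rmult g 0 = 0"
  by (rule poly_mapping_eqI; simp add: sing_lmult.rep_eq sing_rmult.rep_eq)+

lemma sing_mult_one [simp]: "sing_lmult 1 g = g" "sing_rmult g 1 = (g :: nat \<Rightarrow>\<^sub>0 'r::semiring_1)"
proof -
  obtain N where N: "\<And>m. m \<ge> N \<Longrightarrow> Poly_Mapping.lookup g m = 0"
    using sing_bound by blast
  then have N': "\<And>m. m \<ge> Suc N \<Longrightarrow> Poly_Mapping.lookup g m = 0" by simp
  show "sing_lmult 1 g = g"
    by (rule poly_mapping_eqI) (simp add: lookup_sing_lmult[OF N'] sum.lessThan_Suc_shift del: sum.lessThan_Suc)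
  show "sing_rmult g 1 = g"
    by (rule poly_mapping_eqI) (simp add: lookup_sing_rmult[OF N'] sum.lessThan_Suc_shift del: sum.lessThan_Suc)
qed

lemma lookup_pm_map: "h 0 = 0 \<Longrightarrow> Poly_Mapping.lookup (Poly_Mapping.map h p) k = h (Poly_Mapping.lookup p k)"
  by (auto simp: Poly_Mapping.map.rep_eq when_def)

lemma pm_map_add: "(\<And>x y. h (x + y) = h x + h y) \<Longrightarrow> h 0 = (0::'b::monoid_add) \<Longrightarrow>
  Poly_Mapping.map h (p + q) = Poly_Mapping.map h p + Poly_Mapping.map h (q :: _ \<Rightarrow>\<^sub>0 'a::monoid_add)"
  by (rule poly_mapping_eqI) (simp add: lookup_pm_map lookup_add)

instantiation rav :: (super_ring) super_ring
begin

definition zero_rav :: "'a rav" where "0 = Rav 0 0"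
definition one_rav :: "'a rav" where "1 = Rav 1 0"
definition plus_rav :: "'a rav \<Rightarrow> 'a rav \<Rightarrow> 'a rav" where
  "x + y = Rav (reg x + reg y) (sing x + sing y)"
definition minus_rav :: "'a rav \<Rightarrow> 'a rav \<Rightarrow> 'a rav" where
  "x - y = Rav (reg x - reg y) (sing x - sing y)"
definition uminus_rav :: "'a rav \<Rightarrow> 'a rav" where
  "- x = Rav (- reg x) (- sing x)"
(* (z^i r)(Omega^m s) = Omega^(m-i) (-1)^|r| r s, since r has to move past Omega *)
definition times_rav :: "'a rav \<Rightarrow> 'a rav \<Rightarrow> 'a rav" where
  "x * y = Rav (reg x * reg y)
     (sing_lmult (fps_map pari (reg x)) (sing y) + sing_rmult (sing x) (reg y))"
(* Omega is odd, hence the sign on the singular part *)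
definition pari_rav :: "'a rav \<Rightarrow> 'a rav" where
  "pari x = Rav (fps_map pari (reg x)) (- Poly_Mapping.map pari (sing x))"

lemma fps_map_pari_mult: "fps_map pari (f * g :: 'a fps) = fps_map pari f * fps_map pari g"
  by (rule fps_ext) (simp add: fps_mult_nth pari_sum pari_mult)

lemma fps_map_pari_add: "fps_map pari (f + g :: 'a fps) = fps_map pari f + fps_map pari g"
  by (rule fps_ext) (simp add: pari_add)

lemma fps_map_pari_one: "fps_map pari (1 :: 'a fps) = 1"
  by (rule fps_ext) simp

lemma fps_map_pari_zero: "fps_map pari (0 :: 'a fps) = 0"
  by (rule fps_ext) simp

lemma pari_lmult: "Poly_Mapping.map pari (sing_lmult f (g :: nat \<Rightarrow>\<^sub>0 'a)) 
   = sing_lmult (fps_map pari f) (Poly_Mapping.map pari g)"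
proof (rule poly_mapping_eqI)
  fix n
  obtain N where N: "\<And>m. m \<ge> N \<Longrightarrow> Poly_Mapping.lookup g m = 0"
    using sing_bound by blast
  then have N': "\<And>m. m \<ge> N \<Longrightarrow> Poly_Mapping.lookup (Poly_Mapping.map pari g) m = 0"
    by (simp add: lookup_pm_map)
  show "Poly_Mapping.lookup (Poly_Mapping.map pari (sing_lmult f g)) n 
   = Poly_Mapping.lookup (sing_lmult (fps_map pari f) (Poly_Mapping.map pari g)) n"
    by (simp add: lookup_pm_map lookup_sing_lmult[OF N] lookup_sing_lmult[OF N'] pari_sum pari_mult)
qed

lemma pari_rmult: "Poly_Mapping.map pari (sing_rmult (g :: nat \<Rightarrow>\<^sub>0 'a) f) 
   = sing_rmult (Poly_Mapping.map pari g) (fps_map pari f)"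
proof (rule poly_mapping_eqI)
  fix n
  obtain N where N: "\<And>m. m \<ge> N \<Longrightarrow> Poly_Mapping.lookup g m = 0"
    using sing_bound by blast
  then have N': "\<And>m. m \<ge> N \<Longrightarrow> Poly_Mapping.lookup (Poly_Mapping.map pari g) m = 0"
    by (simp add: lookup_pm_map)
  show "Poly_Mapping.lookup (Poly_Mapping.map pari (sing_rmult g f)) n 
   = Poly_Mapping.lookup (sing_rmult (Poly_Mapping.map pari g) (fps_map pari f)) n"
    by (simp add: lookup_pm_map lookup_sing_rmult[OF N] lookup_sing_rmult[OF N'] pari_sum pari_mult)
qed

lemma sing_lmult_uminus: "sing_lmult f (- g :: nat \<Rightarrow>\<^sub>0 'a) = - sing_lmult f g"
  using sing_lmult_add_right[of f g "- g"] by (simp add: eq_neg_iff_add_eq_0 add.commute)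

lemma sing_rmult_uminus: "sing_rmult (- g :: nat \<Rightarrow>\<^sub>0 'a) f = - sing_rmult g f"
  using sing_rmult_add_left[of g "- g" f] by (simp add: eq_neg_iff_add_eq_0 add.commute)

instance
proof
  fix x y z :: "'a rav"
  note defs = zero_rav_def one_rav_def plus_rav_def minus_rav_def uminus_rav_def times_rav_def pari_rav_def
  show "x * y * z = x * (y * z)"
    by (simp add: defs mult.assoc fps_map_pari_mult sing_lmult_mult sing_rmult_mult sing_lmult_rmult
        sing_lmult_add_right sing_rmult_add_left add.assoc)
  show "(x + y) * z = x * z + y * z"
    by (simp add: defs distrib_right sing_lmult_add_left sing_rmult_add_left fps_map_pari_add)
  show "x * (y + z) = x * y + x * z"
    by (simp add: defs distrib_left sing_lmult_add_right sing_rmult_add_right)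
  show "1 * x = x" "x * 1 = x"
    by (simp_all add: defs fps_map_pari_one)
  show "(0::'a rav) \<noteq> 1" by (simp add: defs)
  show "pari (x + y) = pari x + pari y"
    by (simp add: defs fps_map_pari_add pm_map_add[of pari] pari_add)
  show "pari (1 :: 'a rav) = 1"
    by (simp add: defs fps_map_pari_one poly_mapping_eqI lookup_pm_map)
  show "pari (x * y) = pari x * pari y"
    by (simp add: defs fps_map_pari_mult pari_lmult pari_rmult pm_map_add[of pari] pari_add
       sing_lmult_uminus sing_rmult_uminus)
  show "pari (pari x) = x"
    by (rule rav_eqI) (simp_all add: defs lookup_pm_map pari_minus)
qed (simp_all add: plus_rav_def zero_rav_def minus_rav_def uminus_rav_def add_ac rav.expand)

end

section \<open>Free algebras, two-sided ideals and derivations\<close>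

text \<open>With words as exponents, \<open>'g list \<Rightarrow>\<^sub>0 'r\<close> with its convolution product is the free
  associative algebra on the generators \<open>'g\<close> over \<open>'r\<close>.\<close>

instantiation list :: (type) monoid_add
begin
definition zero_list :: "'a list" where "0 = []"
definition plus_list :: "'a list \<Rightarrow> 'a list \<Rightarrow> 'a list" where "xs + ys = xs @ ys"
instance by standard (simp_all add: zero_list_def plus_list_def)
end

type_synonym ('g, 'r) free_alg = "'g list \<Rightarrow>\<^sub>0 'r"

definition fgen :: "'g \<Rightarrow> ('g, 'r::zero_neq_one) free_alg" where
  "fgen a = Poly_Mapping.single [a] 1"

definition fscal :: "'r::zero \<Rightarrow> ('g, 'r) free_alg" where
  "fscal c = Poly_Mapping.single [] c"

definition feval :: "('r::zero \<Rightarrow> 'a::semiring_1) \<Rightarrow> ('g \<Rightarrow> 'a) \<Rightarrow> ('g, 'r) free_alg \<Rightarrow> 'a" where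
  "feval h g p = (\<Sum>w\<in>Poly_Mapping.keys p. h (Poly_Mapping.lookup p w) * prod_list (map g w))"

text \<open>\<open>fderiv dc dg\<close> is the (even) derivation that is \<open>dc\<close> on coefficients and \<open>dg\<close> on
  generators.\<close>

fun word_deriv :: "('g \<Rightarrow> ('g, 'r::semiring_1) free_alg) \<Rightarrow> 'g list \<Rightarrow> ('g, 'r) free_alg" where
  "word_deriv dg [] = 0"
| "word_deriv dg (a # w) = dg a * Poly_Mapping.single w 1 + fgen a * word_deriv dg w"

definition fderiv :: "('r \<Rightarrow> 'r) \<Rightarrow> ('g \<Rightarrow> ('g, 'r) free_alg) \<Rightarrow> ('g, 'r::semiring_1) free_alg \<Rightarrow> ('g, 'r) free_alg" where
  "fderiv dc dg p = (\<Sum>w\<in>Poly_Mapping.keys p.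
     Poly_Mapping.single w (dc (Poly_Mapping.lookup p w)) + fscal (Poly_Mapping.lookup p w) * word_deriv dg w)"

inductive_set two_sided_ideal :: "'a::ring_1 set \<Rightarrow> 'a set" for R where
  zero: "0 \<in> two_sided_ideal R"
| step: "r \<in> R \<Longrightarrow> x \<in> two_sided_ideal R \<Longrightarrow> a * r * b + x \<in> two_sided_ideal R"

lemma pm_induct [case_names zero single add]:
  fixes p :: "'a \<Rightarrow>\<^sub>0 'b::comm_monoid_add"
  assumes "P 0" "\<And>k c. P (Poly_Mapping.single k c)" "\<And>p q. P p \<Longrightarrow> P q \<Longrightarrow> P (p + q)"
  shows "P p"
proof -
  have eq: "p = (\<Sum>k\<in>Poly_Mapping.keys p. Poly_Mapping.single k (Poly_Mapping.lookup p k))"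
    by (rule poly_mapping_eqI) (simp add: lookup_sum lookup_single when_def in_keys_iff)
  have "P (\<Sum>k\<in>K. Poly_Mapping.single k (Poly_Mapping.lookup p k))" if "finite K" for K
    using that by (induction K) (simp_all add: assms)
  then show ?thesis by (subst eq) simp
qed

lemma ideal_add: "x \<in> two_sided_ideal R \<Longrightarrow> y \<in> two_sided_ideal R \<Longrightarrow> x + y \<in> two_sided_ideal R"
  by (induction x rule: two_sided_ideal.induct) (auto simp: add.assoc intro: two_sided_ideal.intros)

lemma ideal_lmult: "x \<in> two_sided_ideal R \<Longrightarrow> c * x \<in> two_sided_ideal R"
proof (induction x rule: two_sided_ideal.induct)
  case (step r x a b)
  then have "(c * a) * r * b + c * x \<in> two_sided_ideal R" by (intro two_sided_ideal.step)
  then show ?case by (simp add: algebra_simps)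
qed (simp add: two_sided_ideal.zero)

lemma ideal_rmult: "x \<in> two_sided_ideal R \<Longrightarrow> x * c \<in> two_sided_ideal R"
proof (induction x rule: two_sided_ideal.induct)
  case (step r x a b)
  then have "a * r * (b * c) + x * c \<in> two_sided_ideal R" by (intro two_sided_ideal.step)
  then show ?case by (simp add: algebra_simps)
qed (simp add: two_sided_ideal.zero)

lemma ideal_uminus: "x \<in> two_sided_ideal R \<Longrightarrow> - x \<in> two_sided_ideal R"
  using ideal_lmult[of x R "- 1"] by simp

lemma ideal_diff: "x \<in> two_sided_ideal R \<Longrightarrow> y \<in> two_sided_ideal R \<Longrightarrow> x - y \<in> two_sided_ideal R"
  using ideal_add[of x R "- y"] ideal_uminus[of y R] by simp

lemma ideal_gen: "r \<in> R \<Longrightarrow> r \<in> two_sided_ideal R"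
  using two_sided_ideal.step[of r R 0 1 1] by (simp add: two_sided_ideal.zero)

lemma ideal_equivp: "equivp (\<lambda>p q. p - q \<in> two_sided_ideal R)"
proof (rule equivpI)
  show "reflp (\<lambda>p q. p - q \<in> two_sided_ideal R)" by (auto intro!: reflpI two_sided_ideal.zero)
  show "symp (\<lambda>p q. p - q \<in> two_sided_ideal R)"
    by (rule sympI) (metis ideal_uminus minus_diff_eq)
  show "transp (\<lambda>p q. p - q \<in> two_sided_ideal R)"
  proof (rule transpI)
    fix x y z assume "x - y \<in> two_sided_ideal R" "y - z \<in> two_sided_ideal R"
    from ideal_add[OF this] show "x - z \<in> two_sided_ideal R" by simp
  qed
qed

locale free_hom =
  fixes h :: "'r::semiring_1 \<Rightarrow> 'a::semiring_1" and g :: "'g \<Rightarrow> 'a"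
  assumes h_zero: "h 0 = 0" and h_one: "h 1 = 1" and h_add: "h (x + y) = h x + h y"
    and h_mult: "h (x * y) = h x * h y" and h_central: "h x * a = a * h x"
begin

lemma feval_zero: "feval h g 0 = 0" by (simp add: feval_def)

lemma feval_add: "feval h g (p + q) = feval h g p + feval h g q"
  unfolding feval_def by (rule setsum_keys_plus_distrib) (simp_all add: h_zero h_add distrib_right)

lemma feval_single: "feval h g (Poly_Mapping.single w c) = h c * prod_list (map g w)"
  by (cases "c = 0") (simp_all add: feval_def h_zero)

lemma feval_mult: "feval h g (p * q) = feval h g p * feval h g q"
proof (induction p rule: pm_induct)
  case (single w c)
  show ?case
  proof (induction q rule: pm_induct)
    case (single v d)
    have "h c * h d * (prod_list (map g w) * prod_list (map g v))
       = h c * (h d * prod_list (map g w)) * prod_list (map g v)"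
      by (simp add: mult.assoc)
    also have "\<dots> = h c * (prod_list (map g w) * h d) * prod_list (map g v)"
      by (simp add: h_central)
    finally show ?case
      by (simp add: mult_single feval_single h_mult plus_list_def mult.assoc)
  qed (simp_all add: feval_zero feval_add distrib_left)
qed (simp_all add: feval_zero feval_add distrib_right)

lemma feval_fgen: "feval h g (fgen a) = g a"
  by (simp add: fgen_def feval_single h_one)

lemma feval_fscal: "feval h g (fscal c) = h c"
  by (simp add: fscal_def feval_single)

lemma feval_one: "feval h g 1 = 1"
  using feval_single[of "[]" 1] by (simp add: h_one single_one[symmetric] zero_list_def del: single_one)

lemma feval_of_nat: "feval h g (of_nat n) = of_nat n"
  by (induction n) (simp_all add: feval_zero feval_add feval_one)

lemma feval_deriv:
  assumes D_add: "\<And>x y. D (x + y) = D x + D y" and D_zero: "D 0 = 0" and D_one: "D 1 = 0"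
    and D_mult: "\<And>x y. D (x * y) = D x * y + x * D y"
    and dc: "\<And>c. h (dc c) = D (h c)" and dg: "\<And>a. feval h g (dg a) = D (g a)"
  shows "feval h g (fderiv dc dg p) = D (feval h g p)"
proof -
  have word: "feval h g (word_deriv dg w) = D (prod_list (map g w))" for w
    by (induction w)
      (simp_all add: feval_zero D_one feval_add feval_mult dg feval_single h_one D_mult feval_fgen)
  have sum: "D (sum F K) = (\<Sum>k\<in>K. D (F k))" "feval h g (sum G K) = (\<Sum>k\<in>K. feval h g (G k))"
    for F G and K :: "'g list set"
    by (induction K rule: infinite_finite_induct) (simp_all add: D_add D_zero feval_zero feval_add)
  show ?thesis
    unfolding fderiv_def sum
    by (simp add: feval_def[of h g p] sum feval_add feval_mult feval_fscal feval_single word D_mult dc)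
qed

end


locale free_hom_ring = free_hom h g for h :: "'r::ring_1 \<Rightarrow> 'a::ring_1" and g :: "'g \<Rightarrow> 'a"
begin

lemma feval_uminus: "feval h g (- p) = - feval h g p"
  using feval_add[of p "- p"] by (simp add: feval_zero eq_neg_iff_add_eq_0 add.commute)

lemma feval_diff: "feval h g (p - q) = feval h g p - feval h g q"
  using feval_add[of p "- q"] by (simp add: feval_uminus)

lemma feval_ideal:
  assumes "\<And>r. r \<in> R \<Longrightarrow> feval h g r = 0" "p \<in> two_sided_ideal R"
  shows "feval h g p = 0"
  using assms(2) by induction (simp_all add: feval_zero feval_add feval_mult assms(1))

end

section \<open>Derivations of raviolo functions\<close>

text \<open>\<open>d Omega^m = -(m+1) Omega^(m+1)\<close>.\<close>

lift_definition sing_deriv :: "(nat \<Rightarrow>\<^sub>0 'r::ring_1) \<Rightarrow> (nat \<Rightarrow>\<^sub>0 'r)" is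
  "\<lambda>g n. - (of_nat n * g (n - 1))"
proof -
  fix g :: "nat \<Rightarrow> 'r" assume "finite {x. g x \<noteq> 0}"
  moreover have "{x. - (of_nat x * g (x - 1)) \<noteq> 0} \<subseteq> Suc ` {x. g x \<noteq> 0}"
  proof
    fix x assume "x \<in> {x. - (of_nat x * g (x - 1)) \<noteq> 0}"
    then have "x \<noteq> 0" "g (x - 1) \<noteq> 0" by (auto intro: Nat.gr0I)
    then show "x \<in> Suc ` {x. g x \<noteq> 0}" by (intro image_eqI[of _ _ "x - 1"]) auto
  qed
  ultimately show "finite {x. - (of_nat x * g (x - 1)) \<noteq> 0}"
    by (meson finite_imageI finite_subset)
qed

definition rav_deriv :: "'r::super_ring rav \<Rightarrow> 'r rav" where
  "rav_deriv x = Rav (fps_deriv (reg x)) (sing_deriv (sing x))"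

definition rav_map :: "('r::zero \<Rightarrow> 's::zero) \<Rightarrow> 'r rav \<Rightarrow> 's rav" where
  "rav_map h x = Rav (fps_map h (reg x)) (Poly_Mapping.map h (sing x))"

definition rav_const :: "'r::zero \<Rightarrow> 'r rav" where
  "rav_const r = Rav (fps_const r) 0"

definition rav_Om :: "nat \<Rightarrow> 'r::zero_neq_one rav" where
  "rav_Om n = Rav 0 (Poly_Mapping.single n 1)"

lemmas rav_defs = zero_rav_def one_rav_def plus_rav_def minus_rav_def uminus_rav_def times_rav_def pari_rav_def

context super_ring
begin
lemma pari_of_nat [simp]: "pari (of_nat n) = of_nat n"
  by (induction n) (simp_all add: pari_add)
end

lemma shift_deriv_sum:
  fixes f g :: "nat \<Rightarrow> 'r::ring_1"
  assumes "\<And>m. m \<ge> N \<Longrightarrow> g m = 0"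
  shows "- (of_nat n * (\<Sum>i<N. f i * g (n - 1 + i))) =
    (\<Sum>i<N. of_nat (i + 1) * f (i + 1) * g (n + i)) + (\<Sum>i<Suc N. f i * - (of_nat (n + i) * g (n + i - 1)))"
proof -
  have c: "f i * (of_nat k * x) = of_nat k * (f i * x)" for i k x
    by (metis mult.assoc mult_of_nat_commute)
  have "(\<Sum>i<Suc N. f i * - (of_nat (n + i) * g (n + i - 1)))
     = - (\<Sum>i<Suc N. of_nat n * (f i * g (n + i - 1))) - (\<Sum>i<Suc N. of_nat i * (f i * g (n + i - 1)))"
    by (simp add: c distrib_right sum.distrib sum_negf sum_subtractf algebra_simps del: sum.lessThan_Suc)
  also have "(\<Sum>i<Suc N. of_nat i * (f i * g (n + i - 1))) = (\<Sum>i<N. of_nat (i + 1) * f (i + 1) * g (n + i))"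
    by (subst sum.lessThan_Suc_shift) (simp add: mult.assoc)
  also have "(\<Sum>i<Suc N. of_nat n * (f i * g (n + i - 1))) = of_nat n * (\<Sum>i<N. f i * g (n - 1 + i))"
  proof (cases n)
    case (Suc k)
    then show ?thesis using assms[of "k + N"] by (simp add: sum_distrib_left distrib_left)
  qed simp
  finally show ?thesis by simp
qed

lemma shift_deriv_sum':
  fixes f g :: "nat \<Rightarrow> 'r::ring_1"
  assumes "\<And>m. m \<ge> N \<Longrightarrow> g m = 0"
  shows "- (of_nat n * (\<Sum>i<N. g (n - 1 + i) * f i)) =
    (\<Sum>i<Suc N. - (of_nat (n + i) * g (n + i - 1)) * f i) + (\<Sum>i<N. g (n + i) * (of_nat (i + 1) * f (i + 1)))"
proof -
  have c: "g i * (of_nat k * x) = of_nat k * (g i * x)" for i k x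
    by (metis mult.assoc mult_of_nat_commute)
  have "(\<Sum>i<Suc N. - (of_nat (n + i) * g (n + i - 1)) * f i)
     = - (\<Sum>i<Suc N. of_nat n * (g (n + i - 1) * f i)) - (\<Sum>i<Suc N. of_nat i * (g (n + i - 1) * f i))"
    by (simp add: c distrib_right sum.distrib sum_negf sum_subtractf algebra_simps del: sum.lessThan_Suc)
  also have "(\<Sum>i<Suc N. of_nat i * (g (n + i - 1) * f i)) = (\<Sum>i<N. g (n + i) * (of_nat (i + 1) * f (i + 1)))"
    unfolding c by (subst sum.lessThan_Suc_shift) simp
  also have "(\<Sum>i<Suc N. of_nat n * (g (n + i - 1) * f i)) = of_nat n * (\<Sum>i<N. g (n - 1 + i) * f i)"
  proof (cases n)
    case (Suc k)
    then show ?thesis using assms[of "k + N"] by (simp add: sum_distrib_left distrib_left)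
  qed simp
  finally show ?thesis by simp
qed

lemma sing_deriv_lmult:
  fixes f :: "'r::super_ring fps"
  shows "sing_deriv (sing_lmult f g) = sing_lmult (fps_deriv f) g + sing_lmult f (sing_deriv g)"
proof (rule poly_mapping_eqI)
  fix n
  obtain N where N: "\<And>m. m \<ge> N \<Longrightarrow> Poly_Mapping.lookup g m = 0"
    using sing_bound by blast
  then have N': "\<And>m. m \<ge> Suc N \<Longrightarrow> Poly_Mapping.lookup (sing_deriv g) m = 0"
    by (simp add: sing_deriv.rep_eq)
  show "Poly_Mapping.lookup (sing_deriv (sing_lmult f g)) n =
      Poly_Mapping.lookup (sing_lmult (fps_deriv f) g + sing_lmult f (sing_deriv g)) n"
    by (simp only: lookup_add lookup_sing_lmult[OF N'] lookup_sing_lmult[OF N] sing_deriv.rep_eq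
      fps_deriv_nth) (rule shift_deriv_sum, erule N)
qed

lemma sing_deriv_rmult:
  fixes f :: "'r::super_ring fps"
  shows "sing_deriv (sing_rmult g f) = sing_rmult (sing_deriv g) f + sing_rmult g (fps_deriv f)"
proof (rule poly_mapping_eqI)
  fix n
  obtain N where N: "\<And>m. m \<ge> N \<Longrightarrow> Poly_Mapping.lookup g m = 0"
    using sing_bound by blast
  then have N': "\<And>m. m \<ge> Suc N \<Longrightarrow> Poly_Mapping.lookup (sing_deriv g) m = 0"
    by (simp add: sing_deriv.rep_eq)
  show "Poly_Mapping.lookup (sing_deriv (sing_rmult g f)) n =
      Poly_Mapping.lookup (sing_rmult (sing_deriv g) f + sing_rmult g (fps_deriv f)) n"
    by (simp only: lookup_add lookup_sing_rmult[OF N'] lookup_sing_rmult[OF N] sing_deriv.rep_eq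
      fps_deriv_nth) (rule shift_deriv_sum', erule N)
qed

lemma sing_deriv_add: "sing_deriv (g + g') = sing_deriv g + sing_deriv g'"
  by (rule poly_mapping_eqI) (simp add: sing_deriv.rep_eq lookup_add distrib_left)

lemma rav_deriv_add: "rav_deriv (x + y) = rav_deriv x + rav_deriv y"
  by (simp add: rav_deriv_def rav_defs sing_deriv_add)

lemma fps_map_pari_deriv: "fps_map pari (fps_deriv f) = fps_deriv (fps_map pari (f::'r::super_ring fps))"
  by (rule fps_ext) (simp add: pari_mult pari_add)

lemma rav_deriv_mult: "rav_deriv (x * y) = rav_deriv x * y + x * rav_deriv y"
  by (simp add: rav_deriv_def rav_defs sing_deriv_add sing_deriv_lmult sing_deriv_rmult fps_map_pari_deriv add_ac)

lemma rav_deriv_zero: "rav_deriv 0 = 0"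
  using rav_deriv_add[of 0 0] by simp

lemma rav_deriv_one: "rav_deriv 1 = 0"
  using rav_deriv_mult[of 1 1] by simp

lemma pari_rav_deriv: "pari (rav_deriv x) = rav_deriv (pari x)"
  by (rule rav_eqI)
    (simp_all add: rav_deriv_def rav_defs pari_mult pari_add lookup_pm_map sing_deriv.rep_eq pari_minus)

locale super_derivation =
  fixes D :: "'r::super_ring \<Rightarrow> 'r"
  assumes D_add: "D (x + y) = D x + D y" and D_mult: "D (x * y) = D x * y + x * D y"
    and D_pari: "pari (D x) = D (pari x)"
begin

lemma D_zero [simp]: "D 0 = 0" using D_add[of 0 0] by simp
lemma D_one [simp]: "D 1 = 0" using D_mult[of 1 1] by simp
lemma D_uminus: "D (- x) = - D x" using D_add[of x "- x"] by (simp add: eq_neg_iff_add_eq_0 add.commute)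
lemma D_diff: "D (x - y) = D x - D y" using D_add[of x "- y"] by (simp add: D_uminus)
lemma D_sum: "D (sum F K) = (\<Sum>k\<in>K. D (F k))"
  by (induction K rule: infinite_finite_induct) (simp_all add: D_add)

lemma D_fps_mult: "fps_map D (f * f') = fps_map D f * f' + f * fps_map D f'"
  by (rule fps_ext) (simp add: fps_mult_nth D_sum D_mult sum.distrib)

lemma D_lmult: "Poly_Mapping.map D (sing_lmult f g) = sing_lmult (fps_map D f) g + sing_lmult f (Poly_Mapping.map D g)"
proof (rule poly_mapping_eqI)
  fix n
  obtain N where N: "\<And>m. m \<ge> N \<Longrightarrow> Poly_Mapping.lookup g m = 0"
    using sing_bound by blast
  then have N': "\<And>m. m \<ge> N \<Longrightarrow> Poly_Mapping.lookup (Poly_Mapping.map D g) m = 0"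
    by (simp add: lookup_pm_map)
  show "Poly_Mapping.lookup (Poly_Mapping.map D (sing_lmult f g)) n = 
    Poly_Mapping.lookup (sing_lmult (fps_map D f) g + sing_lmult f (Poly_Mapping.map D g)) n"
    by (simp add: lookup_add lookup_pm_map lookup_sing_lmult[OF N] lookup_sing_lmult[OF N'] D_sum D_mult sum.distrib)
qed

lemma D_rmult: "Poly_Mapping.map D (sing_rmult g f) = sing_rmult (Poly_Mapping.map D g) f + sing_rmult g (fps_map D f)"
proof (rule poly_mapping_eqI)
  fix n
  obtain N where N: "\<And>m. m \<ge> N \<Longrightarrow> Poly_Mapping.lookup g m = 0"
    using sing_bound by blast
  then have N': "\<And>m. m \<ge> N \<Longrightarrow> Poly_Mapping.lookup (Poly_Mapping.map D g) m = 0"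
    by (simp add: lookup_pm_map)
  show "Poly_Mapping.lookup (Poly_Mapping.map D (sing_rmult g f)) n = 
    Poly_Mapping.lookup (sing_rmult (Poly_Mapping.map D g) f + sing_rmult g (fps_map D f)) n"
    by (simp add: lookup_add lookup_pm_map lookup_sing_rmult[OF N] lookup_sing_rmult[OF N'] D_sum D_mult sum.distrib)
qed

lemma super_derivation_rav_map: "super_derivation (rav_map D)"
proof
  fix x y :: "'r rav"
  have fa: "fps_map D (f + f') = fps_map D f + fps_map D f'" for f f'
    by (rule fps_ext) (simp add: D_add)
  have fp: "fps_map pari (fps_map D f) = fps_map D (fps_map pari f)" for f
    by (rule fps_ext) (simp add: D_pari)
  show "rav_map D (x + y) = rav_map D x + rav_map D y"
    by (simp add: rav_map_def rav_defs fa pm_map_add[of D] D_add)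
  show "rav_map D (x * y) = rav_map D x * y + x * rav_map D y"
    by (simp add: rav_map_def rav_defs fa pm_map_add[of D] D_add D_fps_mult D_lmult D_rmult fp add_ac)
  show "pari (rav_map D x) = rav_map D (pari x)"
    by (rule rav_eqI) (simp_all add: rav_map_def rav_defs lookup_pm_map D_pari D_uminus)
qed

end

interpretation rav_deriv: super_derivation rav_deriv
  by unfold_locales (simp_all add: rav_deriv_add rav_deriv_mult pari_rav_deriv)

interpretation rav_map_deriv: super_derivation "rav_map (rav_deriv :: 'a::super_ring rav \<Rightarrow> _)"
  by (rule rav_deriv.super_derivation_rav_map)

section \<open>The algebra of raviolo functions in z, w and z - w\<close>

text \<open>The three values stand for z, w and z - w. The ring \<open>C[[z,w]]\<close> is represented by
  \<open>complex fps fps\<close> with outer variable w; \<open>Om x n\<close> is \<open>Omega_x^n\<close>.\<close>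

datatype pt = Pz | Pw | Pzw

type_synonym czw = "complex fps fps"
type_synonym kzw_rep = "(pt \<times> nat, czw) free_alg"

definition var_z :: czw where "var_z = fps_const fps_X"
definition var_w :: czw where "var_w = fps_X"

fun pt_var :: "pt \<Rightarrow> czw" where
  "pt_var Pz = var_z"
| "pt_var Pw = var_w"
| "pt_var Pzw = var_z - var_w"

abbreviation Om :: "pt \<Rightarrow> nat \<Rightarrow> kzw_rep" where "Om x n \<equiv> fgen (x, n)"

fun gen_dz :: "pt \<times> nat \<Rightarrow> kzw_rep" where
  "gen_dz (Pz, n) = - (of_nat (n + 1) * Om Pz (n + 1))"
| "gen_dz (Pw, n) = 0"
| "gen_dz (Pzw, n) = - (of_nat (n + 1) * Om Pzw (n + 1))"

fun gen_dw :: "pt \<times> nat \<Rightarrow> kzw_rep" where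
  "gen_dw (Pz, n) = 0"
| "gen_dw (Pw, n) = - (of_nat (n + 1) * Om Pw (n + 1))"
| "gen_dw (Pzw, n) = of_nat (n + 1) * Om Pzw (n + 1)"

definition rep_dz :: "kzw_rep \<Rightarrow> kzw_rep" where "rep_dz = fderiv (fps_map fps_deriv) gen_dz"
definition rep_dw :: "kzw_rep \<Rightarrow> kzw_rep" where "rep_dw = fderiv fps_deriv gen_dw"

definition arnold :: kzw_rep where
  "arnold = Om Pzw 0 * Om Pz 0 + Om Pw 0 * Om Pzw 0 + Om Pz 0 * Om Pw 0"

text \<open>The first family makes the free associative algebra over \<open>C[[z,w]]\<close> on the odd generators
  graded commutative; the others are the relations imposed on the free graded commutative
  algebra.\<close>

definition kzw_rels :: "kzw_rep set" where
  "kzw_rels =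
     {Om x n * Om y m + Om y m * Om x n |x n y m. True}
   \<union> {fscal (pt_var x ^ n) * Om x m - Om x (m - n) |x n m. n \<le> m}
   \<union> {fscal (pt_var x ^ n) * Om x m |x n m. m < n}
   \<union> {Om x n * Om x m |x n m. True}
   \<union> {(rep_dz ^^ i) ((rep_dw ^^ j) arnold) |i j. True}"

quotient_type kzw = kzw_rep / "\<lambda>p q. p - q \<in> two_sided_ideal kzw_rels"
  by (rule ideal_equivp)

text \<open>Pole order in z - w at most N: the element is represented by an expression in which
  \<open>Omega_(z-w)^k\<close> occurs only for \<open>k < N\<close>.\<close>

lift_definition kzw_pole_le :: "nat \<Rightarrow> kzw \<Rightarrow> bool" is
  "\<lambda>N p. \<exists>q. p - q \<in> two_sided_ideal kzw_rels \<and>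
     (\<forall>u\<in>Poly_Mapping.keys q. \<forall>k\<ge>N. (Pzw, k) \<notin> set u)"
proof -
  fix N and p p' :: kzw_rep
  assume a: "p - p' \<in> two_sided_ideal kzw_rels"
  have "p - q \<in> two_sided_ideal kzw_rels \<longleftrightarrow> p' - q \<in> two_sided_ideal kzw_rels" for q
    using ideal_diff[OF _ a, of "p - q"] ideal_add[OF a, of "p' - q"] by (auto simp: algebra_simps)
  then show "(\<exists>q. p - q \<in> two_sided_ideal kzw_rels \<and> (\<forall>u\<in>Poly_Mapping.keys q. \<forall>k\<ge>N. (Pzw, k) \<notin> set u)) =
      (\<exists>q. p' - q \<in> two_sided_ideal kzw_rels \<and> (\<forall>u\<in>Poly_Mapping.keys q. \<forall>k\<ge>N. (Pzw, k) \<notin> set u))"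
    by simp
qed

text \<open>The expansions are algebra homomorphisms, given on coefficients and generators. For
  \<open>zw\<close> the inner variable of \<open>complex rav rav\<close> is z and the outer one w, for \<open>wz\<close> the other
  way round. In both cases \<open>rav_diag m\<close> is the sum over n of
  \<open>binomial (m+n) n * (outer variable)^n * Omega_(inner)^(m+n)\<close>.\<close>

definition fps_swap :: "'a fps fps \<Rightarrow> 'a fps fps" where
  "fps_swap F = Abs_fps (\<lambda>i. Abs_fps (\<lambda>j. F $ j $ i))"

definition rav_coef :: "czw \<Rightarrow> complex rav rav" where
  "rav_coef F = Rav (fps_map (\<lambda>f. Rav f 0) F) 0"

definition rav_diag :: "nat \<Rightarrow> complex rav rav" where
  "rav_diag m = Rav (Abs_fps (\<lambda>n. of_nat ((m + n) choose n) * rav_Om (m + n))) 0"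

fun gen_zw :: "pt \<times> nat \<Rightarrow> complex rav rav" where
  "gen_zw (Pz, n) = rav_const (rav_Om n)"
| "gen_zw (Pw, n) = rav_Om n"
| "gen_zw (Pzw, n) = rav_diag n"

fun gen_wz :: "pt \<times> nat \<Rightarrow> complex rav rav" where
  "gen_wz (Pz, n) = rav_Om n"
| "gen_wz (Pw, n) = rav_const (rav_Om n)"
| "gen_wz (Pzw, n) = (- 1) ^ n * rav_diag n"

definition rep_expand_zw :: "kzw_rep \<Rightarrow> complex rav rav" where
  "rep_expand_zw = feval rav_coef gen_zw"

definition rep_expand_wz :: "kzw_rep \<Rightarrow> complex rav rav" where
  "rep_expand_wz = feval (\<lambda>F. rav_coef (fps_swap F)) gen_wz"

lemma rav_central:
  assumes "\<And>n a. f $ n * a = a * f $ n" "\<And>n. pari (f $ n) = f $ n"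
  shows "Rav f 0 * x = x * Rav (f :: 'r::super_ring fps) 0"
proof -
  have 1: "fps_map pari f = f" by (rule fps_ext) (simp add: assms)
  have 2: "f * reg x = reg x * f"
    by (rule fps_ext, unfold fps_mult_nth, subst sum.atLeastAtMost_rev) (simp add: assms(1))
  have 3: "sing_lmult f g = sing_rmult g f" for g
    by (rule poly_mapping_eqI) (simp add: sing_lmult.rep_eq sing_rmult.rep_eq assms(1))
  show ?thesis by (simp add: times_rav_def 1 2 3)
qed

lemma rav_reg_mult: "Rav f 0 * Rav g 0 = Rav (f * g :: 'r::super_ring fps) 0"
  by (simp add: times_rav_def)

lemma rav_coef_central: "rav_coef F * x = x * rav_coef F"
  unfolding rav_coef_def
proof (rule rav_central)
  fix n and a :: "complex rav"
  show "fps_map (\<lambda>f. Rav f 0) F $ n * a = a * fps_map (\<lambda>f. Rav f 0) F $ n"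
    by (simp, rule rav_central) (simp_all add: pari_complex_def)
  show "pari (fps_map (\<lambda>f. Rav f (0 :: _ \<Rightarrow>\<^sub>0 complex)) F $ n) = fps_map (\<lambda>f. Rav f 0) F $ n"
    by (rule rav_eqI) (simp_all add: pari_rav_def pari_complex_def lookup_pm_map)
qed

lemma Rav_add: "Rav (f + g) 0 = Rav f 0 + Rav g (0 :: _ \<Rightarrow>\<^sub>0 'r::super_ring)"
  by (simp add: plus_rav_def)

lemma Rav_sum: "Rav (sum F K) 0 = (\<Sum>k\<in>K. Rav (F k) (0 :: _ \<Rightarrow>\<^sub>0 'r::super_ring))"
  by (induction K rule: infinite_finite_induct) (simp_all add: Rav_add, simp_all add: zero_rav_def)

lemma rav_coef_mult: "rav_coef (F * G) = rav_coef F * rav_coef G"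
  unfolding rav_coef_def rav_reg_mult
  by (simp, rule fps_ext) (simp add: fps_mult_nth Rav_sum rav_reg_mult)

lemma rav_coef_add: "rav_coef (F + G) = rav_coef F + rav_coef G"
  by (rule rav_eqI) (simp_all add: rav_coef_def rav_defs)

lemma rav_coef_zero: "rav_coef 0 = 0"
  by (rule rav_eqI) (simp_all add: rav_coef_def rav_defs)

lemma rav_coef_one: "rav_coef 1 = 1"
  by (rule rav_eqI) (simp_all add: rav_coef_def rav_defs)

lemma fps_swap_nth [simp]: "fps_swap F $ i $ j = F $ j $ i"
  by (simp add: fps_swap_def)

lemma fps_swap_mult: "fps_swap (F * G) = fps_swap F * fps_swap (G :: czw)"
  by (intro fps_ext) (simp add: fps_mult_nth fps_sum_nth, subst sum.swap, simp)

lemma fps_swap_add: "fps_swap (F + G) = fps_swap F + fps_swap (G :: czw)"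
  by (intro fps_ext) simp

lemma fps_swap_zero: "fps_swap 0 = (0 :: czw)"
  by (intro fps_ext) simp

lemma fps_swap_one: "fps_swap 1 = (1 :: czw)"
  by (intro fps_ext) simp

interpretation zw: free_hom_ring rav_coef gen_zw
  by unfold_locales
    (rule rav_coef_zero rav_coef_one rav_coef_add rav_coef_mult rav_coef_central)+

interpretation wz: free_hom_ring "\<lambda>F. rav_coef (fps_swap F)" gen_wz
  by unfold_locales
    (simp_all add: rav_coef_zero rav_coef_one rav_coef_add rav_coef_mult
      fps_swap_zero fps_swap_one fps_swap_add fps_swap_mult, rule rav_coef_central)

definition v_in :: "complex rav rav" where "v_in = rav_const (Rav fps_X 0)"
definition v_out :: "complex rav rav" where "v_out = Rav fps_X 0"

lemma rav_coef_var_z: "rav_coef var_z = v_in"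
  by (rule rav_eqI) (simp_all add: rav_coef_def var_z_def v_in_def rav_const_def zero_rav_def)

lemma rav_coef_var_w: "rav_coef var_w = v_out"
  by (rule rav_eqI) (simp_all add: rav_coef_def var_w_def v_out_def rav_defs fps_X_def)

lemma fps_swap_z: "fps_swap var_z = var_w" and fps_swap_w: "fps_swap var_w = var_z"
  by (intro fps_ext; simp add: var_z_def var_w_def fps_X_def)+

lemma fps_swap_diff: "fps_swap (F - G) = fps_swap F - fps_swap (G :: czw)"
  by (intro fps_ext) simp

lemma rav_coef_diff: "rav_coef (F - G) = rav_coef F - rav_coef G"
  by (rule rav_eqI) (simp_all add: rav_coef_def rav_defs)

lemma X_single: "sing_lmult fps_X (Poly_Mapping.single m (1::'r::super_ring)) =
    (if m = 0 then 0 else Poly_Mapping.single (m - 1) 1)"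
proof (rule poly_mapping_eqI)
  fix n
  have N: "\<And>k. k \<ge> Suc (Suc m) \<Longrightarrow> Poly_Mapping.lookup (Poly_Mapping.single m (1::'r)) k = 0"
    by (simp add: lookup_single when_def)
  show "Poly_Mapping.lookup (sing_lmult fps_X (Poly_Mapping.single m (1::'r))) n =
    Poly_Mapping.lookup (if m = 0 then 0 else Poly_Mapping.single (m - 1) 1) n"
    by (auto simp: lookup_sing_lmult[OF N] fps_X_def sum.lessThan_Suc_shift lookup_single when_def simp del: sum.lessThan_Suc)
qed

lemma fps_map_pari_X: "fps_map pari fps_X = (fps_X :: 'r::super_ring fps)"
  by (rule fps_ext) (simp add: fps_X_def)

lemma X_rav_Om: "Rav fps_X 0 * rav_Om m = (if m = 0 then 0 else rav_Om (m - 1) :: 'r::super_ring rav)"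
  by (simp add: times_rav_def rav_Om_def fps_map_pari_X X_single zero_rav_def)

lemma rav_const_mult: "rav_const (a * b) = rav_const a * rav_const (b::'r::super_ring)"
  by (simp add: rav_const_def rav_reg_mult)

lemma v_in_Om: "v_in * rav_const (rav_Om m) = (if m = 0 then 0 else rav_const (rav_Om (m - 1)))"
  by (simp add: v_in_def rav_const_mult[symmetric] X_rav_Om) (simp add: rav_const_def zero_rav_def)

lemma v_out_Om: "v_out * rav_Om m = (if m = 0 then 0 else rav_Om (m - 1))"
  by (simp add: v_out_def X_rav_Om)

lemma of_nat_commute_mult: "x * (of_nat n * y) = of_nat n * (x * (y::'r::ring_1))"
  by (metis mult.assoc mult_of_nat_commute)

lemma v_diff_diag: "(v_in - v_out) * rav_diag m = (if m = 0 then 0 else rav_diag (m - 1))"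
proof -
  have X: "(fps_X * F) $ n = (if n = 0 then 0 else F $ (n - 1))" for F :: "complex rav fps" and n
    by (simp add: fps_X_mult_nth)
  show ?thesis
  proof (cases m)
    case 0
    show ?thesis
      unfolding left_diff_distrib
      by (simp add: 0 v_in_def v_out_def rav_diag_def rav_const_def rav_reg_mult minus_rav_def[where 'a = "complex rav"])
        (auto simp: zero_rav_def[where 'a = "complex rav"] intro!: fps_ext
          simp: fps_mult_left_const_nth X X_rav_Om of_nat_commute_mult)
  next
    case (Suc k)
    have "of_nat (Suc (k + n) choose n) * rav_Om (k + n) -
       (if n = 0 then 0 else of_nat ((Suc k + (n - 1)) choose (n - 1)) * rav_Om (Suc k + (n - 1)))
       = of_nat ((k + n) choose n) * (rav_Om (k + n) :: complex rav)" for n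
      by (cases n) (simp_all add: algebra_simps)
    note * = this
    show ?thesis
      unfolding left_diff_distrib
      by (simp add: Suc v_in_def v_out_def rav_diag_def rav_const_def rav_reg_mult minus_rav_def[where 'a = "complex rav"])
        (rule fps_ext, use * in \<open>simp add: fps_mult_left_const_nth X X_rav_Om of_nat_commute_mult if_distrib cong: if_cong\<close>)
  qed
qed

lemma pow_act:
  fixes x :: "'r::ring_1"
  assumes "\<And>m. x * T m = (if m = 0 then 0 else T (m - 1))"
  shows "x ^ n * T m = (if n \<le> m then T (m - n) else 0)"
proof (induction n)
  case (Suc n)
  have "x ^ Suc n * T m = x * (x ^ n * T m)" by (simp add: mult.assoc)
  also have "\<dots> = (if Suc n \<le> m then T (m - Suc n) else 0)"
    unfolding Suc by (auto simp: assms)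
  finally show ?case .
qed simp

lemma rav_Om_Om: "rav_Om n * rav_Om m = (0 :: 'r::super_ring rav)"
  by (simp add: rav_Om_def rav_defs fps_map_pari_zero)

definition inner_sing :: "complex rav rav \<Rightarrow> bool" where
  "inner_sing x \<longleftrightarrow> sing x = 0 \<and> (\<forall>n. reg (reg x $ n) = 0)"

lemma of_nat_rav: "of_nat n = Rav (of_nat n) (0 :: _ \<Rightarrow>\<^sub>0 'r::super_ring)"
  by (induction n) (simp_all add: rav_defs)

lemma reg_of_nat_mult: "reg (of_nat n * x) = of_nat n * reg (x::'r::super_ring rav)"
  by (simp add: of_nat_rav times_rav_def)

lemma inner_sing_const: "inner_sing (rav_const (rav_Om n))"
  by (simp add: inner_sing_def rav_const_def rav_Om_def fps_const_def zero_rav_def)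

lemma inner_sing_diag: "inner_sing (rav_diag n)"
  by (simp add: inner_sing_def rav_diag_def reg_of_nat_mult rav_Om_def)

lemma inner_sing_mult:
  assumes "inner_sing x" "inner_sing y"
  shows "x * y = 0"
proof -
  have "(\<Sum>i = 0..n. reg x $ i * reg y $ (n - i)) = 0" for n
  proof (rule sum.neutral, rule ballI)
    fix i
    have "reg (reg x $ i) = 0" "reg (reg y $ (n - i)) = 0" using assms by (auto simp: inner_sing_def)
    then show "reg x $ i * reg y $ (n - i) = 0" by (simp add: times_rav_def zero_rav_def fps_map_pari_zero)
  qed
  then have "reg x * reg y = 0" by (intro fps_ext) (simp add: fps_mult_nth)
  then show ?thesis using assms by (simp add: inner_sing_def times_rav_def zero_rav_def[where 'a = "complex rav"])
qed

lemma inner_sing_pari: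
  assumes "inner_sing x"
  shows "fps_map pari (reg x) = - reg x"
proof (rule fps_ext)
  fix n
  have "reg (reg x $ n) = 0" using assms by (simp add: inner_sing_def)
  then show "fps_map pari (reg x) $ n = (- reg x) $ n"
    by (intro rav_eqI) (simp_all add: pari_rav_def uminus_rav_def lookup_pm_map pari_complex_def)
qed

lemma sing_single_comm: "sing_lmult f (Poly_Mapping.single m 1) = sing_rmult (Poly_Mapping.single m 1) (f::'r::ring_1 fps)"
  by (rule poly_mapping_eqI)
    (auto simp: sing_lmult.rep_eq sing_rmult.rep_eq lookup_single when_def intro!: sum.cong)

lemma inner_sing_anti:
  assumes "inner_sing x"
  shows "x * rav_Om m + rav_Om m * x = 0"
proof -
  have "sing_lmult (- reg x) (Poly_Mapping.single m 1) + sing_lmult (reg x) (Poly_Mapping.single m 1) = 0"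
    by (simp add: sing_lmult_add_left[symmetric])
  then show ?thesis using assms
    by (simp add: plus_rav_def times_rav_def rav_Om_def inner_sing_pari sing_single_comm[symmetric])
      (simp add: inner_sing_def zero_rav_def[where 'a = "complex rav"])
qed


abbreviation D_in :: "complex rav rav \<Rightarrow> complex rav rav" where "D_in \<equiv> rav_map rav_deriv"
abbreviation D_out :: "complex rav rav \<Rightarrow> complex rav rav" where "D_out \<equiv> rav_deriv"

lemma lookup_of_nat_mult: "Poly_Mapping.lookup (sing (of_nat n * x)) k = of_nat n * Poly_Mapping.lookup (sing (x::'r::super_ring rav)) k"
proof (induction n)
  case (Suc n)
  then show ?case by (simp add: distrib_right lookup_add) (simp add: plus_rav_def lookup_add)
qed (simp, simp add: zero_rav_def)

lemma rav_deriv_Om: "rav_deriv (rav_Om n) = - (of_nat (n + 1) * (rav_Om (n + 1) :: 'r::super_ring rav))"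
proof (rule rav_eqI)
  fix k
  show "Poly_Mapping.lookup (sing (rav_deriv (rav_Om n))) k =
      Poly_Mapping.lookup (sing (- (of_nat (n + 1) * (rav_Om (n + 1) :: 'r rav)))) k"
    by (cases k) (auto simp: rav_deriv_def uminus_rav_def lookup_of_nat_mult rav_Om_def
      sing_deriv.rep_eq lookup_single when_def simp del: of_nat_Suc)
qed (simp add: rav_deriv_def uminus_rav_def reg_of_nat_mult rav_Om_def del: of_nat_Suc of_nat_add)

lemma rav_const_of_nat: "rav_const (of_nat n * x) = of_nat n * rav_const (x::'r::super_ring)"
proof -
  have "fps_const (of_nat n * x) = of_nat n * fps_const x"
    by (metis fps_const_mult fps_of_nat)
  then show ?thesis by (simp add: rav_const_def of_nat_rav rav_reg_mult)
qed

lemma D_in_const: "D_in (rav_const x) = rav_const (rav_deriv x)"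
  by (rule rav_eqI) (simp_all add: rav_map_def rav_const_def lookup_pm_map)

lemma D_out_const: "D_out (rav_const x) = 0"
  by (rule rav_eqI) (simp_all add: rav_deriv_def rav_const_def sing_deriv.rep_eq zero_rav_def[where 'a = "complex rav"])

lemma D_in_Om: "D_in (rav_Om n) = 0"
proof -
  have "rav_deriv (if n = k then 1 else 0) = (0::complex rav)" for k by simp
  then show ?thesis
    by (intro rav_eqI) (simp_all add: rav_map_def rav_Om_def lookup_pm_map lookup_single when_def
       zero_rav_def[where 'a = "complex rav"])
qed

lemma rav_const_uminus: "rav_const (- x) = - rav_const (x :: 'r::super_ring)"
  by (simp add: rav_const_def uminus_rav_def)

lemma reg_of_nat_mult_nth: "reg (of_nat n * x) $ k = of_nat n * (reg (x::'r::super_ring rav) $ k)"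
proof (induction n)
  case (Suc n)
  then show ?case by (simp add: distrib_right) (simp add: plus_rav_def)
qed (simp, simp add: zero_rav_def)

lemma choose_id1: "(m + n + 1) * ((m + n) choose n) = (m + 1) * ((m + 1 + n) choose n)"
proof -
  have "(m + n) choose n = (m + n) choose m" "(m + 1 + n) choose n = Suc (m + n) choose Suc m"
    by (subst binomial_symmetric; simp del: binomial_Suc_Suc)+
  then show ?thesis using Suc_times_binomial_eq[of "m + n" m] by (simp del: binomial_Suc_Suc)
qed

lemma choose_id2: "(n + 1) * ((m + (n + 1)) choose (n + 1)) = (m + 1) * ((m + 1 + n) choose n)"
  unfolding choose_id1[symmetric] using Suc_times_binomial_eq[of "m + n" n]
  by (simp del: binomial_Suc_Suc)

lemma of_nat_mult_assoc: "of_nat n * (of_nat m * x) = of_nat (m * n) * (x::'r::ring_1)"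
  by (metis mult.assoc mult_of_nat_commute of_nat_mult)

lemma rav_deriv_of_nat: "rav_deriv (of_nat n * x) = of_nat n * rav_deriv x"
  by (induction n) (simp_all add: distrib_right rav_deriv_add rav_deriv_zero)

lemma D_in_diag: "D_in (rav_diag m) = - (of_nat (m + 1) * rav_diag (m + 1))"
proof (rule rav_eqI)
  fix n
  have "rav_deriv (of_nat ((m + n) choose n) * rav_Om (m + n))
     = - (of_nat ((m + n + 1) * ((m + n) choose n)) * (rav_Om (m + n + 1) :: complex rav))"
    by (simp add: rav_deriv_of_nat rav_deriv_Om of_nat_mult_assoc del: of_nat_Suc of_nat_add)
  also have "\<dots> = - (of_nat (m + 1) * (of_nat ((m + 1 + n) choose n) * rav_Om (m + 1 + n)))"
    unfolding choose_id1 by (simp only: of_nat_mult mult.assoc add_ac)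
  finally show "reg (D_in (rav_diag m)) $ n = reg (- (of_nat (m + 1) * rav_diag (m + 1))) $ n"
    by (simp add: rav_map_def rav_diag_def uminus_rav_def reg_of_nat_mult_nth del: of_nat_Suc of_nat_add)
qed (simp add: rav_map_def rav_diag_def uminus_rav_def[where 'a = "complex rav"] lookup_of_nat_mult lookup_pm_map del: of_nat_Suc of_nat_add)

lemma D_out_diag: "D_out (rav_diag m) = of_nat (m + 1) * rav_diag (m + 1)"
proof (rule rav_eqI)
  fix n
  have "of_nat (n + 1) * (of_nat ((m + (n + 1)) choose (n + 1)) * rav_Om (m + (n + 1)))
     = of_nat ((n + 1) * ((m + (n + 1)) choose (n + 1))) * (rav_Om (m + n + 1) :: complex rav)"
    by (simp only: of_nat_mult mult.assoc add_ac)
  also have "\<dots> = of_nat (m + 1) * (of_nat ((m + 1 + n) choose n) * rav_Om (m + 1 + n))"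
    unfolding choose_id2 by (simp only: of_nat_mult mult.assoc add_ac)
  finally show "reg (D_out (rav_diag m)) $ n = reg (of_nat (m + 1) * rav_diag (m + 1)) $ n"
    by (simp add: rav_deriv_def rav_diag_def reg_of_nat_mult_nth del: of_nat_Suc of_nat_add binomial_Suc_Suc)
qed (simp add: rav_deriv_def rav_diag_def lookup_of_nat_mult sing_deriv.rep_eq del: of_nat_Suc of_nat_add)

lemma rav_deriv_reg: "rav_deriv (Rav f 0) = Rav (fps_deriv f) 0"
  by (rule rav_eqI) (simp_all add: rav_deriv_def sing_deriv.rep_eq)

lemma D_in_coef: "D_in (rav_coef F) = rav_coef (fps_map fps_deriv F)"
  by (rule rav_eqI) (simp_all add: rav_map_def rav_coef_def rav_deriv_reg lookup_pm_map)

lemma D_out_coef: "D_out (rav_coef F) = rav_coef (fps_deriv F)"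
proof (rule rav_eqI)
  fix n
  show "reg (D_out (rav_coef F)) $ n = reg (rav_coef (fps_deriv F)) $ n"
    by (simp add: rav_deriv_def rav_coef_def of_nat_rav rav_reg_mult del: of_nat_Suc)
qed (simp add: rav_deriv_def rav_coef_def sing_deriv.rep_eq)

lemma swap_deriv: "fps_swap (fps_map fps_deriv F) = fps_deriv (fps_swap (F::czw))"
  "fps_swap (fps_deriv F) = fps_map fps_deriv (fps_swap (F::czw))"
  by (intro fps_ext; simp add: fps_of_nat[symmetric] fps_mult_left_const_nth del: of_nat_Suc)+

lemmas hom_simps = zw.feval_zero zw.feval_add zw.feval_mult zw.feval_fgen zw.feval_fscal zw.feval_uminus zw.feval_diff
  wz.feval_zero wz.feval_add wz.feval_mult wz.feval_fgen wz.feval_fscal wz.feval_uminus wz.feval_diff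

lemmas feval_of_nat = zw.feval_of_nat wz.feval_of_nat

lemma m1_pow: "(- 1) ^ n * x = (if even n then x else - (x::'r::ring_1))"
  by simp

lemma expand_zw_dz: "rep_expand_zw (rep_dz p) = D_in (rep_expand_zw p)"
  unfolding rep_expand_zw_def rep_dz_def
proof (rule zw.feval_deriv)
  fix a show "feval rav_coef gen_zw (gen_dz a) = D_in (gen_zw a)"
    by (cases a rule: gen_dz.cases)
      (simp_all add: hom_simps feval_of_nat D_in_const D_in_Om rav_deriv_Om rav_const_of_nat rav_const_uminus D_in_diag
        del: of_nat_Suc of_nat_add)
qed (simp_all add: D_in_coef rav_map_deriv.D_add rav_map_deriv.D_mult)

lemma expand_zw_dw: "rep_expand_zw (rep_dw p) = D_out (rep_expand_zw p)"
  unfolding rep_expand_zw_def rep_dw_def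
proof (rule zw.feval_deriv)
  fix a show "feval rav_coef gen_zw (gen_dw a) = D_out (gen_zw a)"
    by (cases a rule: gen_dw.cases)
      (simp_all add: hom_simps feval_of_nat D_out_const rav_deriv_Om D_out_diag
        del: of_nat_Suc of_nat_add)
qed (simp_all add: D_out_coef rav_deriv.D_add rav_deriv.D_mult)

lemma expand_wz_dz: "rep_expand_wz (rep_dz p) = D_out (rep_expand_wz p)"
  unfolding rep_expand_wz_def rep_dz_def
proof (rule wz.feval_deriv)
  fix a show "feval (\<lambda>F. rav_coef (fps_swap F)) gen_wz (gen_dz a) = D_out (gen_wz a)"
    by (cases a rule: gen_dz.cases)
      (simp_all add: hom_simps feval_of_nat D_out_const rav_deriv_Om D_out_diag m1_pow rav_deriv.D_uminus
        del: of_nat_Suc of_nat_add)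
qed (simp_all add: D_out_coef rav_deriv.D_add rav_deriv.D_mult swap_deriv)

lemma expand_wz_dw: "rep_expand_wz (rep_dw p) = D_in (rep_expand_wz p)"
  unfolding rep_expand_wz_def rep_dw_def
proof (rule wz.feval_deriv)
  fix a show "feval (\<lambda>F. rav_coef (fps_swap F)) gen_wz (gen_dw a) = D_in (gen_wz a)"
    by (cases a rule: gen_dw.cases)
      (simp_all add: hom_simps feval_of_nat D_in_const D_in_Om rav_deriv_Om rav_const_of_nat rav_const_uminus D_in_diag m1_pow
         rav_map_deriv.D_uminus
        del: of_nat_Suc of_nat_add)
qed (simp_all add: D_in_coef rav_map_deriv.D_add rav_map_deriv.D_mult swap_deriv)

lemma Om_diag: "rav_Om 0 * rav_diag 0 = rav_Om 0 * rav_const (rav_Om 0)"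
proof (rule rav_eqI)
  fix n
  have N: "\<And>m. m \<ge> Suc 0 \<Longrightarrow> Poly_Mapping.lookup (Poly_Mapping.single 0 (1::complex rav)) m = 0"
    by (simp add: lookup_single when_def del: single_one)
  show "Poly_Mapping.lookup (sing (rav_Om 0 * rav_diag 0)) n =
         Poly_Mapping.lookup (sing (rav_Om 0 * rav_const (rav_Om 0))) n"
    unfolding rav_Om_def[where 'r = "complex rav"] rav_diag_def rav_const_def times_rav_def[where 'a = "complex rav"]
    by (simp add: lookup_sing_rmult[OF N] del: single_one)
qed (simp add: rav_Om_def[where 'r = "complex rav"] times_rav_def)

lemma Om_anti:
  "rav_Om m * rav_const (rav_Om n) = - (rav_const (rav_Om n) * (rav_Om m :: complex rav rav))"
  "rav_Om m * rav_diag n = - (rav_diag n * rav_Om m)"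
  using inner_sing_anti[OF inner_sing_const, of n m] inner_sing_anti[OF inner_sing_diag, of n m]
  by (simp_all add: eq_neg_iff_add_eq_0 add.commute)

lemma expand_arnold: "rep_expand_zw arnold = 0" "rep_expand_wz arnold = 0"
proof -
  have 1: "rav_const (rav_Om 0) * rav_Om 0 + rav_Om 0 * rav_const (rav_Om 0) = (0 :: complex rav rav)"
    by (rule inner_sing_anti) (rule inner_sing_const)
  have 2: "rav_diag 0 * rav_Om 0 + rav_Om 0 * rav_diag 0 = 0"
    by (rule inner_sing_anti) (rule inner_sing_diag)
  have 3: "rav_diag 0 * rav_const (rav_Om 0) = 0" "rav_const (rav_Om 0) * rav_diag 0 = 0"
    by (rule inner_sing_mult; rule inner_sing_const inner_sing_diag)+
  show "rep_expand_zw arnold = 0"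
    using 1 by (simp add: rep_expand_zw_def arnold_def hom_simps 3 Om_diag add.commute)
  show "rep_expand_wz arnold = 0"
    using 2 by (simp add: rep_expand_wz_def arnold_def hom_simps 3 Om_diag)
qed

lemma funpow_hom_zero:
  assumes "\<And>p. e (f p) = D (e p)" "D 0 = 0" "e q = 0"
  shows "e ((f ^^ i) q) = 0"
  by (induction i) (simp_all add: assms)

lemma expand_zw_rels:
  assumes "r \<in> kzw_rels" shows "rep_expand_zw r = 0"
proof -
  have c: "feval rav_coef gen_zw (Om x n * Om y m + Om y m * Om x n) = 0" for x n y m
    by (cases x; cases y)
      (auto simp: hom_simps rav_Om_Om inner_sing_mult inner_sing_const inner_sing_diag Om_anti)
  have d: "feval rav_coef gen_zw (Om x n * Om x m) = 0" for x n m
    by (cases x) (auto simp: hom_simps rav_Om_Om inner_sing_mult inner_sing_const inner_sing_diag)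
  have hp: "rav_coef (F ^ n) = rav_coef F ^ n" for F n
    by (induction n) (simp_all add: rav_coef_one rav_coef_mult)
  have p: "rav_coef (pt_var x ^ n) * gen_zw (x, m) = (if n \<le> m then gen_zw (x, m - n) else 0)" for x n m
    unfolding hp by (rule pow_act) (cases x; simp add: rav_coef_var_z rav_coef_var_w rav_coef_diff v_in_Om v_out_Om v_diff_diag)
  have a: "rep_expand_zw ((rep_dz ^^ i) ((rep_dw ^^ j) arnold)) = 0" for i j
    by (intro funpow_hom_zero[of rep_expand_zw _ D_in] funpow_hom_zero[of rep_expand_zw _ D_out])
      (simp_all add: expand_zw_dz expand_zw_dw expand_arnold)
  show ?thesis
    using assms unfolding kzw_rels_def
    by (auto simp: c d a p rep_expand_zw_def[symmetric])
      (auto simp: rep_expand_zw_def hom_simps c[unfolded hom_simps] d[unfolded hom_simps] p)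
qed

lemma expand_wz_rels:
  assumes "r \<in> kzw_rels" shows "rep_expand_wz r = 0"
proof -
  let ?h = "\<lambda>F. rav_coef (fps_swap F)"
  have c: "feval ?h gen_wz (Om x n * Om y m + Om y m * Om x n) = 0" for x n y m
    by (cases x; cases y)
      (auto simp: hom_simps rav_Om_Om inner_sing_mult inner_sing_const inner_sing_diag Om_anti m1_pow)
  have d: "feval ?h gen_wz (Om x n * Om x m) = 0" for x n m
    by (cases x) (auto simp: hom_simps rav_Om_Om inner_sing_mult inner_sing_const inner_sing_diag m1_pow)
  have hp: "?h (F ^ n) = ?h F ^ n" for F n
    by (induction n) (simp_all add: rav_coef_one rav_coef_mult fps_swap_one fps_swap_mult)
  have vd: "(v_out - v_in) * rav_diag m = (if m = 0 then 0 else - rav_diag (m - 1))" for m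
    using v_diff_diag[of m] by (simp add: algebra_simps split: if_splits)
  have p: "?h (pt_var x ^ n) * gen_wz (x, m) = (if n \<le> m then gen_wz (x, m - n) else 0)" for x n m
    unfolding hp by (rule pow_act)
      (cases x; simp add: rav_coef_var_z rav_coef_var_w rav_coef_diff fps_swap_diff fps_swap_z fps_swap_w
          v_in_Om v_out_Om vd m1_pow)
  have a: "rep_expand_wz ((rep_dz ^^ i) ((rep_dw ^^ j) arnold)) = 0" for i j
    by (intro funpow_hom_zero[of rep_expand_wz _ D_out] funpow_hom_zero[of rep_expand_wz _ D_in])
      (simp_all add: expand_wz_dz expand_wz_dw expand_arnold)
  show ?thesis
    using assms unfolding kzw_rels_def
    by (auto simp: c d a p rep_expand_wz_def[symmetric])
      (auto simp: rep_expand_wz_def hom_simps c[unfolded hom_simps] d[unfolded hom_simps] p)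
qed

lift_definition expand_zw :: "kzw \<Rightarrow> complex rav rav" is rep_expand_zw
proof -
  fix p q :: kzw_rep assume a: "p - q \<in> two_sided_ideal kzw_rels"
  show "rep_expand_zw p = rep_expand_zw q"
    using zw.feval_ideal[OF _ a] expand_zw_rels by (simp add: rep_expand_zw_def zw.feval_diff)
qed

lift_definition expand_wz :: "kzw \<Rightarrow> complex rav rav" is rep_expand_wz
proof -
  fix p q :: kzw_rep assume a: "p - q \<in> two_sided_ideal kzw_rels"
  show "rep_expand_wz p = rep_expand_wz q"
    using wz.feval_ideal[OF _ a] expand_wz_rels by (simp add: rep_expand_wz_def wz.feval_diff)
qed

section \<open>Raviolo vertex algebras\<close>

text \<open>A series with coefficients in \<open>End(V)\<close> is a function \<open>A\<close> on the integers: the coefficient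
  of \<open>z^(-m-1)\<close> is \<open>A m\<close> for \<open>m < 0\<close>, and that of \<open>Omega_z^m\<close> is \<open>A m\<close> for \<open>m \<ge> 0\<close>.\<close>

definition koszul_sign :: "int \<Rightarrow> int \<Rightarrow> complex" where
  "koszul_sign r s = (if odd r \<and> odd s then - 1 else 1)"

definition graded_by :: "(complex \<Rightarrow> 'v::ab_group_add \<Rightarrow> 'v) \<Rightarrow> (int \<Rightarrow> 'v set) \<Rightarrow> bool" where
  "graded_by scale V \<longleftrightarrow> (\<forall>i. module.subspace scale (V i)) \<and>
     (\<forall>v. \<exists>!x. (\<forall>i. x i \<in> V i) \<and> finite {i. x i \<noteq> 0} \<and> v = (\<Sum>i | x i \<noteq> 0. x i))"

definition raviolo_field :: "(complex \<Rightarrow> 'v::ab_group_add \<Rightarrow> 'v) \<Rightarrow> (int \<Rightarrow> 'v \<Rightarrow> 'v) \<Rightarrow> bool" where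
  "raviolo_field scale A \<longleftrightarrow> (\<forall>m. Vector_Spaces.linear scale scale (A m)) \<and>
     (\<forall>v. \<exists>N. \<forall>m\<ge>N. A m v = 0)"

definition field_degree :: "(int \<Rightarrow> 'v set) \<Rightarrow> int \<Rightarrow> (int \<Rightarrow> 'v \<Rightarrow> 'v) \<Rightarrow> bool" where
  "field_degree deg r A \<longleftrightarrow>
     (\<forall>m i. \<forall>v\<in>deg i. A m v \<in> deg (i + (if m < 0 then r else r - 1)))"

(* For m < 0 the coefficient of z^(-m-1) in the derivative is -m A_(m-1), and for m > 0
   that of Omega^m is -m A_(m-1); there is no Omega^0, in agreement with the factor m. *)
definition field_deriv :: "(complex \<Rightarrow> 'v \<Rightarrow> 'v) \<Rightarrow> (int \<Rightarrow> 'v \<Rightarrow> 'v) \<Rightarrow> int \<Rightarrow> 'v \<Rightarrow> 'v" where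
  "field_deriv scale A m v = scale (- of_int m) (A (m - 1) v)"

text \<open>The degrees r and s of A and B enter through Koszul signs only. In \<open>A(z) B(w) v\<close> the
  terms with \<open>Omega_w\<close> are brought into the order of \<open>complex rav rav\<close> (outer variable to the
  left) by moving \<open>Omega_w\<close> past \<open>A(z)\<close>, which has total degree r; likewise for
  \<open>B(w) A(z) v\<close>. The functional is applied to the coefficients, which stand on the right;
  letting it pass the \<open>Omega\<close>'s with a sign instead amounts to applying the automorphism
  that negates all \<open>Omega\<close>'s, on both sides.\<close>

definition mutually_local ::
  "(complex \<Rightarrow> 'v::ab_group_add \<Rightarrow> 'v) \<Rightarrow> int \<Rightarrow> int \<Rightarrow> (int \<Rightarrow> 'v \<Rightarrow> 'v) \<Rightarrow> (int \<Rightarrow> 'v \<Rightarrow> 'v) \<Rightarrow> bool" where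
  "mutually_local scale r s A B \<longleftrightarrow>
     (\<exists>N. \<forall>v \<phi>. Vector_Spaces.linear scale (*) \<phi> \<longrightarrow>
       (\<exists>f. kzw_pole_le N f \<and>
         (\<forall>m n. rav_nth (rav_nth (expand_zw f) n) m =
            (if 0 \<le> n \<and> odd r then - 1 else 1) * \<phi> (A m (B n v))) \<and>
         (\<forall>m n. rav_nth (rav_nth (expand_wz f) m) n =
            koszul_sign r s * (if 0 \<le> m \<and> odd s then - 1 else 1) * \<phi> (B n (A m v)))))"

locale raviolo_vertex_algebra = vector_space scale
  for scale :: "complex \<Rightarrow> 'v::ab_group_add \<Rightarrow> 'v" +
  fixes deg :: "int \<Rightarrow> 'v set" and vac :: 'v and tr :: "'v \<Rightarrow> 'v" and Y :: "'v \<Rightarrow> int \<Rightarrow> 'v \<Rightarrow> 'v"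
  assumes grading: "graded_by scale deg"
    and vac_degree: "vac \<in> deg 0"
    and trans_linear: "Vector_Spaces.linear scale scale tr"
    and trans_degree: "v \<in> deg r \<Longrightarrow> tr v \<in> deg r"
    and Y_linear: "Vector_Spaces.linear scale scale (\<lambda>a. Y a m v)"
    and Y_field: "raviolo_field scale (Y a)"
    and Y_degree: "a \<in> deg r \<Longrightarrow> field_degree deg r (Y a)"
    and translation: "tr (Y a m v) - Y a m (tr v) = field_deriv scale (Y a) m v"
    and trans_vac: "tr vac = 0"
    and Y_vac: "Y vac m v = (if m = - 1 then v else 0)"
    and creation: "Y a (- 1) vac = a" "0 \<le> m \<Longrightarrow> Y a m vac = 0"
    and locality: "a \<in> deg r \<Longrightarrow> b \<in> deg s \<Longrightarrow> mutually_local scale r s (Y a) (Y b)"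

definition spin_grading ::
  "(complex \<Rightarrow> 'v::ab_group_add \<Rightarrow> 'v) \<Rightarrow> (int \<Rightarrow> 'v set) \<Rightarrow> 'v \<Rightarrow> ('v \<Rightarrow> 'v) \<Rightarrow>
    ('v \<Rightarrow> int \<Rightarrow> 'v \<Rightarrow> 'v) \<Rightarrow> (int \<Rightarrow> 'v set) \<Rightarrow> bool" where
  "spin_grading scale deg vac tr Y S \<longleftrightarrow>
     graded_by scale S \<and>
     (\<forall>s. S s = module.span scale (\<Union>r. S s \<inter> deg r)) \<and>
     vac \<in> S 0 \<and>
     (\<forall>s. \<forall>v\<in>S s. tr v \<in> S (s + 1)) \<and>
     (\<forall>s t n. \<forall>a\<in>S s. \<forall>v\<in>S t. Y a n v \<in> S (t + (s - n - 1)))"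

fun mode_monomial :: "('v \<Rightarrow> int \<Rightarrow> 'v \<Rightarrow> 'v) \<Rightarrow> 'v \<Rightarrow> ('v \<times> int) list \<Rightarrow> 'v" where
  "mode_monomial Y vac [] = vac"
| "mode_monomial Y vac ((a, j) # w) = Y a j (mode_monomial Y vac w)"

definition strongly_generated ::
  "(complex \<Rightarrow> 'v::ab_group_add \<Rightarrow> 'v) \<Rightarrow> 'v \<Rightarrow> ('v \<Rightarrow> int \<Rightarrow> 'v \<Rightarrow> 'v) \<Rightarrow> 'v set \<Rightarrow> bool" where
  "strongly_generated scale vac Y G \<longleftrightarrow>
     module.span scale {mode_monomial Y vac w |w. \<forall>(a, j)\<in>set w. a \<in> G \<and> j < 0} = UNIV"

(* the sum of z^n p_n and Omega_z^n q_n over n >= 0 *)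
definition raviolo_series :: "(nat \<Rightarrow> 'e) \<Rightarrow> (nat \<Rightarrow> 'e) \<Rightarrow> int \<Rightarrow> 'e" where
  "raviolo_series p q m = (if m < 0 then p (nat (- m - 1)) else q (nat m))"

section \<open>The graded Lie algebra\<close>

text \<open>A triple \<open>(k, l, t)\<close> consists of k in K, l in K[1] and the multiple t of the central element;
  the regular parts of k and l are the (possibly infinite) combinations of the c's and phi's, the
  singular parts those of the nu's and b's.\<close>

type_synonym hhat = "complex rav \<times> complex rav \<times> complex"

definition h_c :: "nat \<Rightarrow> hhat" where "h_c n = (Rav (fps_X ^ n) 0, 0, 0)"
definition h_nu :: "nat \<Rightarrow> hhat" where "h_nu n = (rav_Om n, 0, 0)"
definition h_phi :: "nat \<Rightarrow> hhat" where "h_phi n = (0, Rav (fps_X ^ n) 0, 0)"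
definition h_b :: "nat \<Rightarrow> hhat" where "h_b n = (0, rav_Om n, 0)"
definition h_K :: hhat where "h_K = (0, 0, 1)"

fun h_scale :: "complex \<Rightarrow> hhat \<Rightarrow> hhat" where
  "h_scale c (k, l, t) = (rav_const c * k, rav_const c * l, c * t)"

text \<open>\<open>du_pair f g\<close> is the coefficient of \<open>Omega_u^0\<close> in \<open>(d/du f) g\<close>; it extends the bracket
  from the generators to power series, see \<open>h_bracket_basis\<close> below.\<close>

definition du_pair :: "complex fps \<Rightarrow> (nat \<Rightarrow>\<^sub>0 complex) \<Rightarrow> complex" where
  "du_pair f g = (\<Sum>m\<in>Poly_Mapping.keys g. of_nat (m + 1) * f $ (m + 1) * Poly_Mapping.lookup g m)"

fun h_bracket :: "hhat \<Rightarrow> hhat \<Rightarrow> hhat" where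
  "h_bracket (k, l, t) (k', l', t') = (0, 0,
     - du_pair (reg k) (sing l') + du_pair (reg k') (sing l)
     + du_pair (reg l') (sing k) + du_pair (reg l) (sing k'))"

fun h_deriv :: "hhat \<Rightarrow> hhat" where
  "h_deriv (k, l, t) = (- rav_deriv k, - rav_deriv l, 0)"

definition h_deg :: "int \<Rightarrow> hhat set" where
  "h_deg r = {(k, l, t). (reg k \<noteq> 0 \<longrightarrow> r = 0) \<and> (sing k \<noteq> 0 \<longrightarrow> r = 1) \<and>
     (reg l \<noteq> 0 \<longrightarrow> r = - 1) \<and> (sing l \<noteq> 0 \<longrightarrow> r = 0) \<and> (t \<noteq> 0 \<longrightarrow> r = 0)}"

(* u^n has index m = -n-1 and spin -n, Omega_u^n has index m = n and spin n+1 *)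
definition h_spin :: "int \<Rightarrow> hhat set" where
  "h_spin s = {(k, l, t). (\<forall>m. rav_nth k m \<noteq> 0 \<longrightarrow> s = m + 1) \<and>
     (\<forall>m. rav_nth l m \<noteq> 0 \<longrightarrow> s = m + 1) \<and> (t \<noteq> 0 \<longrightarrow> s = 0)}"

definition h_nonneg :: "hhat set" where
  "h_nonneg = {(k, l, t). sing k = 0 \<and> sing l = 0}"

(* the action of h_nonneg on its module C_1 *)
fun h_char :: "hhat \<Rightarrow> complex" where
  "h_char (k, l, t) = t"

lemma du_pair_single: "du_pair f (Poly_Mapping.single m 1) = of_nat (m + 1) * f $ (m + 1)"
  by (simp add: du_pair_def)

lemma h_bracket_basis:
  "h_bracket (h_c n) (h_b m) = (if n = m + 1 then h_scale (- of_nat n) h_K else 0)"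
  "h_bracket (h_b m) (h_c n) = (if n = m + 1 then h_scale (of_nat n) h_K else 0)"
  "h_bracket (h_nu n) (h_phi m) = (if n + 1 = m then h_scale (of_nat m) h_K else 0)"
  "h_bracket (h_phi m) (h_nu n) = (if n + 1 = m then h_scale (of_nat m) h_K else 0)"
  by (auto simp: h_c_def h_b_def h_nu_def h_phi_def h_K_def rav_Om_def zero_rav_def du_pair_single
      fps_X_power_nth zero_prod_def times_rav_def rav_const_def du_pair_def[of _ 0])

lemma h_bracket_basis_zero:
  "h_bracket (h_c n) (h_c m) = 0" "h_bracket (h_c n) (h_nu m) = 0" "h_bracket (h_c n) (h_phi m) = 0"
  "h_bracket (h_nu n) (h_nu m) = 0" "h_bracket (h_nu n) (h_b m) = 0"
  "h_bracket (h_phi n) (h_phi m) = 0" "h_bracket (h_phi n) (h_b m) = 0"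
  "h_bracket (h_b n) (h_b m) = 0" "h_bracket h_K x = 0"
  by (cases x; simp add: h_c_def h_b_def h_nu_def h_phi_def h_K_def rav_Om_def zero_rav_def
      zero_prod_def du_pair_def[of _ 0] du_pair_def[of 0])+

lemma h_deriv_basis:
  "h_deriv h_K = 0"
  "h_deriv (h_nu n) = h_scale (of_nat (n + 1)) (h_nu (n + 1))"
  "h_deriv (h_c n) = h_scale (- of_nat n) (h_c (n - 1))"
  "h_deriv (h_b n) = h_scale (of_nat (n + 1)) (h_b (n + 1))"
  "h_deriv (h_phi n) = h_scale (- of_nat n) (h_phi (n - 1))"
proof -
  have c: "of_nat k * x = rav_const (of_nat k) * x" for k and x :: "complex rav"
    by (simp add: of_nat_rav rav_const_def fps_of_nat)
  have d: "- rav_deriv (rav_Om n) = rav_const (of_nat (n + 1)) * (rav_Om (n + 1) :: complex rav)"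
    by (simp only: rav_deriv_Om c minus_minus)
  have e: "- rav_deriv (Rav (fps_X ^ n) 0) = rav_const (- of_nat n) * Rav (fps_X ^ (n - 1)) (0 :: _ \<Rightarrow>\<^sub>0 complex)"
    by (simp add: rav_deriv_reg fps_deriv_power uminus_rav_def rav_const_def rav_reg_mult fps_of_nat[symmetric] fps_const_neg[symmetric] del: fps_const_neg)
  show "h_deriv h_K = 0"
    "h_deriv (h_nu n) = h_scale (of_nat (n + 1)) (h_nu (n + 1))"
    "h_deriv (h_c n) = h_scale (- of_nat n) (h_c (n - 1))"
    "h_deriv (h_b n) = h_scale (of_nat (n + 1)) (h_b (n + 1))"
    "h_deriv (h_phi n) = h_scale (- of_nat n) (h_phi (n - 1))"
    using d e by (simp_all add: h_K_def h_nu_def h_c_def h_b_def h_phi_def zero_prod_def rav_deriv_zero)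
qed

section \<open>The universal enveloping algebra\<close>

text \<open>The first two families of relations turn the free algebra on the set \<open>hhat\<close> into the tensor
  algebra of the vector space.\<close>

definition uea_rels :: "(hhat, complex) free_alg set" where
  "uea_rels =
     {fgen (x + y) - fgen x - fgen y |x y. True}
   \<union> {fgen (h_scale c x) - fscal c * fgen x |c x. True}
   \<union> {fgen x * fgen y - fscal (koszul_sign r s) * fgen y * fgen x - fgen (h_bracket x y) |x y r s.
        x \<in> h_deg r \<and> y \<in> h_deg s}"

lemma uea_relsI:
  "fgen (x + y) - fgen x - fgen y \<in> uea_rels"
  "fgen (h_scale c x) - fscal c * fgen x \<in> uea_rels"
  "x \<in> h_deg r \<Longrightarrow> y \<in> h_deg s \<Longrightarrow>
    fgen x * fgen y - fscal (koszul_sign r s) * fgen y * fgen x - fgen (h_bracket x y) \<in> uea_rels"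
  unfolding uea_rels_def by blast+

lemma uea_rels_cases:
  assumes "p \<in> uea_rels"
  obtains x y where "p = fgen (x + y) - fgen x - fgen y"
  | c x where "p = fgen (h_scale c x) - fscal c * fgen x"
  | x y r s where "p = fgen x * fgen y - fscal (koszul_sign r s) * fgen y * fgen x - fgen (h_bracket x y)"
      "x \<in> h_deg r" "y \<in> h_deg s"
  using assms unfolding uea_rels_def by blast

quotient_type uea = "(hhat, complex) free_alg" / "\<lambda>p q. p - q \<in> two_sided_ideal uea_rels"
  by (rule ideal_equivp)

interpretation aug: free_hom_ring "\<lambda>c::complex. c" "\<lambda>x::hhat. 0"
  by unfold_locales simp_all

lemma one_notin_uea_ideal: "1 \<notin> two_sided_ideal uea_rels"
proof
  assume "1 \<in> two_sided_ideal uea_rels"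
  then have "feval (\<lambda>c. c) (\<lambda>x. 0) (1 :: (hhat, complex) free_alg) = 0"
    by (rule aug.feval_ideal[rotated])
      (auto simp: uea_rels_def aug.feval_diff aug.feval_mult aug.feval_fgen aug.feval_fscal)
  then show False by (simp add: aug.feval_one)
qed

instantiation uea :: ring_1
begin

lift_definition zero_uea :: uea is 0 .
lift_definition one_uea :: uea is 1 .
lift_definition plus_uea :: "uea \<Rightarrow> uea \<Rightarrow> uea" is "(+)"
  by (metis (no_types, lifting) add_diff_add ideal_add)
lift_definition minus_uea :: "uea \<Rightarrow> uea \<Rightarrow> uea" is "(-)"
proof -
  fix a b c d :: "(hhat, complex) free_alg"
  assume "a - b \<in> two_sided_ideal uea_rels" "c - d \<in> two_sided_ideal uea_rels"
  from ideal_diff[OF this] show "a - c - (b - d) \<in> two_sided_ideal uea_rels" by (simp add: algebra_simps)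
qed
lift_definition uminus_uea :: "uea \<Rightarrow> uea" is "uminus"
  by (metis ideal_uminus minus_diff_eq minus_diff_minus)
lift_definition times_uea :: "uea \<Rightarrow> uea \<Rightarrow> uea" is "(*)"
proof -
  fix a b c d :: "(hhat, complex) free_alg"
  assume "a - b \<in> two_sided_ideal uea_rels" "c - d \<in> two_sided_ideal uea_rels"
  from ideal_add[OF ideal_rmult[OF this(1), of c] ideal_lmult[OF this(2), of b]]
  show "a * c - b * d \<in> two_sided_ideal uea_rels" by (simp add: algebra_simps)
qed

instance
proof
  show "(0::uea) \<noteq> 1"
    by transfer (use one_notin_uea_ideal ideal_uminus in fastforce)
qed (transfer, simp add: algebra_simps two_sided_ideal.zero)+

end

lift_definition u_scal :: "complex \<Rightarrow> uea" is fscal .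

lift_definition u_inc :: "hhat \<Rightarrow> uea" is fgen .

lemma fscal_central: "fscal c * p = p * fscal (c :: 'r::comm_semiring_1)"
  by (induction p rule: pm_induct)
    (simp_all add: fscal_def mult_single plus_list_def distrib_left distrib_right mult.commute)

abbreviation fder :: "('g \<Rightarrow> ('g, 'r) free_alg) \<Rightarrow> ('g, 'r::comm_ring_1) free_alg \<Rightarrow> ('g, 'r) free_alg" where
  "fder \<equiv> fderiv (\<lambda>_. 0)"

lemma fder_zero: "fder dg 0 = 0" by (simp add: fderiv_def)

lemma fder_add: "fder dg (p + q) = fder dg p + fder dg q"
  unfolding fderiv_def
  by (rule setsum_keys_plus_distrib) (simp_all add: fscal_def single_add distrib_right)

lemma fder_single: "fder dg (Poly_Mapping.single w c) = fscal c * word_deriv dg w"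
  by (cases "c = 0") (simp_all add: fderiv_def fscal_def)

lemma word_deriv_append:
  fixes dg :: "'g \<Rightarrow> ('g, 'r::comm_ring_1) free_alg"
  shows "word_deriv dg (u @ v) = word_deriv dg u * Poly_Mapping.single v 1
     + Poly_Mapping.single u 1 * word_deriv dg v"
proof (induction u)
  case Nil
  have "Poly_Mapping.single [] 1 = (1 :: ('g, 'r) free_alg)"
    using single_one[where 'a = "'g list" and 'b = 'r] by (simp add: zero_list_def del: single_one)
  then show ?case by simp
next
  case (Cons a u)
  have "Poly_Mapping.single (u @ v) 1 = (Poly_Mapping.single u 1 * Poly_Mapping.single v 1 :: ('g, 'r) free_alg)"
    "Poly_Mapping.single (a # u) 1 = (fgen a * Poly_Mapping.single u 1 :: ('g, 'r) free_alg)"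
    by (simp_all add: mult_single plus_list_def fgen_def)
  then show ?case by (simp add: Cons algebra_simps)
qed

lemma fder_mult: "fder dg (p * q) = fder dg p * q + p * fder dg q"
proof (induction p rule: pm_induct)
  case (single w c)
  show ?case
  proof (induction q rule: pm_induct)
    case (single v d)
    have w: "Poly_Mapping.single u e = fscal e * Poly_Mapping.single u 1" for u :: "'a list" and e :: 'b
      by (simp add: fscal_def mult_single plus_list_def)
    have cd: "fscal (c * d) = fscal c * (fscal d :: ('a, 'b) free_alg)"
      by (simp add: fscal_def mult_single plus_list_def)
    have "fscal c * fscal d * (word_deriv dg w * Poly_Mapping.single v 1)
        = fscal c * word_deriv dg w * (fscal d * Poly_Mapping.single v 1)"
      using fscal_central[of d "word_deriv dg w"] by (metis mult.assoc)
    moreover have "fscal c * fscal d * (Poly_Mapping.single w 1 * word_deriv dg v)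
        = fscal c * Poly_Mapping.single w 1 * (fscal d * word_deriv dg v)"
      using fscal_central[of d "Poly_Mapping.single w 1"] by (metis mult.assoc)
    moreover have "fder dg (Poly_Mapping.single w c * Poly_Mapping.single v d)
        = fscal c * fscal d * (word_deriv dg w * Poly_Mapping.single v 1)
        + fscal c * fscal d * (Poly_Mapping.single w 1 * word_deriv dg v)"
      by (simp only: mult_single plus_list_def fder_single word_deriv_append cd distrib_left)
    ultimately show ?case
      by (simp only: fder_single flip: w)
  qed (simp_all add: fder_zero fder_add distrib_left)
qed (simp_all add: fder_zero fder_add distrib_right)


lemma fder_uminus: "fder dg (- p) = - fder dg p"
  using fder_add[of dg p "- p"] by (simp add: fder_zero eq_neg_iff_add_eq_0 add.commute)

lemma fder_diff: "fder dg (p - q) = fder dg p - fder dg q"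
  using fder_add[of dg p "- q"] by (simp add: fder_uminus)

lemma fder_fgen:
  fixes dg :: "'g \<Rightarrow> ('g, 'r::comm_ring_1) free_alg"
  shows "fder dg (fgen a) = dg a"
proof -
  have "Poly_Mapping.single [] 1 = (1 :: ('g, 'r) free_alg)"
    using single_one[where 'a = "'g list" and 'b = 'r] by (simp add: zero_list_def del: single_one)
  then show ?thesis by (simp add: fgen_def fder_single fscal_def)
qed

lemma fder_fscal: "fder dg (fscal c) = 0"
  by (simp add: fscal_def fder_single)

lemma h_deriv_add: "h_deriv (x + y) = h_deriv x + h_deriv y"
  by (cases x; cases y) (simp add: rav_deriv_add)

lemma h_deriv_scale: "h_deriv (h_scale c x) = h_scale c (h_deriv x)"
proof -
  have "rav_deriv (rav_const c * k) = rav_const c * rav_deriv k" for k :: "complex rav"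
    using rav_deriv_mult[of "rav_const c" k] by (simp add: rav_const_def rav_deriv_reg flip: zero_rav_def)
  then show ?thesis by (cases x) simp
qed

lemma h_deriv_deg: "x \<in> h_deg r \<Longrightarrow> h_deriv x \<in> h_deg r"
proof -
  have 1: "reg k = 0 \<Longrightarrow> reg (- rav_deriv k) = 0" for k :: "complex rav"
    by (simp add: rav_deriv_def uminus_rav_def)
  have "sing_deriv 0 = (0 :: nat \<Rightarrow>\<^sub>0 complex)" by (rule poly_mapping_eqI) (simp add: sing_deriv.rep_eq)
  then have 2: "sing k = 0 \<Longrightarrow> sing (- rav_deriv k) = 0" for k :: "complex rav"
    by (simp add: rav_deriv_def uminus_rav_def)
  show "x \<in> h_deg r \<Longrightarrow> h_deriv x \<in> h_deg r"
    unfolding h_deg_def by (cases x) (use 1 2 in fastforce)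
qed

lemma du_pair_bound:
  assumes "\<And>m. m \<ge> N \<Longrightarrow> Poly_Mapping.lookup g m = 0"
  shows "du_pair f g = (\<Sum>m<N. of_nat (m + 1) * f $ (m + 1) * Poly_Mapping.lookup g m)"
  unfolding du_pair_def
  by (rule sum.mono_neutral_left) (auto simp: in_keys_iff, meson assms not_le)

lemma du_pair_deriv: "du_pair (fps_deriv f) g + du_pair f (sing_deriv g) = 0"
proof -
  obtain N where N: "\<And>m. m \<ge> N \<Longrightarrow> Poly_Mapping.lookup g m = 0"
    using sing_bound by blast
  then have N': "\<And>m. m \<ge> Suc N \<Longrightarrow> Poly_Mapping.lookup (sing_deriv g) m = 0"
    by (simp add: sing_deriv.rep_eq)
  have "du_pair f (sing_deriv g)
      = (\<Sum>m<Suc N. of_nat (m + 1) * f $ (m + 1) * Poly_Mapping.lookup (sing_deriv g) m)"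
    by (rule du_pair_bound) (rule N')
  also have "\<dots> = - (\<Sum>m<N. of_nat (m + 1) * fps_deriv f $ (m + 1) * Poly_Mapping.lookup g m)"
    by (subst sum.lessThan_Suc_shift) (simp add: sing_deriv.rep_eq sum_negf[symmetric] algebra_simps)
  also have "(\<Sum>m<N. of_nat (m + 1) * fps_deriv f $ (m + 1) * Poly_Mapping.lookup g m) = du_pair (fps_deriv f) g"
    by (rule du_pair_bound[symmetric]) (rule N)
  finally show ?thesis by simp
qed

lemma du_pair_uminus: "du_pair (- f) g = - du_pair f g" "du_pair f (- g) = - du_pair f g"
proof -
  have "Poly_Mapping.keys (- g) = Poly_Mapping.keys g" by (auto simp: in_keys_iff)
  then show "du_pair (- f) g = - du_pair f g" "du_pair f (- g) = - du_pair f g"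
    by (simp_all add: du_pair_def sum_negf)
qed

lemma h_bracket_deriv: "h_bracket (h_deriv x) y + h_bracket x (h_deriv y) = 0"
proof -
  have a: "du_pair f (sing_deriv g) = - du_pair (fps_deriv f) g" for f g
    using du_pair_deriv[of f g] by (simp add: eq_neg_iff_add_eq_0 add.commute)
  show ?thesis
    by (cases x; cases y) (simp add: rav_deriv_def uminus_rav_def du_pair_uminus a zero_prod_def)
qed

lemma uea_deriv_ideal:
  assumes "p \<in> two_sided_ideal uea_rels"
  shows "fder (\<lambda>x. fgen (h_deriv x)) p \<in> two_sided_ideal uea_rels"
  using assms
proof induction
  case zero
  then show ?case by (simp add: fder_zero two_sided_ideal.zero)
next
  case (step r x a b)
  let ?D = "fder (\<lambda>x. fgen (h_deriv x)) :: (hhat, complex) free_alg \<Rightarrow> _"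
  have add: "fgen (x + y) - fgen x - fgen y \<in> two_sided_ideal uea_rels" for x y :: hhat
    by (intro ideal_gen uea_relsI)
  have scale: "fgen (h_scale c x) - fscal c * fgen x \<in> two_sided_ideal uea_rels" for c x
    by (intro ideal_gen uea_relsI)
  have comm: "fgen x * fgen y - fscal (koszul_sign r s) * fgen y * fgen x - fgen (h_bracket x y)
      \<in> two_sided_ideal uea_rels" if "x \<in> h_deg r" "y \<in> h_deg s" for x y r s
    by (intro ideal_gen uea_relsI that)
  have "?D r \<in> two_sided_ideal uea_rels"
    using step(1)
  proof (cases rule: uea_rels_cases)
    case (1 x y)
    then show ?thesis
      by (simp add: fder_diff fder_fgen h_deriv_add add)
  next
    case (2 c x)
    then show ?thesis
      by (simp add: fder_diff fder_fgen fder_mult fder_fscal h_deriv_scale scale)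
  next
    case (3 x y i j)
    note r = 3(1) and d = 3(2,3)
    let ?dx = "h_deriv x" and ?dy = "h_deriv y"
    let ?k = "fscal (koszul_sign i j)"
    let ?A = "fgen ?dx * fgen y - ?k * fgen y * fgen ?dx - fgen (h_bracket ?dx y)"
    let ?B = "fgen x * fgen ?dy - ?k * fgen ?dy * fgen x - fgen (h_bracket x ?dy)"
    let ?C = "fgen (h_bracket ?dx y + h_bracket x ?dy) - fgen (h_bracket ?dx y) - fgen (h_bracket x ?dy)"
    have dK: "h_deriv (h_bracket x y) = 0"
      by (cases x; cases y) (simp add: zero_prod_def rav_deriv_zero)
    have "?D r = ?A + ?B - ?C"
      unfolding r h_bracket_deriv fder_diff fder_mult fder_fscal fder_fgen dK
      by (simp add: algebra_simps)
    moreover have "?A + ?B - ?C \<in> two_sided_ideal uea_rels"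
      by (intro ideal_diff ideal_add comm add d h_deriv_deg)
    ultimately show ?thesis
      by simp
  qed
  then have "a * ?D r * b \<in> two_sided_ideal uea_rels"
    by (intro ideal_rmult ideal_lmult)
  moreover have "r \<in> two_sided_ideal uea_rels" by (rule ideal_gen) (rule step)
  then have "?D a * r * b \<in> two_sided_ideal uea_rels" "a * r * ?D b \<in> two_sided_ideal uea_rels"
    by (intro ideal_rmult ideal_lmult; simp)+
  ultimately show ?case
    using step(3) by (simp add: fder_add fder_mult distrib_right ideal_add)
qed

lift_definition u_deriv :: "uea \<Rightarrow> uea" is "fder (\<lambda>x. fgen (h_deriv x))"
proof -
  fix p q :: "(hhat, complex) free_alg" assume "p - q \<in> two_sided_ideal uea_rels"
  from uea_deriv_ideal[OF this]
  show "fder (\<lambda>x. fgen (h_deriv x)) p - fder (\<lambda>x. fgen (h_deriv x)) q \<in> two_sided_ideal uea_rels"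
    by (simp add: fder_diff)
qed

lemma u_deriv_add: "u_deriv (u + v) = u_deriv u + u_deriv v"
  by transfer (simp add: fder_add two_sided_ideal.zero)

lemma u_deriv_mult: "u_deriv (u * v) = u_deriv u * v + u * u_deriv v"
  by transfer (simp add: fder_mult two_sided_ideal.zero)

lemma u_deriv_scal: "u_deriv (u_scal c) = 0"
  by transfer (simp add: fder_fscal two_sided_ideal.zero)

lemma u_deriv_inc: "u_deriv (u_inc x) = u_inc (h_deriv x)"
  by transfer (simp add: fder_fgen two_sided_ideal.zero)

lemma u_scal_central: "u_scal c * u = u * u_scal c"
  by transfer (simp add: fscal_central two_sided_ideal.zero)

section \<open>The induced module\<close>

lifting_forget uea.lifting

definition pm_scale :: "complex \<Rightarrow> ('k \<Rightarrow>\<^sub>0 complex) \<Rightarrow> ('k \<Rightarrow>\<^sub>0 complex)" where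
  "pm_scale c = Poly_Mapping.map ((*) c)"

lemma lookup_pm_scale [simp]: "Poly_Mapping.lookup (pm_scale c p) k = c * Poly_Mapping.lookup p k"
  by (simp add: pm_scale_def lookup_pm_map)

interpretation pm: vector_space "pm_scale :: complex \<Rightarrow> ('k \<Rightarrow>\<^sub>0 complex) \<Rightarrow> _"
  by unfold_locales (auto intro!: poly_mapping_eqI simp: lookup_add algebra_simps)

abbreviation basis :: "'k \<Rightarrow> ('k \<Rightarrow>\<^sub>0 complex)" where
  "basis k \<equiv> Poly_Mapping.single k 1"

text \<open>The tensor product of the enveloping algebra with \<open>C_1\<close>. Since \<open>h_nonneg\<close> generates its
  enveloping algebra, it is enough to balance by its elements.\<close>

definition tensor_rels :: "(uea \<times> complex \<Rightarrow>\<^sub>0 complex) set" where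
  "tensor_rels =
     {basis (u + v, t) - basis (u, t) - basis (v, t) |u v t. True}
   \<union> {basis (u, s + t) - basis (u, s) - basis (u, t) |u s t. True}
   \<union> {basis (u_scal c * u, t) - pm_scale c (basis (u, t)) |c u t. True}
   \<union> {basis (u, c * t) - pm_scale c (basis (u, t)) |c u t. True}
   \<union> {basis (u * u_inc x, t) - basis (u, h_char x * t) |u x t. x \<in> h_nonneg}"

quotient_type heis = "uea \<times> complex \<Rightarrow>\<^sub>0 complex" / "\<lambda>p q. p - q \<in> module.span pm_scale tensor_rels"
proof (rule equivpI)
  show "reflp (\<lambda>p q. p - q \<in> pm.span tensor_rels)" by (auto intro!: reflpI pm.span_zero)
  show "symp (\<lambda>p q. p - q \<in> pm.span tensor_rels)"
    by (rule sympI) (metis pm.span_neg minus_diff_eq)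
  show "transp (\<lambda>p q. p - q \<in> pm.span tensor_rels)"
  proof (rule transpI)
    fix x y z :: "uea \<times> complex \<Rightarrow>\<^sub>0 complex"
    assume "x - y \<in> pm.span tensor_rels" "y - z \<in> pm.span tensor_rels"
    from pm.span_add[OF this] show "x - z \<in> pm.span tensor_rels" by simp
  qed
qed

instantiation heis :: ab_group_add
begin

lift_definition zero_heis :: heis is 0 .
lift_definition plus_heis :: "heis \<Rightarrow> heis \<Rightarrow> heis" is "(+)"
  by (metis (no_types, lifting) add_diff_add pm.span_add)
lift_definition minus_heis :: "heis \<Rightarrow> heis \<Rightarrow> heis" is "(-)"
proof -
  fix a b c d :: "uea \<times> complex \<Rightarrow>\<^sub>0 complex"
  assume "a - b \<in> pm.span tensor_rels" "c - d \<in> pm.span tensor_rels"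
  from pm.span_diff[OF this] show "a - c - (b - d) \<in> pm.span tensor_rels" by (simp add: algebra_simps)
qed
lift_definition uminus_heis :: "heis \<Rightarrow> heis" is "uminus"
  by (metis pm.span_neg minus_diff_eq minus_diff_minus)

instance
  by standard (transfer, simp add: algebra_simps pm.span_zero)+

end

lift_definition heis_scale :: "complex \<Rightarrow> heis \<Rightarrow> heis" is pm_scale
  by (metis pm.scale_right_diff_distrib pm.span_scale)

lift_definition heis_tensor :: "uea \<Rightarrow> complex \<Rightarrow> heis" is "\<lambda>u t. basis (u, t)" .

definition pm_push :: "('k \<Rightarrow> 'l) \<Rightarrow> ('k \<Rightarrow>\<^sub>0 complex) \<Rightarrow> ('l \<Rightarrow>\<^sub>0 complex)" where
  "pm_push f p = (\<Sum>k\<in>Poly_Mapping.keys p. Poly_Mapping.single (f k) (Poly_Mapping.lookup p k))"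

lemma pm_push_single: "pm_push f (Poly_Mapping.single k c) = Poly_Mapping.single (f k) c"
  by (cases "c = 0") (simp_all add: pm_push_def)

lemma pm_push_add: "pm_push f (p + q) = pm_push f p + pm_push f q"
  unfolding pm_push_def by (rule setsum_keys_plus_distrib) (simp_all add: single_add)

lemma pm_scale_single: "pm_scale c (Poly_Mapping.single k d) = Poly_Mapping.single k (c * d)"
  by (simp add: pm_scale_def)

lemma pm_push_scale: "pm_push f (pm_scale c p) = pm_scale c (pm_push f p)"
proof (induction p rule: pm_induct)
  case (add p q)
  then show ?case by (simp add: pm.scale_right_distrib pm_push_add)
qed (simp_all add: pm_scale_single pm_push_single, simp add: pm_push_def)

lemma pm_push_diff: "pm_push f (p - q) = pm_push f p - pm_push f q"
  using pm_push_add[of f "p - q" q] by simp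

lemma pm_push_span:
  assumes "\<And>r. r \<in> R \<Longrightarrow> pm_push f r \<in> pm.span S" "p \<in> pm.span R"
  shows "pm_push f p \<in> pm.span S"
  using assms(2)
proof (induction rule: pm.span_induct_alt)
  case base
  then show ?case by (simp add: pm_push_def pm.span_zero)
next
  case (step c x y)
  then show ?case by (simp add: pm_push_add pm_push_scale pm.span_add pm.span_scale assms(1))
qed

lemma tensor_relsI:
  "basis (u + v, t) - basis (u, t) - basis (v, t) \<in> tensor_rels"
  "basis (u, s + t) - basis (u, s) - basis (u, t) \<in> tensor_rels"
  "basis (u_scal c * u, t) - pm_scale c (basis (u, t)) \<in> tensor_rels"
  "basis (u, c * t) - pm_scale c (basis (u, t)) \<in> tensor_rels"
  "x \<in> h_nonneg \<Longrightarrow> basis (u * u_inc x, t) - basis (u, h_char x * t) \<in> tensor_rels"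
  unfolding tensor_rels_def by blast+

lemma tensor_rels_cases:
  assumes "r \<in> tensor_rels"
  obtains u v t where "r = basis (u + v, t) - basis (u, t) - basis (v, t)"
  | u s t where "r = basis (u, s + t) - basis (u, s) - basis (u, t)"
  | c u t where "r = basis (u_scal c * u, t) - pm_scale c (basis (u, t))"
  | c u t where "r = basis (u, c * t) - pm_scale c (basis (u, t))"
  | u x t where "r = basis (u * u_inc x, t) - basis (u, h_char x * t)" "x \<in> h_nonneg"
  using assms unfolding tensor_rels_def by blast

lift_definition heis_act :: "uea \<Rightarrow> heis \<Rightarrow> heis" is "\<lambda>u. pm_push (\<lambda>(v, t). (u * v, t))"
proof -
  fix u and p q :: "uea \<times> complex \<Rightarrow>\<^sub>0 complex"
  let ?f = "\<lambda>(v :: uea, t :: complex). (u * v, t)"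
  assume pq: "p - q \<in> pm.span tensor_rels"
  have "pm_push ?f r \<in> pm.span tensor_rels" if "r \<in> tensor_rels" for r
    using that
  proof (cases rule: tensor_rels_cases)
    case (3 c v t)
    have "u * (u_scal c * v) = u_scal c * (u * v)"
      by (metis mult.assoc u_scal_central)
    with 3 show ?thesis
      by (simp add: pm_push_diff pm_push_single pm_push_scale pm.span_base tensor_relsI)
  next
    case (5 v x t)
    then show ?thesis
      by (simp add: pm_push_diff pm_push_single mult.assoc[symmetric] pm.span_base tensor_relsI)
  qed (simp_all add: pm_push_diff pm_push_single pm_push_scale distrib_left pm.span_base tensor_relsI)
  from pm_push_span[OF this pq]
  show "pm_push ?f p - pm_push ?f q \<in> pm.span tensor_rels" by (simp add: pm_push_diff)
qed

lift_definition heis_trans :: "heis \<Rightarrow> heis" is "pm_push (\<lambda>(v, t). (u_deriv v, t))"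
proof -
  fix p q :: "uea \<times> complex \<Rightarrow>\<^sub>0 complex"
  let ?f = "\<lambda>(v :: uea, t :: complex). (u_deriv v, t)"
  assume pq: "p - q \<in> pm.span tensor_rels"
  have "pm_push ?f r \<in> pm.span tensor_rels" if "r \<in> tensor_rels" for r
    using that
  proof (cases rule: tensor_rels_cases)
    case (3 c v t)
    then show ?thesis
      by (simp add: pm_push_diff pm_push_single pm_push_scale u_deriv_mult u_deriv_scal pm.span_base tensor_relsI)
  next
    case (5 v x t)
    have x: "h_deriv x \<in> h_nonneg" "h_char (h_deriv x) = 0"
      using 5(2) by (cases x; auto simp: h_nonneg_def rav_deriv_def uminus_rav_def
        intro!: poly_mapping_eqI simp: sing_deriv.rep_eq)+
    have z: "basis (v, 0) \<in> pm.span tensor_rels"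
      using tensor_relsI(4)[of v 0 0] by (simp add: pm.span_base)
    have "pm_push ?f r = (basis (u_deriv v * u_inc x + v * u_inc (h_deriv x), t)
          - basis (u_deriv v * u_inc x, t) - basis (v * u_inc (h_deriv x), t))
        + (basis (u_deriv v * u_inc x, t) - basis (u_deriv v, h_char x * t))
        + (basis (v * u_inc (h_deriv x), t) - basis (v, h_char (h_deriv x) * t))
        + basis (v, 0)"
      by (simp add: 5(1) x pm_push_diff pm_push_single u_deriv_mult u_deriv_inc)
    also have "\<dots> \<in> pm.span tensor_rels"
      by (intro pm.span_add pm.span_base tensor_relsI 5 x z)
    finally show ?thesis .
  qed (simp_all add: pm_push_diff pm_push_single pm_push_scale u_deriv_add pm.span_base tensor_relsI)
  from pm_push_span[OF this pq]
  show "pm_push ?f p - pm_push ?f q \<in> pm.span tensor_rels" by (simp add: pm_push_diff)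
qed

definition heis_vac :: heis where "heis_vac = heis_tensor 1 1"

text \<open>The (cohomological or spin) grading induced by a grading of the Lie algebra, with
  \<open>C_1\<close> placed in weight 0.\<close>

definition heis_grading :: "(int \<Rightarrow> hhat set) \<Rightarrow> int \<Rightarrow> heis set" where
  "heis_grading G r = module.span heis_scale
     {heis_tensor (prod_list (map u_inc xs)) 1 |xs rs. list_all2 (\<lambda>x i. x \<in> G i) xs rs \<and> sum_list rs = r}"

lemma heis_trans_tensor: "heis_trans (heis_tensor u t) = heis_tensor (u_deriv u) t"
  by transfer (simp add: pm_push_single pm.span_zero)

lemma heis_act_tensor: "heis_act v (heis_tensor u t) = heis_tensor (v * u) t"
  by transfer (simp add: pm_push_single pm.span_zero)

end

theory Submission
  imports Defs
begin

text \<open>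
  \<^emph>\<open>The fields.\<close> \<open>H\<close> is a Fock space: it is spanned by monomials in the creation modes \<open>b_n\<close>,
  \<open>nu_n\<close> applied to the vacuum, on which \<open>phi_n\<close> and \<open>c_n\<close> act as multiples of derivatives. The
  field of a monomial is the normally ordered product of divided derivatives of \<open>b(z)\<close> and
  \<open>nu(z)\<close>, one for each factor. Since \<open>Omega_z^m Omega_z^n = 0\<close>, such a product is
  \<open>:X A: = X_+ A + A_+ X_-\<close> up to signs, with at most one annihilation mode in each term.

  \<^emph>\<open>Locality.\<close> The commutator of a letter \<open>X(z)\<close> with a normally ordered product \<open>B(w)\<close> is a sum
  of terms \<open>c Omega_(z-w)^k B'(w)\<close>, where \<open>B'\<close> arises from \<open>B\<close> by deleting one letter
  (\<open>commutes_wfield\<close>). Hence, for \<open>A = :X A':\<close>, the product \<open>A(z) B(w) v\<close> is the sum of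
  \<open>X_+(z) A'(z) B(w) v\<close>, of terms \<open>Omega_z^m A'(z) B(w) X_m v\<close> and of terms
  \<open>c Omega_(z-w)^k A'(z) B'(w) v\<close>, and \<open>B(w) A(z) v\<close> is the same sum with the factors in the
  opposite order and with \<open>Omega_(z-w)^k\<close> expanded in the other domain (\<open>local_zw_step\<close>,
  \<open>local_wz_step\<close>). Pairs of families that are the two expansions of one element are closed under
  multiplication by \<open>Omega_z^m\<close>, by \<open>Omega_(z-w)^k\<close> and by series in z, so induction on the number of
  letters proves locality (\<open>word_fields_local\<close>). The orders k depend on the letters only, which
  bounds the pole at \<open>z = w\<close> uniformly.

  \<^emph>\<open>The gradings.\<close> Degree and spin come from automorphisms of the Lie algebra that rescale each mode
  by a power of 2. They act on \<open>H\<close>, and the homogeneous components are exactly their eigenspaces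
  (\<open>grading_weight_space\<close>); this makes the sums of the components direct.

  \<^emph>\<open>The state-field correspondence.\<close> Among the monomial vectors one can choose a basis of \<open>H\<close> that
  contains \<open>|0>\<close>, \<open>b_0|0>\<close> and \<open>nu_0|0>\<close> (\<open>exists_word_basis\<close>). Sending each basis vector to the
  normally ordered product of its monomial defines \<open>Y\<close> by linear extension. All axioms are linear
  in the states, and for normally ordered products they are proved by induction on the letters.
\<close>

section \<open>Koszul signs and coefficient sequences\<close>

text \<open>A sign whose exponent is a truth value. Sums of parities become inequalities of truth values, so
  that an identity between Koszul signs can be checked by distinguishing cases.\<close>

definition sgn_if :: "bool \<Rightarrow> 'v \<Rightarrow> 'v::ab_group_add" where
  "sgn_if b v = (if b then - v else v)"

lemma sgn_if_simps [simp]: "sgn_if False v = v" "sgn_if True v = - v" "sgn_if b 0 = 0"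
  by (simp_all add: sgn_if_def)

lemma sgn_if_add: "sgn_if b (u + v) = sgn_if b u + sgn_if b v"
  by (simp add: sgn_if_def)

lemma sgn_if_diff: "sgn_if b (u - v) = sgn_if b u - sgn_if b v"
  by (simp add: sgn_if_def)

lemma sgn_if_sum: "sgn_if b (sum f A) = (\<Sum>x\<in>A. sgn_if b (f x))"
  by (simp add: sgn_if_def sum_negf)

lemma sgn_if_sgn_if: "sgn_if a (sgn_if b v) = sgn_if (a \<noteq> b) v"
  by (simp add: sgn_if_def)

text \<open>The coefficients of \<open>z^n A(z)\<close>. An index \<open>p < 0\<close> belongs to \<open>z^(-p-1)\<close> and an index \<open>p \<ge> 0\<close> to
  \<open>Omega^p\<close>; since multiplication by z never turns an \<open>Omega\<close> into a power of z, the coefficient is 0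
  where the shift would cross from one range to the other.\<close>

definition zshift :: "nat \<Rightarrow> (int \<Rightarrow> 'a::zero) \<Rightarrow> int \<Rightarrow> 'a" where
  "zshift n A p = (if p < 0 \<and> 0 \<le> p + int n then 0 else A (p + int n))"

text \<open>The coefficients of \<open>Omega^m A(z)\<close>, to which only the regular part of A contributes:
  \<open>Omega^m z^i = Omega^(m-i)\<close>.\<close>

definition Om_shift :: "nat \<Rightarrow> (int \<Rightarrow> 'a::zero) \<Rightarrow> int \<Rightarrow> 'a" where
  "Om_shift m A p = (if 0 \<le> p \<and> p \<le> int m then A (p - int m - 1) else 0)"

definition vanishes_from :: "(int \<Rightarrow> 'a::zero) \<Rightarrow> nat \<Rightarrow> bool" where
  "vanishes_from A N \<longleftrightarrow> (\<forall>m\<ge>int N. A m = 0)"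

lemma vanishes_mono: "vanishes_from A N \<Longrightarrow> N \<le> M \<Longrightarrow> vanishes_from A M"
  by (auto simp: vanishes_from_def)

lemma zshift_0 [simp]: "zshift 0 A = A"
  by (auto simp: zshift_def fun_eq_iff)

lemma zshift_Om_shift: "zshift n (Om_shift m A) p = (if n \<le> m then Om_shift (m - n) A p else 0)"
  by (auto simp: Om_shift_def zshift_def of_nat_diff algebra_simps)

lemma zshift_vanishes: "vanishes_from A N \<Longrightarrow> N \<le> n \<Longrightarrow> nat (- p) \<le> n \<Longrightarrow> zshift n A p = 0"
  by (auto simp: zshift_def vanishes_from_def)

text \<open>The sum of all values, for functions with finite support. The modes of a product of fields are
  such sums on every vector, but the support depends on the vector.\<close>

definition sum_supp :: "(nat \<Rightarrow> 'v) \<Rightarrow> 'v::ab_group_add" where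
  "sum_supp f = sum f {n. f n \<noteq> 0}"

lemma sum_supp_eq: "(\<And>n. n \<ge> M \<Longrightarrow> f n = 0) \<Longrightarrow> sum_supp f = (\<Sum>n<M. f n)"
  unfolding sum_supp_def by (rule sum.mono_neutral_left) (auto, meson not_le)

type_synonym 'v modes = "int \<Rightarrow> 'v \<Rightarrow> 'v"

abbreviation zshift_at :: "nat \<Rightarrow> (int \<Rightarrow> 'v \<Rightarrow> 'v::zero) \<Rightarrow> int \<Rightarrow> 'v \<Rightarrow> 'v" where
  "zshift_at n A p v \<equiv> zshift n (\<lambda>p. A p v) p"
abbreviation Om_shift_at :: "nat \<Rightarrow> (int \<Rightarrow> 'v \<Rightarrow> 'v::zero) \<Rightarrow> int \<Rightarrow> 'v \<Rightarrow> 'v" where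
  "Om_shift_at n A p v \<equiv> Om_shift n (\<lambda>p. A p v) p"

section \<open>Normally ordered products of free fields\<close>

locale complex_space = vector_space scale
  for scale :: "complex \<Rightarrow> 'v::ab_group_add \<Rightarrow> 'v"

begin

abbreviation lin_op :: "('v \<Rightarrow> 'v) \<Rightarrow> bool" where "lin_op \<equiv> Vector_Spaces.linear scale scale"

text \<open>The first N terms of the product with \<open>Omega_(z-w)^k = \<Sum>i. ((k + i) choose i) w^i Omega_z^(k+i)\<close>.
  Exchanging the variables gives the other expansion up to the sign \<open>(-1)^k\<close>.\<close>

abbreviation Om_diff_part :: "nat \<Rightarrow> (int \<Rightarrow> int \<Rightarrow> 'v) \<Rightarrow> nat \<Rightarrow> int \<Rightarrow> int \<Rightarrow> 'v" where
  "Om_diff_part k S N a b \<equiv>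
    (\<Sum>i<N. scale (of_nat ((k + i) choose i)) (Om_shift (k + i) (\<lambda>a. zshift i (\<lambda>b. S a b) b) a))"

lemma linear_rules:
  assumes "lin_op T"
  shows "T 0 = 0" "T (u + v) = T u + T v" "T (- v) = - T v" "T (u - v) = T u - T v" "T (scale c v) = scale c (T v)"
    "T (sgn_if b v) = sgn_if b (T v)" "T (sum f A) = (\<Sum>i\<in>A. T (f i))"
    "T (if Q then u else v) = (if Q then T u else T v)"
proof -
  interpret T: Vector_Spaces.linear scale scale T by fact
  show "T 0 = 0" "T (u + v) = T u + T v" "T (- v) = - T v" "T (u - v) = T u - T v" "T (scale c v) = scale c (T v)"
    "T (sgn_if b v) = sgn_if b (T v)" "T (sum f A) = (\<Sum>i\<in>A. T (f i))"
    "T (if Q then u else v) = (if Q then T u else T v)"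
    by (simp_all add: T.zero T.add T.neg T.diff T.scale T.sum sgn_if_def)
qed

lemma linear_intro:
  assumes "\<And>u v. T (u + v) = T u + T v" "\<And>c v. T (scale c v) = scale c (T v)"
  shows "lin_op T"
  using assms by unfold_locales auto

lemma scale_sgn_if: "scale c (sgn_if b v) = sgn_if b (scale c v)"
  by (simp add: sgn_if_def)

end

text \<open>A letter l stands for the field with the coefficients \<open>cr l n\<close> of \<open>z^n\<close> and \<open>an l n\<close> of
  \<open>Omega_z^n\<close>. The last two axioms say that the commutator of \<open>l(z)\<close> and \<open>l'(w)\<close> is
  \<open>ccoef l l' * Omega_(z-w)^(cord l l')\<close>: they are its expansions at \<open>w = 0\<close> and at \<open>z = 0\<close>, and
  since \<open>Omega\<close> is odd the two letters have opposite parities whenever it is not 0.\<close>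

locale free_fields = complex_space scale
  for scale :: "complex \<Rightarrow> 'v::ab_group_add \<Rightarrow> 'v" +
  fixes odd_l :: "'l \<Rightarrow> bool" and cr an :: "'l \<Rightarrow> nat \<Rightarrow> 'v \<Rightarrow> 'v"
    and ccoef :: "'l \<Rightarrow> 'l \<Rightarrow> complex" and cord :: "'l \<Rightarrow> 'l \<Rightarrow> nat"
  assumes cr_linear: "lin_op (cr l n)"
    and an_linear: "lin_op (an l n)"
    and an_bnd: "\<exists>N. \<forall>m\<ge>N. an l m v = 0"
    and cr_cr: "cr l n (cr l' n' v) = sgn_if (odd_l l \<and> odd_l l') (cr l' n' (cr l n v))"
    and an_an: "an l m (an l' m' v) = sgn_if (\<not> odd_l l \<and> \<not> odd_l l') (an l' m' (an l m v))"
    and an_cr: "an l m (cr l' n v) = sgn_if (\<not> odd_l l \<and> odd_l l') (cr l' n (an l m v)) +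
       (if odd_l l \<noteq> odd_l l' \<and> m = cord l l' + n then scale (ccoef l l' * of_nat (m choose cord l l')) v else 0)"
    and cr_an: "cr l n (an l' m v) = sgn_if (odd_l l \<and> \<not> odd_l l') (an l' m (cr l n v)) -
       (if odd_l l \<noteq> odd_l l' \<and> m = cord l l' + n
        then sgn_if (odd_l l) (scale (ccoef l l' * (- 1) ^ cord l l' * of_nat (m choose cord l l')) v) else 0)"
begin

lemmas cr_rules = linear_rules[OF cr_linear] and an_rules = linear_rules[OF an_linear]

text \<open>The modes of \<open>:X(z) A(z): = X_+(z) A(z) + (-1)^(|X| r) A(z) X_-(z)\<close> for a field A of parity r.
  In the second term only the regular part of A survives, because \<open>Omega_z^m Omega_z^n = 0\<close>.
  The remaining signs come from moving \<open>Omega_z\<close> to the left of a mode.\<close>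

definition nprod :: "'l \<Rightarrow> bool \<Rightarrow> 'v modes \<Rightarrow> 'v modes" where
  "nprod X r A p v = sgn_if (odd_l X \<and> 0 \<le> p) (sum_supp (\<lambda>n. cr X n (zshift_at n A p v)))
     + sgn_if (r \<and> \<not> odd_l X) (sum_supp (\<lambda>m. Om_shift_at m A p (an X m v)))"

definition is_field :: "'v modes \<Rightarrow> bool" where
  "is_field A \<longleftrightarrow> (\<forall>p. lin_op (A p)) \<and> (\<forall>v. \<exists>N. vanishes_from (\<lambda>p. A p v) N)"

lemma is_field_linear: "is_field A \<Longrightarrow> lin_op (A p)"
  by (simp add: is_field_def)

lemma is_field_vanishes: assumes "is_field A" obtains N where "vanishes_from (\<lambda>p. A p v) N"
  using assms unfolding is_field_def by blast

lemma nprod_eq: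
  assumes "is_field A" "vanishes_from (\<lambda>p. A p v) M" "nat (- p) \<le> M" "\<forall>m\<ge>M. an X m v = 0"
  shows "nprod X r A p v = sgn_if (odd_l X \<and> 0 \<le> p) (\<Sum>n<M. cr X n (zshift_at n A p v))
     + sgn_if (r \<and> \<not> odd_l X) (\<Sum>m<M. Om_shift_at m A p (an X m v))"
proof -
  have "sum_supp (\<lambda>n. cr X n (zshift_at n A p v)) = (\<Sum>n<M. cr X n (zshift_at n A p v))"
    by (rule sum_supp_eq) (use assms in \<open>simp add: zshift_vanishes cr_rules\<close>)
  moreover have "sum_supp (\<lambda>m. Om_shift_at m A p (an X m v)) = (\<Sum>m<M. Om_shift_at m A p (an X m v))"
    by (rule sum_supp_eq) (use assms in \<open>simp add: Om_shift_def linear_rules[OF is_field_linear[OF assms(1)]]\<close>)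
  ultimately show ?thesis by (simp add: nprod_def)
qed

lemma field_bounds:
  assumes "is_field A"
  obtains M where "\<And>N. N \<ge> M \<Longrightarrow> vanishes_from (\<lambda>p. A p v) N" "\<And>N. N \<ge> M \<Longrightarrow> nat (- p) \<le> N" "\<And>N. N \<ge> M \<Longrightarrow> \<forall>m\<ge>N. an X m v = 0"
proof -
  obtain a where a: "vanishes_from (\<lambda>p. A p v) a" using is_field_vanishes[OF assms] by blast
  obtain b where b: "\<forall>m\<ge>b. an X m v = 0" using an_bnd by blast
  show ?thesis
    by (rule that[of "max a (max b (nat (- p)))"]) (use a b vanishes_mono in auto)
qed

text \<open>Bounds of the infinite sums are treated as limits: two such descriptions can be compared at a
  common large bound, without naming any bound.\<close>

lemma nprod_eventually:
  assumes "is_field A"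
  shows "\<forall>\<^sub>F N in sequentially. nprod X r A p v = sgn_if (odd_l X \<and> 0 \<le> p) (\<Sum>n<N. cr X n (zshift_at n A p v))
     + sgn_if (r \<and> \<not> odd_l X) (\<Sum>m<N. Om_shift_at m A p (an X m v))"
proof -
  obtain M where "\<And>N. N \<ge> M \<Longrightarrow> vanishes_from (\<lambda>p. A p v) N" "\<And>N. N \<ge> M \<Longrightarrow> nat (- p) \<le> N" "\<And>N. N \<ge> M \<Longrightarrow> \<forall>m\<ge>N. an X m v = 0"
    using field_bounds[OF assms, of v p X] by blast
  then show ?thesis by (intro eventually_sequentiallyI[of M] nprod_eq assms) blast+
qed

lemma at_simps: assumes "is_field A"
  shows "zshift_at n A p (u + v) = zshift_at n A p u + zshift_at n A p v" "zshift_at n A p (scale c v) = scale c (zshift_at n A p v)"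
    "Om_shift_at n A p (u + v) = Om_shift_at n A p u + Om_shift_at n A p v" "Om_shift_at n A p (scale c v) = scale c (Om_shift_at n A p v)"
    "Om_shift_at n A p (- v) = - Om_shift_at n A p v" "Om_shift_at n A p 0 = 0" "zshift_at n A p 0 = 0"
     "zshift_at n A p (- v) = - zshift_at n A p v" "Om_shift_at n A p (sgn_if b v) = sgn_if b (Om_shift_at n A p v)"
     "Om_shift_at n A p (u - v) = Om_shift_at n A p u - Om_shift_at n A p v"
  by (simp_all add: zshift_def Om_shift_def linear_rules[OF is_field_linear[OF assms]])

lemma eventually_const: "\<forall>\<^sub>F N in sequentially. P \<Longrightarrow> P"
  by simp

lemma is_field_nprod: assumes A: "is_field A" shows "is_field (nprod X r A)"
proof -
  have "nprod X r A p (u + v) = nprod X r A p u + nprod X r A p v" for p u v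
    by (rule eventually_const) (use nprod_eventually[OF A, of X r p u] nprod_eventually[OF A, of X r p v] nprod_eventually[OF A, of X r p "u + v"] in
      \<open>eventually_elim, simp add: at_simps[OF A] cr_rules an_rules sum.distrib sgn_if_add\<close>)
  moreover have "nprod X r A p (scale c v) = scale c (nprod X r A p v)" for p c v
    by (rule eventually_const) (use nprod_eventually[OF A, of X r p v] nprod_eventually[OF A, of X r p "scale c v"] in
      \<open>eventually_elim, simp add: at_simps[OF A] cr_rules an_rules scale_sum_right scale_right_distrib scale_sgn_if\<close>)
  moreover have "\<exists>N. vanishes_from (\<lambda>p. nprod X r A p v) N" for v
  proof -
    obtain M where M: "\<And>N. N \<ge> M \<Longrightarrow> vanishes_from (\<lambda>p. A p v) N" "\<And>N. N \<ge> M \<Longrightarrow> \<forall>m\<ge>N. an X m v = 0"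
      by (rule field_bounds[OF A, of v 0 X]) blast
    have "nprod X r A p v = 0" if "p \<ge> int M" for p
      by (subst nprod_eq[OF A M(1)[OF order_refl] _ M(2)[OF order_refl]])
        (use that M(1)[OF order_refl] in \<open>auto simp: zshift_def Om_shift_def vanishes_from_def cr_rules intro!: sum.neutral\<close>)
    then show ?thesis by (auto simp: vanishes_from_def)
  qed
  ultimately show ?thesis by (simp add: is_field_def linear_intro)
qed

definition id_field :: "'v modes" where "id_field p v = (if p = - 1 then v else 0)"

lemma is_field_id_field: "is_field id_field"
  by (auto simp: is_field_def id_field_def vanishes_from_def intro!: linear_intro exI[of _ 0])

fun w_odd :: "'l list \<Rightarrow> bool" where
  "w_odd [] = False" | "w_odd (X # w) = (odd_l X \<noteq> w_odd w)"

fun wfield :: "'l list \<Rightarrow> 'v modes" where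
  "wfield [] = id_field" | "wfield (X # w) = nprod X (w_odd w) (wfield w)"

lemma is_field_wfield: "is_field (wfield w)"
  by (induction w) (simp_all add: is_field_id_field is_field_nprod)

lemma is_field_zshift: assumes A: "is_field A" shows "is_field (\<lambda>p v. zshift_at a A p v)"
proof -
  have "vanishes_from (\<lambda>p. A p v) N \<Longrightarrow> vanishes_from (\<lambda>p. zshift_at a A p v) N" for v N
    by (auto simp: vanishes_from_def zshift_def)
  then show ?thesis using A unfolding is_field_def
    by (auto intro!: linear_intro simp: at_simps[OF A]) meson
qed

lemma nprod_zshift:
  assumes A: "is_field A"
  shows "nprod Y r (\<lambda>p v. zshift_at a A p v) q v = zshift_at a (nprod Y r A) q v"
proof (rule eventually_const)
  have s: "zshift n (zshift a B) q = (if q < 0 \<and> 0 \<le> q + int a then 0 else zshift n B (q + int a))"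
    and o: "Om_shift n (zshift a B) q = (if q < 0 \<and> 0 \<le> q + int a then 0 else Om_shift n B (q + int a))" for n and B :: "int \<Rightarrow> 'v"
    by (auto simp: zshift_def Om_shift_def add_ac intro!: arg_cong[where f = B])
  show "\<forall>\<^sub>F N in sequentially. nprod Y r (\<lambda>p v. zshift_at a A p v) q v = zshift_at a (nprod Y r A) q v"
    using nprod_eventually[OF is_field_zshift[OF A], of Y r a q v] nprod_eventually[OF A, of Y r "q + int a" v]
  proof eventually_elim
    case (elim N)
    show ?case
    proof (cases "q < 0 \<and> 0 \<le> q + int a")
      case True
      with elim(1) show ?thesis by (simp add: s o zshift_def[of a "\<lambda>p. nprod Y r A p v"] cr_rules)
    next
      case False
      then have "0 \<le> q + int a \<longleftrightarrow> 0 \<le> q" "zshift a F q = F (q + int a)"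
        "zshift n (zshift a F) q = zshift n F (q + int a)" "Om_shift n (zshift a F) q = Om_shift n F (q + int a)" for n and F :: "int \<Rightarrow> 'v"
        unfolding s o by (auto simp: zshift_def)
      with elim show ?thesis by simp
    qed
  qed
qed

lemma sum_list_swap: "(\<Sum>n<N. \<Sum>d\<leftarrow>D. f n d) = (\<Sum>d\<leftarrow>D. \<Sum>n<(N::nat). f n d :: 'b::comm_monoid_add)"
  by (induction D) (simp_all add: sum.distrib)

lemma sum_list_sgn_if: "sgn_if b (\<Sum>d\<leftarrow>D. f d) = (\<Sum>d\<leftarrow>D. sgn_if b (f d))"
  by (induction D) (simp_all add: sgn_if_add)

lemma lin_sum_list: "lin_op T \<Longrightarrow> T (\<Sum>d\<leftarrow>D. f d) = (\<Sum>d\<leftarrow>D. T (f d))"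
  by (induction D) (simp_all add: linear_rules)

text \<open>\<open>[X(z), B(w)]\<close> is the sum of \<open>c Omega_(z-w)^k C(w)\<close> over the list D, for a field B of parity s. The
  first equation compares the coefficients of \<open>Omega_z^m\<close> in the expansion at \<open>w = 0\<close>, the second one
  those of \<open>z^n\<close> in the expansion at \<open>z = 0\<close>. The signs with \<open>0 \<le> q\<close> come from moving \<open>Omega_w^q\<close> to
  the left.\<close>

definition commutes :: "'l \<Rightarrow> bool \<Rightarrow> 'v modes \<Rightarrow> (complex \<times> nat \<times> 'v modes) list \<Rightarrow> bool" where
  "commutes X s B D \<longleftrightarrow>
    (\<forall>m q v. an X m (B q v) = sgn_if (\<not> odd_l X \<and> s \<noteq> (0 \<le> q)) (B q (an X m v)) +
       sgn_if (\<not> odd_l X \<and> 0 \<le> q) (\<Sum>(c, k, C)\<leftarrow>D. scale (c * of_nat (m choose k)) (zshift_at (m - k) C q v))) \<and>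
    (\<forall>n q v. cr X n (B q v) = sgn_if (odd_l X \<and> s \<noteq> (0 \<le> q)) (B q (cr X n v)) -
       sgn_if (odd_l X \<and> 0 \<le> q) (\<Sum>(c, k, C)\<leftarrow>D. scale (c * (- 1) ^ k * of_nat ((k + n) choose k)) (Om_shift_at (k + n) C q v)))"

lemma commutes_id_field: "commutes X False id_field []"
  by (simp add: commutes_def id_field_def an_rules cr_rules)

text \<open>The Leibniz rule for the commutator with X: contracting X with Y leaves B, and contracting X
  with B leaves Y in its place. Multiplications by powers of w and by \<open>Omega_w\<close> commute with the
  normally ordered product, so the two equations can be proved mode by mode.\<close>

lemma commutes_nprod:
  assumes B: "is_field B" and D: "\<And>c k C. (c, k, C) \<in> set D \<Longrightarrow> is_field C" and AB: "commutes X s B D"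
  shows "commutes X (odd_l Y \<noteq> s) (nprod Y s B)
    ((if odd_l X \<noteq> odd_l Y then [(ccoef X Y, cord X Y, B)] else []) @
     map (\<lambda>(c, k, C). (if \<not> odd_l X \<and> odd_l Y then - c else c, k, nprod Y (s = odd_l X) C)) D)"
proof -
  let ?E = "(if odd_l X \<noteq> odd_l Y then [(ccoef X Y, cord X Y, B)] else []) @
     map (\<lambda>(c, k, C). (if \<not> odd_l X \<and> odd_l Y then - c else c, k, nprod Y (s = odd_l X) C)) D"
  have "an X m (nprod Y s B q v) = sgn_if (\<not> odd_l X \<and> (odd_l Y \<noteq> s) \<noteq> (0 \<le> q)) (nprod Y s B q (an X m v)) +
       sgn_if (\<not> odd_l X \<and> 0 \<le> q) (\<Sum>(c, k, C)\<leftarrow>?E. scale (c * of_nat (m choose k)) (zshift_at (m - k) C q v))" for m q v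
  proof (rule eventually_const)
    let ?f = "\<lambda>c k. scale (c * of_nat (m choose k))"
    have C: "\<forall>\<^sub>F N in sequentially. \<forall>(c, k, C) \<in> set D. nprod Y (s = odd_l X) (\<lambda>p v. zshift_at (m - k) C p v) q v =
       sgn_if (odd_l Y \<and> 0 \<le> q) (\<Sum>n<N. cr Y n (zshift n (\<lambda>p. zshift_at (m - k) C p v) q))
      + sgn_if ((s = odd_l X) \<and> \<not> odd_l Y) (\<Sum>j<N. Om_shift j (\<lambda>p. zshift_at (m - k) C p (an Y j v)) q)"
      by (rule eventually_ball_finite) (auto intro!: nprod_eventually is_field_zshift dest: D)
    have S: "an X m (zshift_at n B q v) = sgn_if (\<not> odd_l X \<and> s \<noteq> (0 \<le> q)) (zshift_at n B q (an X m v)) +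
        sgn_if (\<not> odd_l X \<and> 0 \<le> q) (\<Sum>(c, k, C)\<leftarrow>D. ?f c k (zshift n (\<lambda>p. zshift_at (m - k) C p v) q))" for n
    proof (cases "q < 0 \<and> 0 \<le> q + int n")
      case True
      then show ?thesis by (simp add: zshift_def an_rules case_prod_unfold)
    next
      case False
      then have "0 \<le> q + int n \<longleftrightarrow> 0 \<le> q" "zshift n F q = F (q + int n)" for F :: "int \<Rightarrow> 'v"
        by (auto simp: zshift_def)
      then show ?thesis
        using AB[unfolded commutes_def, THEN conjunct1, rule_format, of m "q + int n" v] by simp
    qed
    have O: "an X m (Om_shift_at j B q u) = sgn_if (\<not> odd_l X \<and> s) (Om_shift_at j B q (an X m u)) +
        (\<Sum>(c, k, C)\<leftarrow>D. ?f c k (Om_shift j (\<lambda>p. zshift_at (m - k) C p u) q))" for j u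
    proof (cases "0 \<le> q \<and> q \<le> int j")
      case True
      then show ?thesis
        using AB[unfolded commutes_def, THEN conjunct1, rule_format, of m "q - int j - 1" u]
        by (simp add: Om_shift_def[of j])
    next
      case False
      then show ?thesis by (auto simp: Om_shift_def an_rules case_prod_unfold)
    qed
    have T: "(\<Sum>n<N. if m = cord X Y + n then ?f (ccoef X Y) (cord X Y) (zshift_at n B q v) else 0)
      = ?f (ccoef X Y) (cord X Y) (zshift_at (m - cord X Y) B q v)" if "N > m" for N
    proof (cases "cord X Y \<le> m")
      case True
      then have "m = cord X Y + n \<longleftrightarrow> n = m - cord X Y" for n by auto
      moreover have "m - cord X Y < N" using that by simp
      ultimately show ?thesis by (simp add: sum.delta)
    next
      case False
      then show ?thesis by (auto intro!: sum.neutral simp: binomial_eq_0)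
    qed
    show "\<forall>\<^sub>F N in sequentially. an X m (nprod Y s B q v) = sgn_if (\<not> odd_l X \<and> (odd_l Y \<noteq> s) \<noteq> (0 \<le> q)) (nprod Y s B q (an X m v)) +
       sgn_if (\<not> odd_l X \<and> 0 \<le> q) (\<Sum>(c, k, C)\<leftarrow>?E. scale (c * of_nat (m choose k)) (zshift_at (m - k) C q v))"
      using nprod_eventually[OF B, of Y s q v] nprod_eventually[OF B, of Y s q "an X m v"] C eventually_gt_at_top[of m]
    proof eventually_elim
      case (elim N)
      have E: "(\<Sum>(c, k, C)\<leftarrow>?E. ?f c k (zshift_at (m - k) C q v)) =
         (if odd_l X \<noteq> odd_l Y then ?f (ccoef X Y) (cord X Y) (zshift_at (m - cord X Y) B q v) else 0) +
         (\<Sum>(c, k, C)\<leftarrow>D. sgn_if (\<not> odd_l X \<and> odd_l Y) (?f c k (zshift_at (m - k) (nprod Y (s = odd_l X) C) q v)))"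
        by (simp add: case_prod_unfold comp_def) (auto intro!: arg_cong[where f = sum_list])
      have D': "(\<Sum>(c, k, C)\<leftarrow>D. sgn_if (\<not> odd_l X \<and> odd_l Y) (?f c k (zshift_at (m - k) (nprod Y (s = odd_l X) C) q v)))
         = (\<Sum>(c, k, C)\<leftarrow>D. sgn_if (\<not> odd_l X \<and> odd_l Y) (?f c k (
             sgn_if (odd_l Y \<and> 0 \<le> q) (\<Sum>n<N. cr Y n (zshift n (\<lambda>p. zshift_at (m - k) C p v) q))
            + sgn_if ((s = odd_l X) \<and> \<not> odd_l Y) (\<Sum>j<N. Om_shift j (\<lambda>p. zshift_at (m - k) C p (an Y j v)) q))))"
        using elim(3) by (intro arg_cong[where f = sum_list] map_cong refl) (auto simp: nprod_zshift[symmetric] D)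
      have 1: "(\<Sum>n<N. an X m (cr Y n (zshift_at n B q v))) =
        (\<Sum>n<N. sgn_if (\<not> odd_l X \<and> odd_l Y) (sgn_if (\<not> odd_l X \<and> s \<noteq> (0 \<le> q)) (cr Y n (zshift_at n B q (an X m v))))) +
        (\<Sum>(c, k, C)\<leftarrow>D. sgn_if (\<not> odd_l X \<and> odd_l Y) (sgn_if (\<not> odd_l X \<and> 0 \<le> q) (?f c k (\<Sum>n<N. cr Y n (zshift n (\<lambda>p. zshift_at (m - k) C p v) q))))) +
        (if odd_l X \<noteq> odd_l Y then ?f (ccoef X Y) (cord X Y) (zshift_at (m - cord X Y) B q v) else 0)"
        by (simp add: an_cr S sum.distrib T[OF elim(4)] cr_rules sgn_if_add lin_sum_list[OF cr_linear] case_prod_unfold sum_list_sgn_if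
           sum_list_swap scale_sum_right sgn_if_sum)
      have 2: "(\<Sum>j<N. an X m (Om_shift_at j B q (an Y j v))) =
        (\<Sum>j<N. sgn_if (\<not> odd_l X \<and> s) (sgn_if (\<not> odd_l X \<and> \<not> odd_l Y) (Om_shift_at j B q (an Y j (an X m v))))) +
        (\<Sum>(c, k, C)\<leftarrow>D. ?f c k (\<Sum>j<N. Om_shift j (\<lambda>p. zshift_at (m - k) C p (an Y j v)) q))"
        by (simp add: O sum.distrib case_prod_unfold sum_list_swap scale_sum_right)
           (simp add: an_an[of X m Y] at_simps[OF B])
      have 3: "q < 0 \<Longrightarrow> Om_shift j F q = 0" for j and F :: "int \<Rightarrow> 'v" by (simp add: Om_shift_def)
      show ?case
        unfolding E D' elim(1,2)
        by (cases "0 \<le> q"; cases "odd_l X"; cases "odd_l Y"; cases s)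
          (simp_all add: an_rules 1 2 3 sum.distrib case_prod_unfold sum_negf sum_list_addf uminus_sum_list_map scale_right_distrib
            scale_right_diff_distrib comp_def sum_list_subtractf)
    qed
  qed
  moreover have "cr X m (nprod Y s B q v) = sgn_if (odd_l X \<and> (odd_l Y \<noteq> s) \<noteq> (0 \<le> q)) (nprod Y s B q (cr X m v)) -
       sgn_if (odd_l X \<and> 0 \<le> q) (\<Sum>(c, k, C)\<leftarrow>?E. scale (c * (- 1) ^ k * of_nat ((k + m) choose k)) (Om_shift_at (k + m) C q v))" for m q v
  proof (rule eventually_const)
    let ?f = "\<lambda>c k. scale (c * (- 1) ^ k * of_nat ((k + m) choose k))"
    have 3: "q < 0 \<Longrightarrow> Om_shift j F q = 0" for j q and F :: "int \<Rightarrow> 'v" by (simp add: Om_shift_def)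
    have "\<forall>\<^sub>F N in sequentially. q \<le> int (k + m) \<longrightarrow> nprod Y (s = odd_l X) C (q - int (k + m) - 1) v =
       (\<Sum>n<N. cr Y n (zshift_at n C (q - int (k + m) - 1) v))" if "(c, k, C) \<in> set D" for c k C
      using nprod_eventually[OF D[OF that], of Y "s = odd_l X" "q - int (k + m) - 1" v] by eventually_elim (simp add: 3)
    then have C: "\<forall>\<^sub>F N in sequentially. \<forall>(c, k, C) \<in> set D. q \<le> int (k + m) \<longrightarrow> nprod Y (s = odd_l X) C (q - int (k + m) - 1) v =
       (\<Sum>n<N. cr Y n (zshift_at n C (q - int (k + m) - 1) v))"
      by (intro eventually_ball_finite) auto
    have S: "cr X m (zshift_at n B q v) = sgn_if (odd_l X \<and> s \<noteq> (0 \<le> q)) (zshift_at n B q (cr X m v)) -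
        sgn_if (odd_l X \<and> 0 \<le> q) (\<Sum>(c, k, C)\<leftarrow>D. ?f c k (zshift n (\<lambda>p. Om_shift_at (k + m) C p v) q))" for n
    proof (cases "q < 0 \<and> 0 \<le> q + int n")
      case True
      then show ?thesis by (simp add: zshift_def cr_rules case_prod_unfold)
    next
      case False
      then have "0 \<le> q + int n \<longleftrightarrow> 0 \<le> q" "zshift n F q = F (q + int n)" for F :: "int \<Rightarrow> 'v"
        by (auto simp: zshift_def)
      then show ?thesis
        using AB[unfolded commutes_def, THEN conjunct2, rule_format, of m "q + int n" v] by simp
    qed
    have O: "cr X m (Om_shift_at j B q u) = sgn_if (odd_l X \<and> s) (Om_shift_at j B q (cr X m u))" for j u
    proof (cases "0 \<le> q \<and> q \<le> int j")
      case True
      then show ?thesis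
        using AB[unfolded commutes_def, THEN conjunct2, rule_format, of m "q - int j - 1" u]
        by (simp add: Om_shift_def[of j] 3 case_prod_unfold)
    next
      case False
      then show ?thesis by (auto simp: Om_shift_def cr_rules)
    qed
    have T: "(\<Sum>j<N. Om_shift_at j B q (if odd_l X \<noteq> odd_l Y \<and> j = cord X Y + m then u else 0))
      = (if odd_l X \<noteq> odd_l Y then Om_shift_at (cord X Y + m) B q u else 0)" if "N > cord X Y + m" for N u
    proof -
      have "Om_shift_at j B q (if odd_l X \<noteq> odd_l Y \<and> j = cord X Y + m then u else 0)
        = (if j = cord X Y + m then if odd_l X \<noteq> odd_l Y then Om_shift_at j B q u else 0 else 0)" for j
        by (simp add: at_simps[OF B])
      then show ?thesis using that by (simp add: sum.delta)
    qed
    show "\<forall>\<^sub>F N in sequentially. cr X m (nprod Y s B q v) = sgn_if (odd_l X \<and> (odd_l Y \<noteq> s) \<noteq> (0 \<le> q)) (nprod Y s B q (cr X m v)) -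
       sgn_if (odd_l X \<and> 0 \<le> q) (\<Sum>(c, k, C)\<leftarrow>?E. ?f c k (Om_shift_at (k + m) C q v))"
      using nprod_eventually[OF B, of Y s q v] nprod_eventually[OF B, of Y s q "cr X m v"] C eventually_gt_at_top[of "cord X Y + m"]
    proof eventually_elim
      case (elim N)
      have 4: "q < 0 \<Longrightarrow> zshift n (Om_shift j F) q = 0" for n j and F :: "int \<Rightarrow> 'v" by (simp add: zshift_Om_shift 3)
      have E: "(\<Sum>(c, k, C)\<leftarrow>?E. ?f c k (Om_shift_at (k + m) C q v)) =
         (if odd_l X \<noteq> odd_l Y then ?f (ccoef X Y) (cord X Y) (Om_shift_at (cord X Y + m) B q v) else 0) +
         (\<Sum>(c, k, C)\<leftarrow>D. sgn_if (\<not> odd_l X \<and> odd_l Y) (?f c k (Om_shift_at (k + m) (nprod Y (s = odd_l X) C) q v)))"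
        by (simp add: case_prod_unfold comp_def) (auto intro!: arg_cong[where f = sum_list])
      have N: "Om_shift_at (k + m) (nprod Y (s = odd_l X) C) q v = (\<Sum>n<N. cr Y n (zshift n (\<lambda>p. Om_shift_at (k + m) C p v) q))"
        if "(c, k, C) \<in> set D" for c k C
      proof -
        have e: "zshift n F (q - int (k + m) - 1) = zshift n (Om_shift (k + m) F) q" if "0 \<le> q \<and> q \<le> int (k + m)" for n and F :: "int \<Rightarrow> 'v"
          using that by (auto simp: zshift_def Om_shift_def algebra_simps)
        have "zshift n (Om_shift (k + m) F) q = 0" if "\<not> (0 \<le> q \<and> q \<le> int (k + m))" for n and F :: "int \<Rightarrow> 'v"
          using that by (auto simp: zshift_def Om_shift_def)
        moreover have "nprod Y (s = odd_l X) C (q - int (k + m) - 1) v = (\<Sum>n<N. cr Y n (zshift_at n C (q - int (k + m) - 1) v))" if "q \<le> int (k + m)"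
          using elim(3) \<open>(c, k, C) \<in> set D\<close> that by force
        ultimately show ?thesis
          by (cases "0 \<le> q \<and> q \<le> int (k + m)") (auto simp add: e Om_shift_def[of "k + m" "\<lambda>p. nprod Y (s = odd_l X) C p v"] cr_rules simp del: of_nat_add)
      qed
      have D': "(\<Sum>(c, k, C)\<leftarrow>D. sgn_if (\<not> odd_l X \<and> odd_l Y) (?f c k (Om_shift_at (k + m) (nprod Y (s = odd_l X) C) q v)))
         = (\<Sum>(c, k, C)\<leftarrow>D. sgn_if (\<not> odd_l X \<and> odd_l Y) (?f c k (\<Sum>n<N. cr Y n (zshift n (\<lambda>p. Om_shift_at (k + m) C p v) q))))"
        by (intro arg_cong[where f = sum_list] map_cong refl) (auto simp: N)
      have 1: "(\<Sum>n<N. cr X m (cr Y n (zshift_at n B q v))) =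
        (\<Sum>n<N. sgn_if (odd_l X \<and> odd_l Y) (sgn_if (odd_l X \<and> s \<noteq> (0 \<le> q)) (cr Y n (zshift_at n B q (cr X m v))))) -
        (\<Sum>(c, k, C)\<leftarrow>D. sgn_if (odd_l X \<and> odd_l Y) (sgn_if (odd_l X \<and> 0 \<le> q) (?f c k (\<Sum>n<N. cr Y n (zshift n (\<lambda>p. Om_shift_at (k + m) C p v) q)))))"
        by (simp add: cr_cr[of X m Y] S sum_subtractf cr_rules lin_sum_list[OF cr_linear] case_prod_unfold
           sum_list_swap scale_sum_right sum_list_sgn_if sgn_if_sum sgn_if_diff)
      have 2: "(\<Sum>j<N. cr X m (Om_shift_at j B q (an Y j v))) =
        (\<Sum>j<N. sgn_if (odd_l X \<and> s) (sgn_if (odd_l X \<and> \<not> odd_l Y) (Om_shift_at j B q (an Y j (cr X m v))))) - sgn_if (odd_l X \<and> s) (sgn_if (odd_l X)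
        (if odd_l X \<noteq> odd_l Y then ?f (ccoef X Y) (cord X Y) (Om_shift_at (cord X Y + m) B q v) else 0))"
      proof -
        have "Om_shift_at j B q (cr X m (an Y j v)) = sgn_if (odd_l X \<and> \<not> odd_l Y) (Om_shift_at j B q (an Y j (cr X m v)))
          - sgn_if (odd_l X) (Om_shift_at j B q (if odd_l X \<noteq> odd_l Y \<and> j = cord X Y + m then ?f (ccoef X Y) (cord X Y) v else 0))" for j
          using cr_an[of X m Y j v]
          by (cases "odd_l X \<noteq> odd_l Y \<and> j = cord X Y + m") (simp_all add: at_simps[OF B], auto simp: at_simps[OF B])
        then have "(\<Sum>j<N. cr X m (Om_shift_at j B q (an Y j v))) =
           (\<Sum>j<N. sgn_if (odd_l X \<and> s) (sgn_if (odd_l X \<and> \<not> odd_l Y) (Om_shift_at j B q (an Y j (cr X m v))))) -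
           sgn_if (odd_l X \<and> s) (sgn_if (odd_l X) (\<Sum>j<N. Om_shift_at j B q (if odd_l X \<noteq> odd_l Y \<and> j = cord X Y + m then ?f (ccoef X Y) (cord X Y) v else 0)))"
          unfolding sgn_if_sum by (simp only: O sum_subtractf sgn_if_diff)
        then show ?thesis
          unfolding T[OF elim(4), of "?f (ccoef X Y) (cord X Y) v"] by (simp add: at_simps[OF B] cong: if_cong)
      qed
      show ?case
        unfolding E D' elim(1,2)
        by (cases "0 \<le> q"; cases "odd_l X"; cases "odd_l Y"; cases s)
          (simp_all add: cr_rules 1 2 3 4 sum.distrib case_prod_unfold sum_negf sum_list_addf uminus_sum_list_map scale_right_distrib
            scale_right_diff_distrib comp_def sum_list_subtractf)
    qed
  qed
  ultimately show ?thesis by (simp add: commutes_def)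
qed

text \<open>All ways to contract X with one letter of a word. The sign is that of moving the odd pairing
  past the letters in front.\<close>

fun contractions :: "'l \<Rightarrow> 'l list \<Rightarrow> (complex \<times> nat \<times> 'l list) list" where
  "contractions X [] = []"
| "contractions X (Y # w) = (if odd_l X \<noteq> odd_l Y then [(ccoef X Y, cord X Y, w)] else []) @
     map (\<lambda>(c, k, u). (if \<not> odd_l X \<and> odd_l Y then - c else c, k, Y # u)) (contractions X w)"

lemma w_odd_contractions: "(c, k, u) \<in> set (contractions X w) \<Longrightarrow> w_odd u = (w_odd w = odd_l X)"
  by (induction w arbitrary: c u) (auto split: if_splits)

lemma commutes_wfield: "commutes X (w_odd w) (wfield w) (map (\<lambda>(c, k, u). (c, k, wfield u)) (contractions X w))"
proof (induction w)
  case Nil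
  then show ?case by (simp add: commutes_id_field)
next
  case (Cons Y w)
  have m: "map (\<lambda>(c, k, C). (if \<not> odd_l X \<and> odd_l Y then - c else c, k, nprod Y (w_odd w = odd_l X) C)) (map (\<lambda>(c, k, u). (c, k, wfield u)) (contractions X w))
    = map (\<lambda>(c, k, u). (c, k, wfield u)) (map (\<lambda>(c, k, u). (if \<not> odd_l X \<and> odd_l Y then - c else c, k, Y # u)) (contractions X w))"
    by (auto simp: w_odd_contractions)
  have "commutes X (odd_l Y \<noteq> w_odd w) (nprod Y (w_odd w) (wfield w))
    ((if odd_l X \<noteq> odd_l Y then [(ccoef X Y, cord X Y, wfield w)] else []) @
     map (\<lambda>(c, k, C). (if \<not> odd_l X \<and> odd_l Y then - c else c, k, nprod Y (w_odd w = odd_l X) C)) (map (\<lambda>(c, k, u). (c, k, wfield u)) (contractions X w)))"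
    by (rule commutes_nprod[OF is_field_wfield _ Cons]) (auto simp: is_field_wfield)
  then show ?case
    unfolding m by (simp split: if_splits)
qed

lemma an_wfield: "an X m (wfield w q v) = sgn_if (\<not> odd_l X \<and> w_odd w \<noteq> (0 \<le> q)) (wfield w q (an X m v)) +
    sgn_if (\<not> odd_l X \<and> 0 \<le> q) (\<Sum>(c, k, u)\<leftarrow>contractions X w. scale (c * of_nat (m choose k)) (zshift_at (m - k) (wfield u) q v))"
  using commutes_wfield[of X w] by (simp add: commutes_def case_prod_unfold comp_def)

lemma cr_wfield: "cr X n (wfield w q v) = sgn_if (odd_l X \<and> w_odd w \<noteq> (0 \<le> q)) (wfield w q (cr X n v)) -
    sgn_if (odd_l X \<and> 0 \<le> q) (\<Sum>(c, k, u)\<leftarrow>contractions X w.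
      scale (c * (- 1) ^ k * of_nat ((k + n) choose k)) (Om_shift_at (k + n) (wfield u) q v))"
  using commutes_wfield[of X w] by (simp add: commutes_def case_prod_unfold comp_def)

primrec word_vec :: "'v \<Rightarrow> 'l list \<Rightarrow> 'v" where
  "word_vec vac [] = vac" | "word_vec vac (X # w) = cr X 0 (word_vec vac w)"

text \<open>On the vacuum the annihilation modes vanish, and of each \<open>X_+(z)\<close> only the constant term
  contributes to the constant term.\<close>

lemma word_field_vacuum:
  assumes "\<And>l m. an l m vac = 0"
  shows "wfield w (- 1) vac = word_vec vac w" "0 \<le> p \<Longrightarrow> wfield w p vac = 0"
proof -
  have "wfield w (- 1) vac = word_vec vac w \<and> (\<forall>p\<ge>0. wfield w p vac = 0)"
  proof (induction w)
    case (Cons X w)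
    have 1: "zshift_at n (wfield w) (- 1) vac = (if n = 0 then word_vec vac w else 0)" for n
      using Cons by (auto simp: zshift_def)
    have 2: "zshift_at n (wfield w) p vac = 0" if "0 \<le> p" for p n
      using Cons that by (auto simp: zshift_def)
    have "\<forall>\<^sub>F N in sequentially. nprod X (w_odd w) (wfield w) (- 1) vac = cr X 0 (word_vec vac w)"
      using nprod_eventually[OF is_field_wfield[of w], of X "w_odd w" "-1" vac] eventually_gt_at_top[of 0]
      by eventually_elim (simp add: 1 if_distrib cr_rules assms at_simps[OF is_field_wfield] sum.delta cong: if_cong)
    moreover have "nprod X (w_odd w) (wfield w) p vac = 0" if "0 \<le> p" for p
      by (rule eventually_const)
        (use nprod_eventually[OF is_field_wfield[of w], of X "w_odd w" p vac] in
         \<open>eventually_elim, simp add: 2[OF that] cr_rules assms at_simps[OF is_field_wfield]\<close>)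
    ultimately show ?case by simp
  qed (simp_all add: id_field_def)
  then show "wfield w (- 1) vac = word_vec vac w" "0 \<le> p \<Longrightarrow> wfield w p vac = 0" by simp_all
qed

text \<open>The product rule for the derivative. The derivative of a field has no coefficient of
  \<open>Omega^0\<close>, and there the terms telescope; at every other index the coefficients add up.\<close>

lemma nprod_translation:
  assumes T: "lin_op T"
    and cr: "\<And>X n v. T (cr X n v) = cr X n (T v) + scale (of_nat (n + 1)) (cr X (n + 1) v)"
    and an: "\<And>X m v. T (an X m v) = an X m (T v) - scale (of_nat m) (an X (m - 1) v)"
    and B: "is_field B" and B': "\<And>p v. T (B p v) = B p (T v) + scale (- of_int p) (B (p - 1) v)"
  shows "T (nprod X r B p v) = nprod X r B p (T v) + scale (- of_int p) (nprod X r B (p - 1) v)"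
proof (rule eventually_const)
  note tl = linear_rules[OF T]
  obtain M where M: "vanishes_from (\<lambda>p. B p v) M" "\<forall>m\<ge>M. an X m v = 0"
    by (rule field_bounds[OF B, of v p X]) blast
  define b where "b n = zshift_at n B (p - 1) v" for n
  define e where "e m = Om_shift_at m B (p - 1) (an X m v)" for m
  show "\<forall>\<^sub>F N in sequentially. T (nprod X r B p v) = nprod X r B p (T v) + scale (- of_int p) (nprod X r B (p - 1) v)"
    using nprod_eventually[OF B, of X r p v] nprod_eventually[OF B, of X r p "T v"] nprod_eventually[OF B, of X r "p - 1" v]
      eventually_gt_at_top[of M] eventually_gt_at_top[of "nat (- p)"]
  proof eventually_elim
    case (elim N)
    have 1: "(\<Sum>n<N. T (cr X n (zshift_at n B p v))) = (\<Sum>n<N. cr X n (zshift_at n B p (T v))) +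
      (if p = 0 then 0 else scale (- of_int p) (\<Sum>n<N. cr X n (b n)))"
    proof (cases "p = 0")
      case True
      have "T (cr X n (zshift_at n B p v)) = cr X n (zshift_at n B p (T v)) +
        (scale (of_nat (Suc n)) (cr X (Suc n) (B (int (Suc n) - 1) v)) - scale (of_nat n) (cr X n (B (int n - 1) v)))" for n
        by (simp add: True cr zshift_def B' cr_rules scale_minus_left)
      moreover have "cr X N (B (int N - 1) v) = 0" using elim M by (simp add: vanishes_from_def cr_rules)
      moreover have "(\<Sum>n<N. scale (of_nat (Suc n)) (cr X (Suc n) (B (int (Suc n) - 1) v)) - scale (of_nat n) (cr X n (B (int n - 1) v)))
        = scale (of_nat N) (cr X N (B (int N - 1) v))"
        by (subst sum_lessThan_telescope) simp
      ultimately show ?thesis using True by (simp add: sum.distrib)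
    next
      case False
      have "T (cr X n (zshift_at n B p v)) = cr X n (zshift_at n B p (T v)) +
        ((scale (of_nat (Suc n)) (cr X (Suc n) (b (Suc n))) - scale (of_nat n) (cr X n (b n))) - scale (of_int p) (cr X n (b n)))" for n
      proof -
        have "zshift_at n B p v = b (Suc n)" using False by (auto simp: b_def zshift_def)
        moreover have "T (zshift_at n B p v) = zshift_at n B p (T v) - scale (of_int p + of_nat n) (b n)"
        proof (cases "p < 0 \<and> 0 \<le> p + int n")
          case True
          then have "p + int n = 0 \<or> b n = 0" by (auto simp: b_def zshift_def)
          then have "of_int p + of_nat n = (0::complex) \<or> b n = 0" by (metis of_int_0 of_int_add of_int_of_nat_eq)
          with True show ?thesis by (auto simp: zshift_def tl)
        next
          case F: False
          have "b n = B (p + int n - 1) v" using F False by (auto simp: b_def zshift_def algebra_simps)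
          moreover have "zshift_at n B p u = B (p + int n) u" for u using F by (auto simp add: zshift_def)
          ultimately show ?thesis by (simp add: B') (metis add.commute minus_add_distrib scale_minus_left uminus_add_conv_diff)
        qed
        ultimately show ?thesis by (simp add: cr cr_rules scale_left_distrib)
      qed
      moreover have "cr X N (b N) = 0" using elim M by (auto simp add: b_def zshift_def vanishes_from_def cr_rules)
      moreover have "(\<Sum>n<N. scale (of_nat (Suc n)) (cr X (Suc n) (b (Suc n))) - scale (of_nat n) (cr X n (b n)))
        = scale (of_nat N) (cr X N (b N))"
        by (subst sum_lessThan_telescope) simp
      ultimately show ?thesis using False by (simp add: sum.distrib sum_subtractf scale_sum_right scale_minus_left sum_negf)
    qed
    have 2: "(\<Sum>m<N. T (Om_shift_at m B p (an X m v))) = (\<Sum>m<N. Om_shift_at m B p (an X m (T v))) +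
      (if p = 0 then 0 else scale (- of_int p) (\<Sum>m<N. e m))"
    proof -
      \<comment> \<open>h is \<open>Omega_z^(m+1)\<close> times B at p, written so that the derivatives of \<open>Omega_z^m\<close> and of the modes
        of X telescope.\<close>
      define h where "h m = (if 0 \<le> p \<and> p \<le> int m + 1 then B (p - int m - 2) (an X m v) else 0)" for m
      have "T (Om_shift_at m B p (an X m v)) = Om_shift_at m B p (an X m (T v)) +
        ((scale (of_nat (Suc m)) (h (Suc m - 1)) - scale (of_nat m) (h (m - 1))) - scale (of_int p) (h m))" for m
      proof -
        have "T (Om_shift_at m B p u) = Om_shift_at m B p (T u) + scale (of_nat (Suc m) - of_int p) (if 0 \<le> p \<and> p \<le> int m then B (p - int m - 2) u else 0)" for u
          by (simp add: Om_shift_def B' tl)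
        moreover have "scale (of_nat (Suc m) - of_int p) (if 0 \<le> p \<and> p \<le> int m then B (p - int m - 2) (an X m v) else 0)
          = scale (of_nat (Suc m) - of_int p) (h m)"
          by (cases "p = int (Suc m)") (simp_all add: h_def)
        moreover have "scale (of_nat m) (Om_shift_at m B p (an X (m - 1) v)) = scale (of_nat m) (h (m - 1))"
          by (cases m) (auto simp: h_def Om_shift_def algebra_simps intro!: arg_cong2[where f = B])
        ultimately show ?thesis
          by (simp add: an at_simps[OF B] scale_left_diff_distrib)
      qed
      moreover have "(\<Sum>m<N. scale (of_nat (Suc m)) (h (Suc m - 1)) - scale (of_nat m) (h (m - 1))) = 0"
        by (subst sum_lessThan_telescope) (use elim M in \<open>auto simp: h_def linear_rules[OF is_field_linear[OF B]]\<close>)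
      moreover have "(\<Sum>m<N. scale (of_int p) (h m)) = (if p = 0 then 0 else scale (of_int p) (\<Sum>m<N. e m))"
        by (auto simp: scale_sum_right h_def e_def Om_shift_def algebra_simps intro!: sum.cong)
      ultimately show ?thesis
        by (simp only: sum.distrib sum_subtractf) (simp add: scale_minus_left)
    qed
    show ?case
    proof (cases "p = 0")
      case True
      then show ?thesis using 1 2 elim(1,2) by (simp add: tl)
    next
      case False
      then have "0 \<le> p \<longleftrightarrow> 0 \<le> p - 1" by auto
      with False show ?thesis
        by (simp add: elim(1-3) tl 1 2 b_def e_def sgn_if_add sgn_if_diff scale_right_distrib scale_sgn_if scale_minus_left)
          (simp add: sgn_if_def)
    qed
  qed
qed

lemma wfield_translation:
  assumes T: "lin_op T"
    and cr: "\<And>X n v. T (cr X n v) = cr X n (T v) + scale (of_nat (n + 1)) (cr X (n + 1) v)"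
    and an: "\<And>X m v. T (an X m v) = an X m (T v) - scale (of_nat m) (an X (m - 1) v)"
  shows "T (wfield w p v) = wfield w p (T v) + scale (- of_int p) (wfield w (p - 1) v)"
proof (induction w arbitrary: p v)
  case Nil
  then show ?case by (simp add: id_field_def linear_rules[OF T])
next
  case (Cons X w)
  show ?case unfolding wfield.simps by (rule nprod_translation[OF T cr an is_field_wfield Cons])
qed

lemma sgn_if_subspace: "subspace S \<Longrightarrow> v \<in> S \<Longrightarrow> sgn_if b v \<in> S"
  by (simp add: sgn_if_def subspace_neg)

text \<open>Weights of the modes of normally ordered products, for degree and spin at once: \<open>\<mu> p\<close> is the
  difference between the weight of the mode of index p and that of the field. The conditions on \<open>\<mu>\<close>
  express that it is additive where a product \<open>z^n z^i\<close>, \<open>z^n Omega^i\<close> or \<open>Omega^m z^i\<close> contributes.\<close>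

lemma word_field_weight:
  fixes S :: "int \<Rightarrow> 'v set" and wt :: "'l \<Rightarrow> int"
  assumes S: "\<And>t. subspace (S t)"
    and cr: "\<And>X n t v. v \<in> S t \<Longrightarrow> cr X n v \<in> S (t + wt X + \<mu> (- 1 - int n))"
    and an: "\<And>X m t v. v \<in> S t \<Longrightarrow> an X m v \<in> S (t + wt X + \<mu> (int m))"
    and \<mu>: "\<mu> (- 1) = 0"
      "\<And>n p. \<not> (p < 0 \<and> 0 \<le> p + int n) \<Longrightarrow> \<mu> (- 1 - int n) + \<mu> (p + int n) = \<mu> p"
      "\<And>m p. 0 \<le> p \<Longrightarrow> p \<le> int m \<Longrightarrow> \<mu> (p - int m - 1) + \<mu> (int m) = \<mu> p"
    and v: "v \<in> S t"
  shows "wfield w p v \<in> S (t + sum_list (map wt w) + \<mu> p)"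
  using v
proof (induction w arbitrary: p t v)
  case Nil
  then show ?case by (auto simp: id_field_def \<mu> subspace_0[OF S])
next
  case (Cons X w)
  let ?t = "t + sum_list (map wt (X # w)) + \<mu> p"
  have 1: "cr X n (zshift_at n (wfield w) p v) \<in> S ?t" for n
  proof (cases "p < 0 \<and> 0 \<le> p + int n")
    case True
    then show ?thesis by (simp add: zshift_def cr_rules subspace_0[OF S])
  next
    case False
    then have "zshift_at n (wfield w) p v = wfield w (p + int n) v" by (auto simp: zshift_def)
    moreover have "cr X n (wfield w (p + int n) v) \<in> S (t + sum_list (map wt w) + \<mu> (p + int n) + wt X + \<mu> (- 1 - int n))"
      by (intro cr Cons)
    moreover have "t + sum_list (map wt w) + \<mu> (p + int n) + wt X + \<mu> (- 1 - int n) = ?t"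
      using \<mu>(2)[OF False] by simp
    ultimately show ?thesis by metis
  qed
  have 2: "Om_shift_at m (wfield w) p (an X m v) \<in> S ?t" for m
  proof (cases "0 \<le> p \<and> p \<le> int m")
    case True
    have "wfield w (p - int m - 1) (an X m v) \<in> S (t + wt X + \<mu> (int m) + sum_list (map wt w) + \<mu> (p - int m - 1))"
      by (intro an Cons)
    moreover have "t + wt X + \<mu> (int m) + sum_list (map wt w) + \<mu> (p - int m - 1) = ?t"
      using \<mu>(3)[of p m] True by simp
    ultimately show ?thesis using True unfolding Om_shift_def by metis
  next
    case False
    then show ?thesis by (auto simp: Om_shift_def subspace_0[OF S])
  qed
  have "\<forall>\<^sub>F N in sequentially. nprod X (w_odd w) (wfield w) p v \<in> S ?t"
    using nprod_eventually[OF is_field_wfield, of X "w_odd w" w p v]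
    by eventually_elim (auto intro!: subspace_add subspace_sum sgn_if_subspace S 1 2 simp del: sum_list.Cons list.map)
  then show ?case by simp
qed

end

section \<open>Coefficients of raviolo functions in two variables\<close>

lemma rav_nth_add: "rav_nth (x + y) m = rav_nth x m + rav_nth (y :: 'r::super_ring rav) m"
  by (simp add: rav_nth_def plus_rav_def lookup_add)

lemma rav_nth_zero [simp]: "rav_nth (0 :: 'r::super_ring rav) m = 0"
  by (simp add: rav_nth_def zero_rav_def)

lemma rav_nth_uminus: "rav_nth (- x) m = - rav_nth (x :: 'r::super_ring rav) m"
  by (simp add: rav_nth_def uminus_rav_def)

lemma rav_nth_sum: "rav_nth (sum f A) m = (\<Sum>i\<in>A. rav_nth (f i :: 'r::super_ring rav) m)"
  by (induction A rule: infinite_finite_induct) (simp_all add: rav_nth_add)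

lemma rav_nth_of_nat_mult: "rav_nth (of_nat n * x) m = of_nat n * rav_nth (x :: 'r::super_ring rav) m"
  by (induction n) (simp_all add: rav_nth_add distrib_right)

lemma rav_nth_vanishes: "\<exists>N. vanishes_from (rav_nth (x :: 'r::super_ring rav)) N"
proof -
  obtain N where "\<forall>n\<ge>N. Poly_Mapping.lookup (sing x) n = 0" using sing_bound by blast
  then have "vanishes_from (rav_nth x) N" by (auto simp: vanishes_from_def rav_nth_def)
  then show ?thesis ..
qed

lemma rav_nth_Om_mult: "rav_nth (rav_Om m * x) p = Om_shift m (rav_nth x) (p::int)"
  for x :: "'r::super_ring rav"
proof -
  have "Poly_Mapping.lookup (sing_rmult (Poly_Mapping.single m 1) f) n = (if n \<le> m then f $ (m - n) else 0)" for n and f :: "'r fps"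
  proof -
    have "{m'. Poly_Mapping.lookup (Poly_Mapping.single m (1::'r)) m' \<noteq> 0 \<and> n \<le> m'} = (if n \<le> m then {m} else {})"
      by (auto simp: lookup_single when_def split: if_splits)
    then show ?thesis by (simp add: sing_rmult.rep_eq)
  qed
  then show ?thesis
    by (auto simp: rav_nth_def times_rav_def rav_Om_def Om_shift_def fps_map_pari_zero nat_le_iff intro!: arg_cong[where f = "fps_nth (reg x)"])
qed

text \<open>The sums are stated with an arbitrary large bound so that they can be compared with the sums over
  modes. The involution appears at \<open>p \<ge> 0\<close> because the coefficient has to pass \<open>Omega^p\<close>.\<close>

lemma rav_nth_reg_mult:
  fixes x :: "'r::super_ring rav"
  assumes "vanishes_from (rav_nth x) N" "nat (- p) \<le> N"
  shows "rav_nth (Rav f 0 * x) p = (\<Sum>i<N. (if p < 0 then f $ i else pari (f $ i)) * zshift i (rav_nth x) p)"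
proof (cases "p < 0")
  case True
  define j where "j = nat (- p - 1)"
  have "rav_nth (Rav f 0 * x) p = (\<Sum>i\<le>j. f $ i * reg x $ (j - i))"
    using True by (simp add: rav_nth_def times_rav_def fps_mult_nth j_def atLeast0AtMost)
  also have "\<dots> = (\<Sum>i<N. f $ i * zshift i (rav_nth x) p)"
  proof (rule sum.mono_neutral_cong_left)
    show "{..j} \<subseteq> {..<N}" using assms True by (auto simp: j_def)
  next
    fix i assume "i \<in> {..j}"
    then have "p + int i < 0" "nat (- (p + int i) - 1) = j - i" using True by (auto simp: j_def)
    then show "f $ i * reg x $ (j - i) = f $ i * zshift i (rav_nth x) p"
      by (simp add: zshift_def rav_nth_def)
  next
    show "\<forall>i\<in>{..<N} - {..j}. f $ i * zshift i (rav_nth x) p = 0"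
      using True by (auto simp: zshift_def j_def)
  qed simp
  finally show ?thesis using True by simp
next
  case False
  have "\<And>m. m \<ge> N \<Longrightarrow> Poly_Mapping.lookup (sing x) m = 0"
    using assms by (metis (no_types, lifting) vanishes_from_def nat_int of_nat_le_iff of_nat_less_0_iff rav_nth_def)
  from lookup_sing_lmult[OF this] False show ?thesis
    by (simp add: rav_nth_def times_rav_def zshift_def nat_add_distrib)
qed

lemma rav_nth_const_mult: "rav_nth (rav_const r * x) p = (if p < 0 then r else pari r) * rav_nth x p"
  for x :: "'r::super_ring rav"
proof -
  obtain N where N: "vanishes_from (rav_nth x) N" using rav_nth_vanishes by blast
  have "rav_nth (rav_const r * x) p = (\<Sum>i<Suc (max N (nat (- p))). (if p < 0 then fps_const r $ i else pari (fps_const r $ i)) * zshift i (rav_nth x) p)"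
    unfolding rav_const_def by (rule rav_nth_reg_mult) (auto intro: vanishes_mono[OF N])
  also have "\<dots> = (\<Sum>i<Suc (max N (nat (- p))). if i = 0 then (if p < 0 then r else pari r) * rav_nth x p else 0)"
    by (rule sum.cong) auto
  finally show ?thesis by (simp add: sum.delta del: sum.lessThan_Suc)
qed

lemma rav_nth_X_mult: "rav_nth (Rav (fps_X ^ n) 0 * x) p = zshift n (rav_nth x) p"
  for x :: "'r::super_ring rav"
proof -
  obtain N where N: "vanishes_from (rav_nth x) N" using rav_nth_vanishes by blast
  have "rav_nth (Rav (fps_X ^ n) 0 * x) p = (\<Sum>i<Suc (max n (max N (nat (- p)))). (if p < 0 then (fps_X ^ n) $ i else pari ((fps_X ^ n) $ i)) * zshift i (rav_nth x) p)"
    by (rule rav_nth_reg_mult) (auto intro: vanishes_mono[OF N])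
  also have "\<dots> = (\<Sum>i<Suc (max n (max N (nat (- p)))). if i = n then zshift n (rav_nth x) p else 0)"
    by (rule sum.cong) (auto simp: fps_X_power_nth)
  finally show ?thesis by (simp add: sum.delta less_Suc_eq_le del: sum.lessThan_Suc)
qed

lemma pari_Om: "pari (rav_Om m) = - (rav_Om m :: 'r::super_ring rav)"
  by (rule rav_eqI) (simp_all add: rav_Om_def pari_rav_def uminus_rav_def lookup_pm_map lookup_single when_def)

text \<open>The index of the outer variable comes first.\<close>

definition coeff2 :: "complex rav rav \<Rightarrow> int \<Rightarrow> int \<Rightarrow> complex" where
  "coeff2 x a b = rav_nth (rav_nth x a) b"

lemma coeff2_add: "coeff2 (x + y) a b = coeff2 x a b + coeff2 y a b"
  by (simp add: coeff2_def rav_nth_add)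
lemma coeff2_zero [simp]: "coeff2 0 a b = 0"
  by (simp add: coeff2_def)
lemma coeff2_uminus: "coeff2 (- x) a b = - coeff2 x a b"
  by (simp add: coeff2_def rav_nth_uminus)
lemma coeff2_sum: "coeff2 (sum f A) a b = (\<Sum>i\<in>A. coeff2 (f i) a b)"
  by (simp add: coeff2_def rav_nth_sum)

lemma rav_nth_pari: "rav_nth (pari y) m = sgn_if (0 \<le> m) (pari (rav_nth y m))"
  by (auto simp: rav_nth_def pari_rav_def[of y] lookup_pm_map)

lemma coeff2_sum': "coeff2 (sum f A) a = (\<lambda>b. \<Sum>i\<in>A. coeff2 (f i) a b)"
  by (simp add: coeff2_sum fun_eq_iff)

lemma coeff2_pari: "coeff2 (pari x) a b = sgn_if ((0 \<le> a) \<noteq> (0 \<le> b)) (coeff2 x a b)"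
  by (simp add: rav_nth_pari coeff2_def pari_complex_def sgn_if_def rav_nth_uminus)

text \<open>The sign is that of moving an inner \<open>Omega\<close> past an outer one.\<close>

lemma coeff2_const_Om: "coeff2 (rav_const (rav_Om m) * x) a b = sgn_if (0 \<le> a) (Om_shift m (coeff2 x a) b)"
  by (simp add: coeff2_def rav_nth_const_mult pari_Om rav_nth_Om_mult rav_nth_uminus) (simp add: Om_shift_def sgn_if_def coeff2_def)

lemma coeff2_Om: "coeff2 (rav_Om m * x) a b = Om_shift m (\<lambda>a. coeff2 x a b) a"
  by (simp add: coeff2_def rav_nth_Om_mult) (simp add: Om_shift_def coeff2_def)

lemma coeff2_zshift: "rav_nth (zshift i (rav_nth x) a) b = zshift i (\<lambda>a. coeff2 x a b) a"
  by (simp add: zshift_def coeff2_def)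

lemma coeff2_v_in: "coeff2 (v_in ^ n * x) a b = zshift n (coeff2 x a) b"
proof -
  have "v_in ^ n = rav_const (Rav (fps_X ^ n) 0)"
  proof (induction n)
    case 0
    then show ?case by (simp add: rav_const_def one_rav_def)
  next
    case (Suc n)
    then show ?case by (simp add: v_in_def rav_const_mult[symmetric] rav_reg_mult)
  qed
  moreover have "pari (Rav (fps_X ^ n) 0) = Rav (fps_X ^ n) (0 :: _ \<Rightarrow>\<^sub>0 complex)"
    by (rule rav_eqI) (simp_all add: pari_rav_def pari_complex_def lookup_pm_map)
  ultimately show ?thesis
    by (simp add: coeff2_def rav_nth_const_mult rav_nth_X_mult) (simp add: zshift_def coeff2_def)
qed

lemma coeff2_v_out: "coeff2 (v_out ^ n * x) a b = zshift n (\<lambda>a. coeff2 x a b) a"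
proof -
  have "v_out ^ n = Rav (fps_X ^ n) 0"
    by (induction n) (simp_all add: v_out_def rav_reg_mult one_rav_def)
  then show ?thesis by (simp add: coeff2_def rav_nth_X_mult) (simp add: zshift_def coeff2_def)
qed

text \<open>Multiplication by the expansion of \<open>Omega_(z-w)^k\<close>, up to the sign \<open>(-1)^k\<close> of the second
  expansion.\<close>

lemma coeff2_diag: "\<forall>\<^sub>F N in sequentially. coeff2 (rav_diag k * x) a b =
   sgn_if (0 \<le> a) (\<Sum>i<N. of_nat ((k + i) choose i) * Om_shift (k + i) (\<lambda>b. zshift i (\<lambda>a. coeff2 x a b) a) b)"
proof -
  obtain N where N: "vanishes_from (rav_nth x) N" using rav_nth_vanishes by blast
  have p: "pari (of_nat n * rav_Om m) = - (of_nat n * rav_Om m :: complex rav)" for n m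
    by (simp add: pari_mult pari_Om)
  show ?thesis
  proof (rule eventually_sequentiallyI[of "max N (nat (- a))"])
    fix M assume "max N (nat (- a)) \<le> M"
    then have "vanishes_from (rav_nth x) M" "nat (- a) \<le> M" using vanishes_mono[OF N] by auto
    from rav_nth_reg_mult[OF this]
    have *: "rav_nth (rav_diag k * x) a = sgn_if (0 \<le> a) (\<Sum>i<M. of_nat ((k + i) choose i) * rav_Om (k + i) * zshift i (rav_nth x) a)"
      by (auto simp: rav_diag_def p sgn_if_def sum_negf)
    have "coeff2 (rav_diag k * x) a b = sgn_if (0 \<le> a) (\<Sum>i<M. of_nat ((k + i) choose i) * Om_shift (k + i) (rav_nth (zshift i (rav_nth x) a)) b)"
      unfolding coeff2_def *
      by (simp add: rav_nth_sum rav_nth_uminus sgn_if_def mult.assoc rav_nth_of_nat_mult rav_nth_Om_mult del: binomial_Suc_Suc)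
    moreover have "rav_nth (zshift i (rav_nth x) a) = (\<lambda>b. zshift i (\<lambda>a. coeff2 x a b) a)" for i
      by (rule ext) (rule coeff2_zshift)
    ultimately show "coeff2 (rav_diag k * x) a b =
      sgn_if (0 \<le> a) (\<Sum>i<M. of_nat ((k + i) choose i) * Om_shift (k + i) (\<lambda>b. zshift i (\<lambda>a. coeff2 x a b) a) b)"
      by simp
  qed
qed

text \<open>Multiplication by power series creates no new \<open>Omega\<close>'s, so the order of the singular part is
  bounded independently of F. This is what makes the coefficients of infinite sums of powers of z
  finite sums.\<close>

lemma coeff2_coef_bound: "\<exists>B. \<forall>F. \<forall>b\<ge>B. coeff2 (rav_coef F * E) a b = 0"
  "\<exists>A. \<forall>F. \<forall>a\<ge>A. \<forall>b. coeff2 (rav_coef F * E) a b = 0"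
proof -
  obtain N where N: "vanishes_from (rav_nth E) N" using rav_nth_vanishes by blast
  have c: "rav_nth (rav_coef F * E) a = (\<Sum>i<M. Rav (F $ i) 0 * zshift i (rav_nth E) a)"
    if "M \<ge> N" "M \<ge> nat (- a)" for F M a
  proof -
    have "pari (Rav f 0) = Rav f (0 :: _ \<Rightarrow>\<^sub>0 complex)" for f
      by (rule rav_eqI) (simp_all add: pari_rav_def pari_complex_def lookup_pm_map)
    then show ?thesis
      unfolding rav_coef_def by (subst rav_nth_reg_mult[OF vanishes_mono[OF N]]; cases "a < 0") (use that in auto)
  qed
  define M where "M = max N (nat (- a))"
  have "\<exists>B. \<forall>i<M. \<forall>b\<ge>B. \<forall>f. rav_nth (Rav f 0 * zshift i (rav_nth E) a) b = 0"
  proof -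
    have "\<forall>i. \<exists>K. vanishes_from (rav_nth (zshift i (rav_nth E) a)) K" using rav_nth_vanishes by blast
    then obtain K where K: "\<And>i. vanishes_from (rav_nth (zshift i (rav_nth E) a)) (K i)" by metis
    have "rav_nth (Rav f 0 * zshift i (rav_nth E) a) b = 0" if "i < M" "int (\<Sum>i<M. K i) \<le> b" for i f b
    proof -
      have "K i \<le> (\<Sum>i<M. K i)" using that(1) by (intro member_le_sum) auto
      then have B: "vanishes_from (rav_nth (zshift i (rav_nth E) a)) (\<Sum>i<M. K i)" by (rule vanishes_mono[OF K])
      have "0 \<le> b" using that(2) by (metis of_nat_0_le_iff order_trans)
      then have b: "nat (- b) \<le> (\<Sum>i<M. K i)" by simp
      show ?thesis
        by (subst rav_nth_reg_mult[OF B b]) (use that B in \<open>auto simp: zshift_def vanishes_from_def intro!: sum.neutral\<close>)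
    qed
    then show ?thesis by blast
  qed
  then obtain B where "\<And>i b f. i < M \<Longrightarrow> b \<ge> B \<Longrightarrow> rav_nth (Rav f 0 * zshift i (rav_nth E) a) b = 0" by blast
  then have "coeff2 (rav_coef F * E) a b = 0" if "b \<ge> B" for F b
    unfolding coeff2_def by (subst c[of M]) (use that in \<open>auto simp: M_def rav_nth_sum\<close>)
  then show "\<exists>B. \<forall>F. \<forall>b\<ge>B. coeff2 (rav_coef F * E) a b = 0" by blast
  have "coeff2 (rav_coef F * E) a b = 0" if "a \<ge> int N" for F a b
    unfolding coeff2_def by (subst c[of N]) (use that N in \<open>auto simp: rav_nth_sum zshift_def vanishes_from_def intro!: sum.neutral\<close>)
  then show "\<exists>A. \<forall>F. \<forall>a\<ge>A. \<forall>b. coeff2 (rav_coef F * E) a b = 0" by blast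
qed


section \<open>Pairs of expansions of one element\<close>

text \<open>The two expansions of the sum of \<open>F u\<close> times the product of the \<open>Omega\<close>'s in u, over the words u
  in U.\<close>

definition comb_zw :: "(pt \<times> nat) list set \<Rightarrow> ((pt \<times> nat) list \<Rightarrow> czw) \<Rightarrow> complex rav rav" where
  "comb_zw U F = (\<Sum>u\<in>U. rav_coef (F u) * prod_list (map gen_zw u))"
definition comb_wz :: "(pt \<times> nat) list set \<Rightarrow> ((pt \<times> nat) list \<Rightarrow> czw) \<Rightarrow> complex rav rav" where
  "comb_wz U F = (\<Sum>u\<in>U. rav_coef (fps_swap (F u)) * prod_list (map gen_wz u))"

definition kzw_comb :: "(pt \<times> nat) list set \<Rightarrow> ((pt \<times> nat) list \<Rightarrow> czw) \<Rightarrow> kzw_rep" where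
  "kzw_comb U F = (\<Sum>u\<in>U. Poly_Mapping.single u (F u))"

lemma expand_kzw_comb:
  "rep_expand_zw (kzw_comb U F) = comb_zw U F" "rep_expand_wz (kzw_comb U F) = comb_wz U F"
proof -
  have "rep_expand_zw (sum G U) = (\<Sum>u\<in>U. rep_expand_zw (G u))" "rep_expand_wz (sum G U) = (\<Sum>u\<in>U. rep_expand_wz (G u))" for G
    by (induction U rule: infinite_finite_induct) (simp_all add: rep_expand_zw_def rep_expand_wz_def hom_simps)
  then show "rep_expand_zw (kzw_comb U F) = comb_zw U F" "rep_expand_wz (kzw_comb U F) = comb_wz U F"
    by (simp_all add: kzw_comb_def comb_zw_def comb_wz_def rep_expand_zw_def rep_expand_wz_def zw.feval_single wz.feval_single)
qed

lemma kzw_comb_pole: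
  assumes "finite U" "\<And>u k. u \<in> U \<Longrightarrow> k \<ge> N \<Longrightarrow> (Pzw, k) \<notin> set u"
  shows "kzw_pole_le N (abs_kzw (kzw_comb U F))"
proof -
  have "Poly_Mapping.keys (kzw_comb U F) \<subseteq> U"
    using assms(1) by (auto simp: kzw_comb_def in_keys_iff lookup_sum lookup_single when_def split: if_splits intro: ccontr)
  then show ?thesis
    using assms(2) by (auto simp: kzw_pole_le.abs_eq intro!: exI[of _ "kzw_comb U F"] two_sided_ideal.zero)
qed

lemma comb_zw_add: "comb_zw U (\<lambda>u. F u + G u) = comb_zw U F + comb_zw U G" "comb_wz U (\<lambda>u. F u + G u) = comb_wz U F + comb_wz U G"
  by (simp_all add: comb_zw_def comb_wz_def rav_coef_add fps_swap_add distrib_right sum.distrib)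

lemma rav_coef_uminus: "rav_coef (- F) = - rav_coef F"
  using rav_coef_add[of F "- F"] by (simp add: rav_coef_zero eq_neg_iff_add_eq_0 add.commute)

lemma fps_swap_uminus: "fps_swap (- F) = - fps_swap (F :: czw)"
  by (intro fps_ext) simp

lemma comb_zw_mono:
  assumes "finite U'" "U \<subseteq> U'"
  shows "comb_zw U' (\<lambda>u. if u \<in> U then F u else 0) = comb_zw U F" "comb_wz U' (\<lambda>u. if u \<in> U then F u else 0) = comb_wz U F"
  unfolding comb_zw_def comb_wz_def using assms
  by (auto intro!: sum.mono_neutral_cong_right simp: rav_coef_zero fps_swap_zero)

lemma comb_zw_Cons: "comb_zw (Cons l ` U) (\<lambda>u. F (tl u)) = gen_zw l * comb_zw U F" "comb_wz (Cons l ` U) (\<lambda>u. F (tl u)) = gen_wz l * comb_wz U F"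
proof -
  have a: "rav_coef f * (x * y) = x * (rav_coef f * y)" for f x y
    by (metis mult.assoc rav_coef_central)
  show "comb_zw (Cons l ` U) (\<lambda>u. F (tl u)) = gen_zw l * comb_zw U F" "comb_wz (Cons l ` U) (\<lambda>u. F (tl u)) = gen_wz l * comb_wz U F"
    by (simp_all add: comb_zw_def comb_wz_def sum.reindex a sum_distrib_left)
qed

text \<open>All three kinds of \<open>Omega\<close> expand to odd elements.\<close>

lemma pari_generator: "pari (gen_zw l) = - gen_zw l" "pari (gen_wz l) = - gen_wz l"
proof -
  have c: "pari (rav_const r) = rav_const (pari r)" for r :: "'r::super_ring"
    by (rule rav_eqI) (simp_all add: rav_const_def pari_rav_def lookup_pm_map)
  have d: "pari (rav_diag n) = - rav_diag n" for n
  proof (rule rav_eqI)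
    show "reg (pari (rav_diag n)) $ i = reg (- rav_diag n) $ i" for i
      by (simp add: pari_rav_def[where 'a = "complex rav"] rav_diag_def uminus_rav_def[where 'a = "complex rav"] pari_mult pari_Om)
  qed (simp add: rav_diag_def pari_rav_def[where 'a = "complex rav"] uminus_rav_def[where 'a = "complex rav"] lookup_pm_map)
  have m: "pari ((- 1) ^ n) = ((- 1) ^ n :: 'r::super_ring)" for n
    by (induction n) (simp_all add: pari_mult pari_minus)
  show "pari (gen_zw l) = - gen_zw l" "pari (gen_wz l) = - gen_wz l"
    by (cases l rule: gen_zw.cases; simp add: c d m pari_Om rav_const_uminus pari_mult)+
qed

lemma comb_zw_pari:
  "comb_zw U (\<lambda>u. if even (length u) then F u else - F u) = pari (comb_zw U F)"
  "comb_wz U (\<lambda>u. if even (length u) then F u else - F u) = pari (comb_wz U F)"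
proof -
  have c: "pari (rav_coef f) = rav_coef f" for f
  proof (rule rav_eqI)
    have "pari (Rav f 0) = Rav f (0 :: _ \<Rightarrow>\<^sub>0 complex)" for f
      by (rule rav_eqI) (simp_all add: pari_rav_def pari_complex_def lookup_pm_map)
    then show "reg (pari (rav_coef f)) $ i = reg (rav_coef f) $ i" for i
      by (simp add: pari_rav_def[where 'a = "complex rav"] rav_coef_def)
  qed (simp add: rav_coef_def pari_rav_def[where 'a = "complex rav"] lookup_pm_map)
  have p: "pari (prod_list (map gen_zw u)) = (if even (length u) then prod_list (map gen_zw u) else - prod_list (map gen_zw u))"
    "pari (prod_list (map gen_wz u)) = (if even (length u) then prod_list (map gen_wz u) else - prod_list (map gen_wz u))" for u
    by (induction u) (simp_all add: pari_mult pari_generator)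
  show "comb_zw U (\<lambda>u. if even (length u) then F u else - F u) = pari (comb_zw U F)"
    "comb_wz U (\<lambda>u. if even (length u) then F u else - F u) = pari (comb_wz U F)"
    by (simp_all add: comb_zw_def comb_wz_def pari_sum pari_mult c p rav_coef_uminus fps_swap_uminus if_distrib[of rav_coef] if_distrib[of fps_swap]
       if_distrib[of "\<lambda>x. x * _"] if_distrib[of "\<lambda>x. _ * x"] cong: if_cong)
qed

text \<open>The sum of \<open>z^n F_n\<close> over all n.\<close>

definition z_adic_sum :: "(nat \<Rightarrow> czw) \<Rightarrow> czw" where
  "z_adic_sum F = Abs_fps (\<lambda>j. Abs_fps (\<lambda>i. \<Sum>n\<le>i. F n $ j $ (i - n)))"

lemma z_adic_sum_split: "z_adic_sum F = (\<Sum>n<N. var_z ^ n * F n) + var_z ^ N * z_adic_sum (\<lambda>n. F (N + n))"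
proof -
  have "var_z ^ n = fps_const (fps_X ^ n)" for n
    by (simp add: var_z_def fps_const_power)
  then have v: "(var_z ^ n * G) $ j $ i = (if i < n then 0 else G $ j $ (i - n))" for n j i and G :: czw
    by (simp add: fps_X_power_mult_nth)
  have "(\<Sum>n\<le>i. F n $ j $ (i - n)) = (\<Sum>n<N. if i < n then 0 else F n $ j $ (i - n)) +
      (if i < N then 0 else \<Sum>n\<le>i - N. F (N + n) $ j $ (i - N - n))" for i j
  proof (cases "i < N")
    case True
    then have "(\<Sum>n<N. if i < n then 0 else F n $ j $ (i - n)) = (\<Sum>n\<le>i. F n $ j $ (i - n))"
      by (intro sum.mono_neutral_cong_right) auto
    with True show ?thesis by simp
  next
    case False
    then have e: "{..i} = {..<N} \<union> {N..i}" "{N..i} = (+) N ` {..i - N}"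
      by (auto simp: atMost_atLeast0)
    have "(\<Sum>n\<in>{N..i}. F n $ j $ (i - n)) = (\<Sum>n\<le>i - N. F (N + n) $ j $ (i - N - n))"
      unfolding e(2) by (subst sum.reindex) (auto simp: diff_diff_add)
    moreover have "(\<Sum>n<N. if i < n then 0 else F n $ j $ (i - n)) = (\<Sum>n<N. F n $ j $ (i - n))"
      using False by (intro sum.cong) auto
    ultimately show ?thesis
      using False by (subst e(1), subst sum.union_disjoint) auto
  qed
  then show ?thesis
    by (intro fps_ext) (simp add: z_adic_sum_def fps_sum_nth v del: fps_mult_left_const_nth)
qed

text \<open>After N terms the remainder is divisible by \<open>z^N\<close>. In a fixed coefficient this kills the regular
  part as soon as N exceeds the exponent, and the singular part by the uniform bound on its order.\<close>

lemma z_adic_sum_coef: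
  "\<forall>\<^sub>F N in sequentially. coeff2 (rav_coef (z_adic_sum F) * E) b a = (\<Sum>n<N. zshift n (coeff2 (rav_coef (F n) * E) b) a)"
  "\<forall>\<^sub>F N in sequentially. coeff2 (rav_coef (fps_swap (z_adic_sum F)) * E) a b = (\<Sum>n<N. zshift n (\<lambda>a. coeff2 (rav_coef (fps_swap (F n)) * E) a b) a)"
proof -
  have hp: "rav_coef (x ^ n) = rav_coef x ^ n" "fps_swap (x ^ n) = fps_swap x ^ n" for x n
    by (induction n) (simp_all add: rav_coef_one rav_coef_mult fps_swap_one fps_swap_mult)
  have hs: "rav_coef (sum G A) = (\<Sum>n\<in>A. rav_coef (G n))" "fps_swap (sum G A) = (\<Sum>n\<in>A. fps_swap (G n))"
    for G and A :: "nat set"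
    by (induction A rule: infinite_finite_induct)
      (simp_all add: rav_coef_zero rav_coef_add fps_swap_zero fps_swap_add)
  \<comment> \<open>The bounds are uniform in F, hence they apply to all remainders at once.\<close>
  obtain B where B: "\<And>F b'. b' \<ge> B \<Longrightarrow> coeff2 (rav_coef F * E) b b' = 0" using coeff2_coef_bound(1)[of E b] by blast
  obtain A where A: "\<And>F a b. a \<ge> A \<Longrightarrow> coeff2 (rav_coef F * E) a b = 0" using coeff2_coef_bound(2)[of E] by blast
  show "\<forall>\<^sub>F N in sequentially. coeff2 (rav_coef (z_adic_sum F) * E) b a = (\<Sum>n<N. zshift n (coeff2 (rav_coef (F n) * E) b) a)"
  proof (rule eventually_sequentiallyI[of "nat (max 0 (B - a)) + nat (- a)"])
    fix N assume N: "nat (max 0 (B - a)) + nat (- a) \<le> N"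
    have "zshift N (coeff2 (rav_coef (z_adic_sum (\<lambda>n. F (N + n))) * E) b) a = 0"
      using N by (auto simp: zshift_def intro!: B)
    then show "coeff2 (rav_coef (z_adic_sum F) * E) b a = (\<Sum>n<N. zshift n (coeff2 (rav_coef (F n) * E) b) a)"
      by (subst z_adic_sum_split[of _ N])
        (simp add: rav_coef_add rav_coef_mult hs hp rav_coef_var_z distrib_right sum_distrib_right mult.assoc coeff2_add coeff2_sum coeff2_v_in)
  qed
  show "\<forall>\<^sub>F N in sequentially. coeff2 (rav_coef (fps_swap (z_adic_sum F)) * E) a b = (\<Sum>n<N. zshift n (\<lambda>a. coeff2 (rav_coef (fps_swap (F n)) * E) a b) a)"
  proof (rule eventually_sequentiallyI[of "nat (max 0 (A - a)) + nat (- a)"])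
    fix N assume N: "nat (max 0 (A - a)) + nat (- a) \<le> N"
    have "zshift N (\<lambda>a. coeff2 (rav_coef (fps_swap (z_adic_sum (\<lambda>n. F (N + n)))) * E) a b) a = 0"
      using N by (auto simp: zshift_def intro!: A)
    then show "coeff2 (rav_coef (fps_swap (z_adic_sum F)) * E) a b = (\<Sum>n<N. zshift n (\<lambda>a. coeff2 (rav_coef (fps_swap (F n)) * E) a b) a)"
      by (subst z_adic_sum_split[of _ N])
        (simp add: rav_coef_add rav_coef_mult fps_swap_add fps_swap_mult hs hp fps_swap_z rav_coef_var_w
          distrib_right sum_distrib_right mult.assoc coeff2_add coeff2_sum coeff2_v_out)
  qed
qed

lemma z_adic_sum_comb_zw:
  assumes "finite U"
  shows "\<forall>\<^sub>F N in sequentially. coeff2 (comb_zw U (\<lambda>u. z_adic_sum (\<lambda>n. F n u))) b a = (\<Sum>n<N. zshift n (coeff2 (comb_zw U (F n)) b) a)"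
    "\<forall>\<^sub>F N in sequentially. coeff2 (comb_wz U (\<lambda>u. z_adic_sum (\<lambda>n. F n u))) a b = (\<Sum>n<N. zshift n (\<lambda>a. coeff2 (comb_wz U (F n)) a b) a)"
proof -
  have s: "zshift n (\<lambda>a. \<Sum>u\<in>U. f u a) a = (\<Sum>u\<in>U. zshift n (f u) a)" for n a and f :: "_ \<Rightarrow> _ \<Rightarrow> complex"
    by (cases "a < 0 \<and> 0 \<le> a + int n") (auto simp: zshift_def)
  have "\<forall>\<^sub>F N in sequentially. \<forall>u\<in>U. coeff2 (rav_coef (z_adic_sum (\<lambda>n. F n u)) * prod_list (map gen_zw u)) b a =
     (\<Sum>n<N. zshift n (coeff2 (rav_coef (F n u) * prod_list (map gen_zw u)) b) a)"
    using assms z_adic_sum_coef(1) by (intro eventually_ball_finite) auto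
  then show "\<forall>\<^sub>F N in sequentially. coeff2 (comb_zw U (\<lambda>u. z_adic_sum (\<lambda>n. F n u))) b a = (\<Sum>n<N. zshift n (coeff2 (comb_zw U (F n)) b) a)"
    by eventually_elim (simp add: comb_zw_def coeff2_sum' s sum.swap[of _ U])
  have "\<forall>\<^sub>F N in sequentially. \<forall>u\<in>U. coeff2 (rav_coef (fps_swap (z_adic_sum (\<lambda>n. F n u))) * prod_list (map gen_wz u)) a b =
     (\<Sum>n<N. zshift n (\<lambda>a. coeff2 (rav_coef (fps_swap (F n u)) * prod_list (map gen_wz u)) a b) a)"
    using assms z_adic_sum_coef(2) by (intro eventually_ball_finite) auto
  then show "\<forall>\<^sub>F N in sequentially. coeff2 (comb_wz U (\<lambda>u. z_adic_sum (\<lambda>n. F n u))) a b = (\<Sum>n<N. zshift n (\<lambda>a. coeff2 (comb_wz U (F n)) a b) a)"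
    by eventually_elim (simp add: comb_wz_def coeff2_sum s sum.swap[of _ U])
qed


context complex_space
begin

text \<open>S and \<open>S'\<close> are the coefficients of two expansions of one vector-valued combination of the words
  in U, tested on linear functionals; U does not depend on the functional. The index of z comes
  first in both.\<close>

definition local_with :: "(pt \<times> nat) list set \<Rightarrow> (int \<Rightarrow> int \<Rightarrow> 'v) \<Rightarrow> (int \<Rightarrow> int \<Rightarrow> 'v) \<Rightarrow> bool" where
  "local_with U S S' \<longleftrightarrow> finite U \<and> (\<forall>\<phi>. Vector_Spaces.linear scale (*) \<phi> \<longrightarrow>
     (\<exists>F. \<forall>a b. coeff2 (comb_zw U F) b a = \<phi> (S a b) \<and> coeff2 (comb_wz U F) a b = \<phi> (S' a b)))"

end

locale functional = complex_space scale for scale :: "complex \<Rightarrow> 'v::ab_group_add \<Rightarrow> 'v" +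
  fixes \<phi> :: "'v \<Rightarrow> complex"
  assumes lin: "Vector_Spaces.linear scale (*) \<phi>"
begin

lemma add: "\<phi> (u + v) = \<phi> u + \<phi> v" and zero: "\<phi> 0 = 0" and sc: "\<phi> (scale c v) = c * \<phi> v"
  and sgn_if: "\<phi> (sgn_if b v) = sgn_if b (\<phi> v)" and sum: "\<phi> (sum f A) = (\<Sum>i\<in>A. \<phi> (f i))"
proof -
  interpret \<phi>: Vector_Spaces.linear scale "(*)" \<phi> by (rule lin)
  show "\<phi> (u + v) = \<phi> u + \<phi> v" "\<phi> 0 = 0" "\<phi> (scale c v) = c * \<phi> v"
    "\<phi> (sgn_if b v) = sgn_if b (\<phi> v)" "\<phi> (sum f A) = (\<Sum>i\<in>A. \<phi> (f i))"
    by (simp_all add: \<phi>.add \<phi>.zero \<phi>.scale \<phi>.neg \<phi>.sum sgn_if_def)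
qed

lemma Om_shift: "\<phi> (Om_shift m A p) = Om_shift m (\<lambda>p. \<phi> (A p)) p" and zshift: "\<phi> (zshift m A p) = zshift m (\<lambda>p. \<phi> (A p)) p"
  by (simp_all add: Om_shift_def zshift_def zero)

end

context complex_space
begin

lemma functionalI: "Vector_Spaces.linear scale (*) \<phi> \<Longrightarrow> functional scale \<phi>"
  by (intro functional.intro complex_space_axioms functional_axioms.intro)

lemma local_with_transform:
  assumes "local_with U S S'" and "finite V"
    and "\<And>\<phi> F. functional scale \<phi> \<Longrightarrow> (\<And>a b. coeff2 (comb_zw U F) b a = \<phi> (S a b)) \<Longrightarrow>
      (\<And>a b. coeff2 (comb_wz U F) a b = \<phi> (S' a b)) \<Longrightarrow>
      \<exists>G. \<forall>a b. coeff2 (comb_zw V G) b a = \<phi> (T a b) \<and> coeff2 (comb_wz V G) a b = \<phi> (T' a b)"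
  shows "local_with V T T'"
  unfolding local_with_def
proof (intro conjI allI impI assms(2))
  fix \<phi> assume l: "Vector_Spaces.linear scale (*) \<phi>"
  with assms(1) obtain F where "\<forall>a b. coeff2 (comb_zw U F) b a = \<phi> (S a b) \<and> coeff2 (comb_wz U F) a b = \<phi> (S' a b)"
    unfolding local_with_def by meson
  then show "\<exists>G. \<forall>a b. coeff2 (comb_zw V G) b a = \<phi> (T a b) \<and> coeff2 (comb_wz V G) a b = \<phi> (T' a b)"
    by (intro assms(3)[of \<phi> F] functionalI l) auto
qed

lemma local_with_finite: "local_with U S S' \<Longrightarrow> finite U"
  by (simp add: local_with_def)

lemma local_with_mono:
  assumes "local_with U S S'" "U \<subseteq> U'" "finite U'" shows "local_with U' S S'"
proof (rule local_with_transform[OF assms(1,3)])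
  fix \<phi> F
  assume "\<And>a b. coeff2 (comb_zw U F) b a = \<phi> (S a b)" "\<And>a b. coeff2 (comb_wz U F) a b = \<phi> (S' a b)"
  then show "\<exists>F. \<forall>a b. coeff2 (comb_zw U' F) b a = \<phi> (S a b) \<and> coeff2 (comb_wz U' F) a b = \<phi> (S' a b)"
    by (intro exI[of _ "\<lambda>u. if u \<in> U then F u else 0"]) (simp add: comb_zw_mono assms)
qed

lemma local_with_add:
  assumes "local_with U S S'" "local_with V T T'"
  shows "local_with (U \<union> V) (\<lambda>a b. S a b + T a b) (\<lambda>a b. S' a b + T' a b)"
proof -
  have fin: "finite (U \<union> V)" using assms by (simp add: local_with_def)
  have 1: "local_with (U \<union> V) S S'" "local_with (U \<union> V) T T'"
    by (rule local_with_mono[OF assms(1) _ fin] local_with_mono[OF assms(2) _ fin], simp)+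
  show ?thesis unfolding local_with_def
  proof (intro conjI allI impI fin)
    fix \<phi> assume l: "Vector_Spaces.linear scale (*) \<phi>"
    then interpret functional scale \<phi> by (rule functionalI)
    from 1(1) l obtain F where F: "\<forall>a b. coeff2 (comb_zw (U \<union> V) F) b a = \<phi> (S a b) \<and> coeff2 (comb_wz (U \<union> V) F) a b = \<phi> (S' a b)"
      unfolding local_with_def by meson
    from 1(2) l obtain G where G: "\<forall>a b. coeff2 (comb_zw (U \<union> V) G) b a = \<phi> (T a b) \<and> coeff2 (comb_wz (U \<union> V) G) a b = \<phi> (T' a b)"
      unfolding local_with_def by meson
    show "\<exists>F. \<forall>a b. coeff2 (comb_zw (U \<union> V) F) b a = \<phi> (S a b + T a b) \<and> coeff2 (comb_wz (U \<union> V) F) a b = \<phi> (S' a b + T' a b)"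
      by (intro exI[of _ "\<lambda>u. F u + G u"]) (simp add: comb_zw_add coeff2_add F G add)
  qed
qed

lemma local_with_zero: "local_with {} (\<lambda>a b. 0) (\<lambda>a b. 0)"
proof -
  have "\<phi> 0 = 0" if "Vector_Spaces.linear scale (*) \<phi>" for \<phi> :: "'v \<Rightarrow> complex"
    using functional.zero[OF functionalI[OF that]] .
  then show ?thesis by (auto simp: local_with_def comb_zw_def comb_wz_def)
qed

lemma local_with_linear:
  assumes "local_with U S S'" "lin_op T"
  shows "local_with U (\<lambda>a b. T (S a b)) (\<lambda>a b. T (S' a b))"
  unfolding local_with_def
proof (intro conjI allI impI)
  show "finite U" using assms by (simp add: local_with_def)
  fix \<phi> assume l: "Vector_Spaces.linear scale (*) \<phi>"
  interpret T: Vector_Spaces.linear scale scale T by fact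
  interpret \<phi>: Vector_Spaces.linear scale "(*)" \<phi> by fact
  have "Vector_Spaces.linear scale (*) (\<lambda>v. \<phi> (T v))"
    by unfold_locales (simp_all add: T.add T.scale \<phi>.add \<phi>.scale)
  with assms(1) show "\<exists>F. \<forall>a b. coeff2 (comb_zw U F) b a = \<phi> (T (S a b)) \<and> coeff2 (comb_wz U F) a b = \<phi> (T (S' a b))"
    unfolding local_with_def by (metis (no_types, lifting))
qed

lemma linear_scale: "lin_op (scale c)"
  by unfold_locales (simp_all add: scale_right_distrib mult.commute)

lemma local_with_scale: "local_with U S S' \<Longrightarrow> local_with U (\<lambda>a b. scale c (S a b)) (\<lambda>a b. scale c (S' a b))"
  by (rule local_with_linear[OF _ linear_scale])

lemma local_with_sgn_if: "local_with U S S' \<Longrightarrow> local_with U (\<lambda>a b. sgn_if c (S a b)) (\<lambda>a b. sgn_if c (S' a b))"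
  using local_with_scale[of U S S' "- 1"] by (cases c) (simp_all add: scale_minus_left)

text \<open>Negating every \<open>Omega\<close> is an automorphism compatible with both expansions.\<close>

lemma local_with_parity:
  assumes "local_with U S S'"
  shows "local_with U (\<lambda>a b. sgn_if ((0 \<le> a) \<noteq> (0 \<le> b)) (S a b)) (\<lambda>a b. sgn_if ((0 \<le> a) \<noteq> (0 \<le> b)) (S' a b))"
proof (rule local_with_transform[OF assms local_with_finite[OF assms]])
  fix \<phi> F
  assume "functional scale \<phi>"
    and F: "\<And>a b. coeff2 (comb_zw U F) b a = \<phi> (S a b)" "\<And>a b. coeff2 (comb_wz U F) a b = \<phi> (S' a b)"
  then interpret functional scale \<phi> by simp
  show "\<exists>F. \<forall>a b. coeff2 (comb_zw U F) b a = \<phi> (sgn_if ((0 \<le> a) \<noteq> (0 \<le> b)) (S a b)) \<and> coeff2 (comb_wz U F) a b = \<phi> (sgn_if ((0 \<le> a) \<noteq> (0 \<le> b)) (S' a b))"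
    by (intro exI[of _ "\<lambda>u. if even (length u) then F u else - F u"])
      (auto simp: comb_zw_pari coeff2_pari F sgn_if_def sgn_if[of True, simplified])
qed

lemma local_with_Om_z:
  assumes "local_with U S S'"
  shows "local_with (Cons (Pz, m) ` U) (\<lambda>a b. sgn_if (0 \<le> b) (Om_shift m (\<lambda>a. S a b) a)) (\<lambda>a b. Om_shift m (\<lambda>a. S' a b) a)"
proof (rule local_with_transform[OF assms])
  show "finite (Cons (Pz, m) ` U)" using local_with_finite[OF assms] by simp
  fix \<phi> F
  assume "functional scale \<phi>"
    and F: "\<And>a b. coeff2 (comb_zw U F) b a = \<phi> (S a b)" "\<And>a b. coeff2 (comb_wz U F) a b = \<phi> (S' a b)"
  then interpret functional scale \<phi> by simp
  have F': "coeff2 (comb_zw U F) b = (\<lambda>a. \<phi> (S a b))" for b using F by auto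
  show "\<exists>F. \<forall>a b. coeff2 (comb_zw (Cons (Pz, m) ` U) F) b a = \<phi> (sgn_if (0 \<le> b) (Om_shift m (\<lambda>a. S a b) a)) \<and>
       coeff2 (comb_wz (Cons (Pz, m) ` U) F) a b = \<phi> (Om_shift m (\<lambda>a. S' a b) a)"
    by (intro exI[of _ "\<lambda>u. F (tl u)"]) (simp add: comb_zw_Cons coeff2_const_Om coeff2_Om F' F(2) sgn_if Om_shift)
qed

lemma local_with_Om_w:
  assumes "local_with U S S'"
  shows "local_with (Cons (Pw, m) ` U) (\<lambda>a b. Om_shift m (\<lambda>b. S a b) b) (\<lambda>a b. sgn_if (0 \<le> a) (Om_shift m (\<lambda>b. S' a b) b))"
proof (rule local_with_transform[OF assms])
  show "finite (Cons (Pw, m) ` U)" using local_with_finite[OF assms] by simp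
  fix \<phi> F
  assume "functional scale \<phi>"
    and F: "\<And>a b. coeff2 (comb_zw U F) b a = \<phi> (S a b)" "\<And>a b. coeff2 (comb_wz U F) a b = \<phi> (S' a b)"
  then interpret functional scale \<phi> by simp
  have F': "coeff2 (comb_wz U F) a = (\<lambda>b. \<phi> (S' a b))" for a using F by auto
  show "\<exists>F. \<forall>a b. coeff2 (comb_zw (Cons (Pw, m) ` U) F) b a = \<phi> (Om_shift m (\<lambda>b. S a b) b) \<and>
       coeff2 (comb_wz (Cons (Pw, m) ` U) F) a b = \<phi> (sgn_if (0 \<le> a) (Om_shift m (\<lambda>b. S' a b) b))"
    by (intro exI[of _ "\<lambda>u. F (tl u)"]) (simp add: comb_zw_Cons coeff2_const_Om coeff2_Om F' F(1) sgn_if Om_shift)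
qed

lemma local_with_reg:
  fixes G :: "nat \<Rightarrow> nat \<Rightarrow> 'v"
  defines "S \<equiv> \<lambda>a b. if a < 0 \<and> b < 0 then G (nat (- a - 1)) (nat (- b - 1)) else 0"
  shows "local_with {[]} S S"
  unfolding local_with_def
proof (intro conjI allI impI)
  fix \<phi> assume l: "Vector_Spaces.linear scale (*) \<phi>"
  then interpret functional scale \<phi> by (rule functionalI)
  have "coeff2 (rav_coef F) a b = (if a < 0 \<and> b < 0 then F $ nat (- a - 1) $ nat (- b - 1) else 0)" for F a b
    by (simp add: coeff2_def rav_nth_def rav_coef_def) (simp add: zero_rav_def)
  then show "\<exists>F. \<forall>a b. coeff2 (comb_zw {[]} F) b a = \<phi> (S a b) \<and> coeff2 (comb_wz {[]} F) a b = \<phi> (S a b)"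
    by (intro exI[of _ "\<lambda>_. Abs_fps (\<lambda>j. Abs_fps (\<lambda>i. \<phi> (G i j)))"]) (auto simp: comb_zw_def comb_wz_def S_def zero)
qed simp

text \<open>Multiplication by \<open>Omega_(z-w)^k\<close>; T and \<open>T'\<close> are described by their partial sums because the
  expansions of \<open>Omega_(z-w)^k\<close> are infinite.\<close>

lemma local_with_Om_zw:
  assumes "local_with U S S'"
    and T: "\<And>a b. \<forall>\<^sub>F N in sequentially. T a b =
       sgn_if (0 \<le> b) (Om_diff_part k S N a b)"
    and T': "\<And>a b. \<forall>\<^sub>F N in sequentially. T' a b =
       sgn_if (0 \<le> a) (scale ((- 1) ^ k) (Om_diff_part k (\<lambda>b a. S' a b) N b a))"
  shows "local_with (Cons (Pzw, k) ` U) T T'"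
proof (rule local_with_transform[OF assms(1)])
  show "finite (Cons (Pzw, k) ` U)" using local_with_finite[OF assms(1)] by simp
  fix \<phi> F
  assume "functional scale \<phi>"
    and F: "\<And>a b. coeff2 (comb_zw U F) b a = \<phi> (S a b)" "\<And>a b. coeff2 (comb_wz U F) a b = \<phi> (S' a b)"
  then interpret functional scale \<phi> by simp
  have "\<forall>\<^sub>F N in sequentially. coeff2 (rav_diag k * comb_zw U F) b a = \<phi> (T a b)" for a b
    using coeff2_diag[of k "comb_zw U F" b a] T[of a b]
    by eventually_elim (simp add: sgn_if sum sc Om_shift zshift F)
  moreover have "\<forall>\<^sub>F N in sequentially. coeff2 ((- 1) ^ k * (rav_diag k * comb_wz U F)) a b = \<phi> (T' a b)" for a b
    using coeff2_diag[of k "comb_wz U F" a b] T'[of a b]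
    by eventually_elim (simp add: sgn_if sum sc Om_shift zshift F m1_pow coeff2_uminus, simp add: sgn_if_def)
  ultimately show "\<exists>F. \<forall>a b. coeff2 (comb_zw (Cons (Pzw, k) ` U) F) b a = \<phi> (T a b) \<and>
       coeff2 (comb_wz (Cons (Pzw, k) ` U) F) a b = \<phi> (T' a b)"
    by (intro exI[of _ "\<lambda>u. F (tl u)"]) (simp add: comb_zw_Cons mult.assoc)
qed

text \<open>Multiplication by the operator-valued series of \<open>z^n T_n\<close>. If \<open>F_n\<close> represents the pair for the
  functional \<open>\<phi> o T_n\<close>, then the sum of \<open>z^n F_n\<close> represents the product for \<open>\<phi>\<close>; the set of words
  stays the same.\<close>

lemma local_with_series:
  assumes loc: "local_with U S S'" and T: "\<And>n. lin_op (T n)"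
    and R: "\<And>a b. \<forall>\<^sub>F N in sequentially. R a b = (\<Sum>n<N. T n (zshift n (\<lambda>a. S a b) a))"
    and R': "\<And>a b. \<forall>\<^sub>F N in sequentially. R' a b = (\<Sum>n<N. T n (zshift n (\<lambda>a. S' a b) a))"
  shows "local_with U R R'"
  unfolding local_with_def
proof (intro conjI allI impI)
  show fin: "finite U" using assms by (simp add: local_with_def)
  fix \<phi> assume l: "Vector_Spaces.linear scale (*) \<phi>"
  then interpret functional scale \<phi> by (rule functionalI)
  have "\<forall>n. \<exists>F. \<forall>a b. coeff2 (comb_zw U F) b a = \<phi> (T n (S a b)) \<and> coeff2 (comb_wz U F) a b = \<phi> (T n (S' a b))"
    using local_with_linear[OF loc T] l unfolding local_with_def by blast
  then obtain F where F: "\<And>n a b. coeff2 (comb_zw U (F n)) b a = \<phi> (T n (S a b))" "\<And>n a b. coeff2 (comb_wz U (F n)) a b = \<phi> (T n (S' a b))"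
    by metis
  have F': "coeff2 (comb_zw U (F n)) b = (\<lambda>a. \<phi> (T n (S a b)))" for b n using F by auto
  have s: "\<phi> (T n (zshift n A a)) = zshift n (\<lambda>a. \<phi> (T n (A a))) a" for n A a
  proof -
    interpret T: Vector_Spaces.linear scale scale "T n" by (rule T)
    show ?thesis by (simp add: zshift_def T.zero zero)
  qed
  have "\<forall>\<^sub>F N in sequentially. coeff2 (comb_zw U (\<lambda>u. z_adic_sum (\<lambda>n. F n u))) b a = \<phi> (R a b)" for a b
    using z_adic_sum_comb_zw(1)[OF fin, of F b a] R[of a b] by eventually_elim (simp add: sum s F')
  moreover have "\<forall>\<^sub>F N in sequentially. coeff2 (comb_wz U (\<lambda>u. z_adic_sum (\<lambda>n. F n u))) a b = \<phi> (R' a b)" for a b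
    using z_adic_sum_comb_zw(2)[OF fin, of F a b] R'[of a b] by eventually_elim (simp add: sum s F)
  ultimately show "\<exists>F. \<forall>a b. coeff2 (comb_zw U F) b a = \<phi> (R a b) \<and> coeff2 (comb_wz U F) a b = \<phi> (R' a b)"
    by (intro exI[of _ "\<lambda>u. z_adic_sum (\<lambda>n. F n u)"]) simp
qed

text \<open>N bounds the order of the pole at \<open>z = w\<close>. The words themselves may vary, since the orders of the
  poles at \<open>z = 0\<close> and \<open>w = 0\<close> depend on the vector.\<close>

definition local_pair :: "nat \<Rightarrow> (int \<Rightarrow> int \<Rightarrow> 'v) \<Rightarrow> (int \<Rightarrow> int \<Rightarrow> 'v) \<Rightarrow> bool" where
  "local_pair N S S' \<longleftrightarrow> (\<exists>U. (\<forall>u\<in>U. \<forall>k\<ge>N. (Pzw, k) \<notin> set u) \<and> local_with U S S')"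

lemma local_pair_mono: "local_pair N S S' \<Longrightarrow> N \<le> M \<Longrightarrow> local_pair M S S'"
  unfolding local_pair_def by (meson order_trans)

lemma local_pair_zero: "local_pair N (\<lambda>a b. 0) (\<lambda>a b. 0)"
  unfolding local_pair_def using local_with_zero by blast

lemma local_pair_add: "local_pair N S S' \<Longrightarrow> local_pair N T T' \<Longrightarrow> local_pair N (\<lambda>a b. S a b + T a b) (\<lambda>a b. S' a b + T' a b)"
  unfolding local_pair_def by (elim exE conjE, rule exI, rule conjI[OF _ local_with_add]) auto

lemma local_pair_scale: "local_pair N S S' \<Longrightarrow> local_pair N (\<lambda>a b. scale c (S a b)) (\<lambda>a b. scale c (S' a b))"
  unfolding local_pair_def by (elim exE conjE, rule exI, rule conjI[OF _ local_with_scale])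

lemma local_pair_sgn_if: "local_pair N S S' \<Longrightarrow> local_pair N (\<lambda>a b. sgn_if c (S a b)) (\<lambda>a b. sgn_if c (S' a b))"
  unfolding local_pair_def by (elim exE conjE, rule exI, rule conjI[OF _ local_with_sgn_if])

lemma local_pair_sum: "(\<And>i. i < (n::nat) \<Longrightarrow> local_pair N (S i) (S' i)) \<Longrightarrow> local_pair N (\<lambda>a b. \<Sum>i<n. S i a b) (\<lambda>a b. \<Sum>i<n. S' i a b)"
  by (induction n) (simp_all add: local_pair_zero local_pair_add)

lemma local_pair_sum_list: "(\<And>d. d \<in> set D \<Longrightarrow> local_pair N (S d) (S' d)) \<Longrightarrow> local_pair N (\<lambda>a b. \<Sum>d\<leftarrow>D. S d a b) (\<lambda>a b. \<Sum>d\<leftarrow>D. S' d a b)"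
  by (induction D) (simp_all add: local_pair_zero local_pair_add)

lemma local_pair_parity: "local_pair N S S' \<Longrightarrow> local_pair N (\<lambda>a b. sgn_if (c \<and> (0 \<le> a) \<noteq> (0 \<le> b)) (S a b)) (\<lambda>a b. sgn_if (c \<and> (0 \<le> a) \<noteq> (0 \<le> b)) (S' a b))"
proof (cases c)
  case True
  assume "local_pair N S S'"
  then obtain U where U: "\<forall>u\<in>U. \<forall>k\<ge>N. (Pzw, k) \<notin> set u" "local_with U S S'"
    unfolding local_pair_def by blast
  with True local_with_parity[OF this(2)] show ?thesis
    unfolding local_pair_def by (intro exI[of _ U]) simp
qed simp

lemma local_pair_Om_z: "local_pair N S S' \<Longrightarrow> local_pair N (\<lambda>a b. sgn_if (0 \<le> b) (Om_shift m (\<lambda>a. S a b) a)) (\<lambda>a b. Om_shift m (\<lambda>a. S' a b) a)"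
  unfolding local_pair_def by (elim exE conjE, rule exI, rule conjI[OF _ local_with_Om_z]) auto

lemma local_pair_Om_w: "local_pair N S S' \<Longrightarrow> local_pair N (\<lambda>a b. Om_shift m (\<lambda>b. S a b) b) (\<lambda>a b. sgn_if (0 \<le> a) (Om_shift m (\<lambda>b. S' a b) b))"
  unfolding local_pair_def by (elim exE conjE, rule exI, rule conjI[OF _ local_with_Om_w]) auto

lemma local_pair_reg: "local_pair N (\<lambda>a b. if a < 0 \<and> b < 0 then G (nat (- a - 1)) (nat (- b - 1)) else 0)
    (\<lambda>a b. if a < 0 \<and> b < 0 then G (nat (- a - 1)) (nat (- b - 1)) else 0)"
  unfolding local_pair_def by (rule exI[of _ "{[]}"]) (auto intro: local_with_reg)

lemma local_pair_Om_zw: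
  assumes "local_pair N S S'" "k < N"
    and "\<And>a b. \<forall>\<^sub>F N in sequentially. T a b =
       sgn_if (0 \<le> b) (Om_diff_part k S N a b)"
    and "\<And>a b. \<forall>\<^sub>F N in sequentially. T' a b =
       sgn_if (0 \<le> a) (scale ((- 1) ^ k) (Om_diff_part k (\<lambda>b a. S' a b) N b a))"
  shows "local_pair N T T'"
proof -
  from assms(1) obtain U where "\<forall>u\<in>U. \<forall>k\<ge>N. (Pzw, k) \<notin> set u" "local_with U S S'"
    unfolding local_pair_def by blast
  with local_with_Om_zw[OF this(2) assms(3,4)] assms(2) show ?thesis
    unfolding local_pair_def by (intro exI[of _ "Cons (Pzw, k) ` U"]) auto
qed

lemma local_pair_series:
  assumes "local_pair N S S'" "\<And>n. lin_op (T n)"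
    "\<And>a b. \<forall>\<^sub>F N in sequentially. R a b = (\<Sum>n<N. T n (zshift n (\<lambda>a. S a b) a))"
    "\<And>a b. \<forall>\<^sub>F N in sequentially. R' a b = (\<Sum>n<N. T n (zshift n (\<lambda>a. S' a b) a))"
  shows "local_pair N R R'"
  using assms(1) unfolding local_pair_def
  by (elim exE conjE, intro exI conjI) (assumption, rule local_with_series[OF _ assms(2-4)])

end

section \<open>Locality of normally ordered products\<close>

lemma sum_stable: "(\<And>m. m \<ge> M \<Longrightarrow> f m = 0) \<Longrightarrow> N \<ge> M \<Longrightarrow> (\<Sum>m<N. f m) = (\<Sum>m<(M::nat). f m :: 'a::comm_monoid_add)"
  by (rule sum.mono_neutral_right) auto

context free_fields
begin

text \<open>The coefficients of \<open>A(z) B(w) v\<close> and of \<open>(-1)^(r s) B(w) A(z) v\<close> for fields of parities r and s,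
  with the \<open>Omega\<close> of the right factor moved to the front.\<close>

definition product_zw :: "bool \<Rightarrow> 'v modes \<Rightarrow> 'v modes \<Rightarrow> 'v \<Rightarrow> int \<Rightarrow> int \<Rightarrow> 'v" where
  "product_zw r A B v a b = sgn_if (0 \<le> b \<and> r) (A a (B b v))"

definition product_wz :: "bool \<Rightarrow> bool \<Rightarrow> 'v modes \<Rightarrow> 'v modes \<Rightarrow> 'v \<Rightarrow> int \<Rightarrow> int \<Rightarrow> 'v" where
  "product_wz r s A B v a b = sgn_if (r \<and> s) (sgn_if (0 \<le> a \<and> s) (B b (A a v)))"

text \<open>The products with \<open>Omega_(z-w)^k\<close> in the two domains of expansion.\<close>

definition Om_diff_zw :: "nat \<Rightarrow> (int \<Rightarrow> int \<Rightarrow> 'v) \<Rightarrow> int \<Rightarrow> int \<Rightarrow> 'v" where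
  "Om_diff_zw k S a b = sgn_if (0 \<le> b) (sum_supp (\<lambda>i. scale (of_nat ((k + i) choose i)) (Om_shift (k + i) (\<lambda>a. zshift i (\<lambda>b. S a b) b) a)))"

definition Om_diff_wz :: "nat \<Rightarrow> (int \<Rightarrow> int \<Rightarrow> 'v) \<Rightarrow> int \<Rightarrow> int \<Rightarrow> 'v" where
  "Om_diff_wz k S a b = sgn_if (0 \<le> a) (scale ((- 1) ^ k) (sum_supp (\<lambda>i. scale (of_nat ((k + i) choose i)) (Om_shift (k + i) (\<lambda>b. zshift i (\<lambda>a. S a b) a) b))))"

lemma is_field_zero: "is_field A \<Longrightarrow> A p 0 = 0"
  by (simp add: linear_rules[OF is_field_linear])

lemma Om_diff_zw_eventually:
  assumes "is_field A" "is_field B"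
  shows "\<forall>\<^sub>F N in sequentially. Om_diff_zw k (product_zw r A B v) a b = sgn_if (0 \<le> b) (Om_diff_part k (product_zw r A B v) N a b)"
proof -
  obtain M where M: "vanishes_from (\<lambda>p. B p v) M" using is_field_vanishes[OF assms(2)] by blast
  show ?thesis
  proof (rule eventually_sequentiallyI[of "max M (nat (- b))"])
    fix N assume N: "max M (nat (- b)) \<le> N"
    have "zshift i (\<lambda>b. product_zw r A B v a b) b = 0" if "i \<ge> N" for i a
      using N that M by (auto simp: zshift_def product_zw_def vanishes_from_def is_field_zero[OF assms(1)])
    then show "Om_diff_zw k (product_zw r A B v) a b = sgn_if (0 \<le> b) (Om_diff_part k (product_zw r A B v) N a b)"
      unfolding Om_diff_zw_def by (subst sum_supp_eq[of N]) (simp_all add: Om_shift_def)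
  qed
qed

lemma Om_diff_wz_eventually:
  assumes "is_field A" "is_field B"
  shows "\<forall>\<^sub>F N in sequentially. Om_diff_wz k (product_wz r s A B v) a b = sgn_if (0 \<le> a) (scale ((- 1) ^ k) (Om_diff_part k (\<lambda>b a. product_wz r s A B v a b) N b a))"
proof -
  obtain M where M: "vanishes_from (\<lambda>p. A p v) M" using is_field_vanishes[OF assms(1)] by blast
  show ?thesis
  proof (rule eventually_sequentiallyI[of "max M (nat (- a))"])
    fix N assume N: "max M (nat (- a)) \<le> N"
    have "zshift i (\<lambda>a. product_wz r s A B v a b) a = 0" if "i \<ge> N" for i b
      using N that M by (auto simp: zshift_def product_wz_def vanishes_from_def is_field_zero[OF assms(2)])
    then show "Om_diff_wz k (product_wz r s A B v) a b = sgn_if (0 \<le> a) (scale ((- 1) ^ k) (Om_diff_part k (\<lambda>b a. product_wz r s A B v a b) N b a))"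
      unfolding Om_diff_wz_def by (subst sum_supp_eq[of N]) (simp_all add: Om_shift_def)
  qed
qed

lemma local_pair_Om_diff:
  assumes "local_pair N (product_zw r A B v) (product_wz r s A B v)" "k < N" "is_field A" "is_field B"
  shows "local_pair N (Om_diff_zw k (product_zw r A B v)) (Om_diff_wz k (product_wz r s A B v))"
  by (rule local_pair_Om_zw[OF assms(1,2) Om_diff_zw_eventually[OF assms(3,4)] Om_diff_wz_eventually[OF assms(3,4)]])

lemma choose_sym: "((k + i) choose i) = ((k + i) choose k)"
  by (subst binomial_symmetric) simp_all

lemma reindex_binomial:
  fixes g :: "nat \<Rightarrow> nat \<Rightarrow> 'v"
  assumes "N \<ge> k"
  shows "(\<Sum>m<N. scale (c * of_nat (m choose k)) (g m (m - k))) = scale c (\<Sum>i<N - k. scale (of_nat ((k + i) choose i)) (g (k + i) i))"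
proof -
  have "(\<Sum>m<N. scale (c * of_nat (m choose k)) (g m (m - k))) = (\<Sum>m\<in>(+) k ` {..<N - k}. scale (c * of_nat (m choose k)) (g m (m - k)))"
  proof (rule sum.mono_neutral_right)
    show "(+) k ` {..<N - k} \<subseteq> {..<N}" using assms by auto
    show "\<forall>m\<in>{..<N} - (+) k ` {..<N - k}. scale (c * of_nat (m choose k)) (g m (m - k)) = 0"
    proof
      fix m assume m: "m \<in> {..<N} - (+) k ` {..<N - k}"
      have "m < k"
      proof (rule ccontr)
        assume "\<not> m < k"
        then have "m = k + (m - k)" "m - k \<in> {..<N - k}" using m by auto
        with m show False by blast
      qed
      then show "scale (c * of_nat (m choose k)) (g m (m - k)) = 0" by (simp add: binomial_eq_0)
    qed
  qed simp
  also have "\<dots> = scale c (\<Sum>i<N - k. scale (of_nat ((k + i) choose i)) (g (k + i) i))"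
    by (subst sum.reindex) (simp_all add: scale_sum_right choose_sym[of k] del: binomial_Suc_Suc)
  finally show ?thesis .
qed

lemma eventually_diff: "\<forall>\<^sub>F N in sequentially. P N \<Longrightarrow> \<forall>\<^sub>F N in sequentially. P (N - (k::nat))"
  unfolding eventually_sequentially by (metis add_le_imp_le_diff)

text \<open>One letter is peeled off the left factor. Its creation modes stay in front; its annihilation
  modes are moved to the vector, and the contractions with y that arise on the way are collected in
  the last sum.\<close>

lemma local_zw_step:
  assumes A: "is_field A" and M: "\<forall>m\<ge>M. an X m v = 0"
  shows "\<forall>\<^sub>F N in sequentially. product_zw (odd_l X \<noteq> r) (nprod X r A) (wfield y) v a b =
    sgn_if (odd_l X \<and> ((0 \<le> a) \<noteq> (0 \<le> b))) (\<Sum>n<N. cr X n (zshift n (\<lambda>a. product_zw r A (wfield y) v a b) a)) +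
    sgn_if (\<not> odd_l X \<and> (r \<noteq> w_odd y)) (\<Sum>m<M. sgn_if (0 \<le> b) (Om_shift m (\<lambda>a. product_zw r A (wfield y) (an X m v) a b) a)) +
    sgn_if (r \<and> \<not> odd_l X) (\<Sum>(c, k, u)\<leftarrow>contractions X y. scale c (Om_diff_zw k (product_zw r A (wfield u) v) a b))"
proof -
  define x s D where "x = odd_l X" and "s = w_odd y" and "D = contractions X y"
  have Z: "\<forall>\<^sub>F N in sequentially. \<forall>(c, k, u)\<in>set D. Om_diff_zw k (product_zw r A (wfield u) v) a b =
     sgn_if (0 \<le> b) (Om_diff_part k (product_zw r A (wfield u) v) (N - k) a b)"
    by (rule eventually_ball_finite) (auto intro!: eventually_diff[OF Om_diff_zw_eventually[OF A is_field_wfield]])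
  have K: "\<forall>\<^sub>F N in sequentially. \<forall>(c, k, u)\<in>set D. k \<le> N"
    by (rule eventually_ball_finite) (auto simp: eventually_ge_at_top)
  show ?thesis
    using nprod_eventually[OF A, of X r a "wfield y b v"] Z K eventually_ge_at_top[of M]
    unfolding x_def[symmetric] s_def[symmetric] D_def[symmetric]
  proof eventually_elim
    case (elim N)
    \<comment> \<open>P and Q are the creation and annihilation parts of X acting on the other fields, and W collects the
      contractions. Every term is one of them up to a sign, and the last step compares the signs.\<close>
    define P where "P = (\<Sum>n<N. cr X n (zshift_at n A a (wfield y b v)))"
    define Q where "Q = (\<Sum>m<M. Om_shift_at m A a (wfield y b (an X m v)))"
    define W where "W = (\<Sum>(c, k, u)\<leftarrow>D. scale c (\<Sum>i<N - k. scale (of_nat ((k + i) choose i)) (Om_shift_at (k + i) A a (zshift_at i (wfield u) b v))))"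
    have om: "Om_shift_at m A a (sum_list vs) = (\<Sum>v\<leftarrow>vs. Om_shift_at m A a v)" for m and vs :: "'v list"
      by (induction vs) (simp_all add: at_simps[OF A])
    have Q: "(\<Sum>m<N. Om_shift_at m A a (wfield y b (an X m v))) = Q"
      unfolding Q_def by (rule sum_stable) (use M elim in \<open>simp_all add: is_field_zero[OF is_field_wfield] at_simps[OF A]\<close>)
    have W: "(\<Sum>m<N. \<Sum>(c, k, u)\<leftarrow>D. scale (c * of_nat (m choose k)) (Om_shift_at m A a (zshift_at (m - k) (wfield u) b v))) = W"
      unfolding W_def case_prod_unfold sum_list_swap
      by (intro arg_cong[where f = sum_list] map_cong refl reindex_binomial) (use elim(3) in auto)
    have 1: "(\<Sum>m<N. Om_shift_at m A a (an X m (wfield y b v))) = sgn_if (\<not> x \<and> s \<noteq> (0 \<le> b)) Q + sgn_if (\<not> x \<and> 0 \<le> b) W"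
      unfolding W[symmetric] Q[symmetric]
      by (simp add: an_wfield x_def s_def D_def at_simps[OF A] sum.distrib sgn_if_sum om comp_def case_prod_unfold)
    have 2: "(\<Sum>n<N. cr X n (zshift n (\<lambda>a. product_zw r A (wfield y) v a b) a)) = sgn_if (0 \<le> b \<and> r) P"
      unfolding P_def sgn_if_sum by (intro sum.cong refl) (simp add: product_zw_def zshift_def cr_rules)
    have 3: "(\<Sum>m<M. sgn_if (0 \<le> b) (Om_shift m (\<lambda>a. product_zw r A (wfield y) (an X m v) a b) a)) = sgn_if (0 \<le> b) (sgn_if (0 \<le> b \<and> r) Q)"
      unfolding Q_def sgn_if_sum by (intro sum.cong refl) (simp add: product_zw_def Om_shift_def)
    have 4: "(\<Sum>(c, k, u)\<leftarrow>D. scale c (Om_diff_zw k (product_zw r A (wfield u) v) a b)) = sgn_if (0 \<le> b) (sgn_if (0 \<le> b \<and> r) W)"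
    proof -
      have "Om_shift m (\<lambda>a. zshift i (\<lambda>b. product_zw r A (wfield u) v a b) b) a = sgn_if (0 \<le> b \<and> r) (Om_shift_at m A a (zshift_at i (wfield u) b v))" for m i u
        by (auto simp: Om_shift_def zshift_def product_zw_def is_field_zero[OF A] sgn_if_def)
      moreover have "Om_diff_zw k (product_zw r A (wfield u) v) a b = sgn_if (0 \<le> b) (Om_diff_part k (product_zw r A (wfield u) v) (N - k) a b)"
        if "(c, k, u) \<in> set D" for c k u using elim(2) that by blast
      ultimately have "scale c (Om_diff_zw k (product_zw r A (wfield u) v) a b) = sgn_if (0 \<le> b) (sgn_if (0 \<le> b \<and> r) (scale c
         (\<Sum>i<N - k. scale (of_nat ((k + i) choose i)) (Om_shift_at (k + i) A a (zshift_at i (wfield u) b v)))))" if "(c, k, u) \<in> set D" for c k u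
        using that by (simp add: scale_sgn_if sgn_if_sum scale_sum_right)
      then show ?thesis
        unfolding W_def sum_list_sgn_if case_prod_unfold
        by (intro arg_cong[where f = sum_list] map_cong refl) auto
    qed
    show ?case
      unfolding 2 3 4 unfolding product_zw_def elim(1) x_def[symmetric] 1 P_def[symmetric]
      by (cases x; cases r; cases s; cases "0 \<le> a"; cases "0 \<le> b") simp_all
  qed
qed

text \<open>The same sum in the opposite order. Here the annihilation modes of X already stand next to the
  vector, and it is the creation modes that have to be moved past the other field. Their
  contractions produce the expansion of the same multiples of \<open>Omega_(z-w)^k\<close> in the other domain.\<close>

lemma local_wz_step:
  assumes A: "is_field A" and M: "\<forall>m\<ge>M. an X m v = 0"
  shows "\<forall>\<^sub>F N in sequentially. product_wz (odd_l X \<noteq> r) (w_odd y) (nprod X r A) (wfield y) v a b =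
    sgn_if (odd_l X \<and> ((0 \<le> a) \<noteq> (0 \<le> b))) (\<Sum>n<N. cr X n (zshift n (\<lambda>a. product_wz r (w_odd y) A (wfield y) v a b) a)) +
    sgn_if (\<not> odd_l X \<and> (r \<noteq> w_odd y)) (\<Sum>m<M. Om_shift m (\<lambda>a. product_wz r (w_odd y) A (wfield y) (an X m v) a b) a) +
    sgn_if (r \<and> \<not> odd_l X) (\<Sum>(c, k, u)\<leftarrow>contractions X y. scale c (Om_diff_wz k (product_wz r (w_odd u) A (wfield u) v) a b))"
proof -
  define x s D where "x = odd_l X" and "s = w_odd y" and "D = contractions X y"
  have Z: "\<forall>\<^sub>F N in sequentially. \<forall>(c, k, u)\<in>set D. Om_diff_wz k (product_wz r (w_odd u) A (wfield u) v) a b =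
     sgn_if (0 \<le> a) (scale ((- 1) ^ k) (Om_diff_part k (\<lambda>b a. product_wz r (w_odd u) A (wfield u) v a b) N b a))"
    by (rule eventually_ball_finite) (auto intro!: Om_diff_wz_eventually[OF A is_field_wfield])
  show ?thesis
    using nprod_eventually[OF A, of X r a v] Z eventually_ge_at_top[of M]
    unfolding x_def[symmetric] s_def[symmetric] D_def[symmetric]
  proof eventually_elim
    case (elim N)
    note yl = linear_rules[OF is_field_linear[OF is_field_wfield[of y]]]
    \<comment> \<open>The same three sums with the factors in the opposite order.\<close>
    define P where "P = (\<Sum>n<N. cr X n (wfield y b (zshift_at n A a v)))"
    define Q where "Q = (\<Sum>m<M. wfield y b (Om_shift_at m A a (an X m v)))"
    define W where "W = (\<Sum>(c, k, u)\<leftarrow>D. scale c (scale ((- 1) ^ k) (\<Sum>i<N. scale (of_nat ((k + i) choose i)) (Om_shift_at (k + i) (wfield u) b (zshift_at i A a v)))))"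
    have Q: "(\<Sum>m<N. wfield y b (Om_shift_at m A a (an X m v))) = Q"
      unfolding Q_def by (rule sum_stable) (use M elim in \<open>simp_all add: is_field_zero[OF is_field_wfield] at_simps[OF A]\<close>)
    have W: "(\<Sum>n<N. \<Sum>(c, k, u)\<leftarrow>D. scale (c * (- 1) ^ k * of_nat ((k + n) choose k)) (Om_shift_at (k + n) (wfield u) b (zshift_at n A a v))) = W"
      unfolding W_def case_prod_unfold sum_list_swap
      by (simp add: scale_sum_right mult.assoc choose_sym[of "fst _"] del: binomial_Suc_Suc)
    have "wfield y b (cr X n u) = sgn_if (x \<and> s \<noteq> (0 \<le> b)) (cr X n (wfield y b u)) + sgn_if (x \<and> s \<noteq> (0 \<le> b)) (sgn_if (x \<and> 0 \<le> b)
        (\<Sum>(c, k, w)\<leftarrow>D. scale (c * (- 1) ^ k * of_nat ((k + n) choose k)) (Om_shift_at (k + n) (wfield w) b u)))" for n u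
      by (subst cr_wfield) (simp add: x_def s_def D_def sgn_if_def)
    then have 1: "(\<Sum>n<N. wfield y b (cr X n (zshift_at n A a v))) = sgn_if (x \<and> s \<noteq> (0 \<le> b)) P + sgn_if (x \<and> s \<noteq> (0 \<le> b)) (sgn_if (x \<and> 0 \<le> b) W)"
      unfolding W[symmetric] P_def by (simp add: sum.distrib sgn_if_sum)
    have 2: "(\<Sum>n<N. cr X n (zshift n (\<lambda>a. product_wz r s A (wfield y) v a b) a)) = sgn_if (r \<and> s) (sgn_if (0 \<le> a \<and> s) P)"
      unfolding P_def sgn_if_sum by (intro sum.cong refl) (auto simp: product_wz_def zshift_def cr_rules yl sgn_if_def)
    have 3: "(\<Sum>m<M. Om_shift m (\<lambda>a. product_wz r s A (wfield y) (an X m v) a b) a) = sgn_if (r \<and> s) Q"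
      unfolding Q_def sgn_if_sum by (intro sum.cong refl) (simp add: product_wz_def Om_shift_def yl)
    have 5: "Q = 0" if "\<not> 0 \<le> a" using that by (simp add: Q_def Om_shift_def yl)
    have 4: "(\<Sum>(c, k, u)\<leftarrow>D. scale c (Om_diff_wz k (product_wz r (w_odd u) A (wfield u) v) a b)) = sgn_if (0 \<le> a) (sgn_if (r \<and> (s = x)) (sgn_if (0 \<le> a \<and> (s = x)) W))"
    proof -
      have "Om_shift m (\<lambda>b. zshift i (\<lambda>a. product_wz r (w_odd u) A (wfield u) v a b) a) b = sgn_if (r \<and> w_odd u) (sgn_if (0 \<le> a \<and> w_odd u) (Om_shift_at m (wfield u) b (zshift_at i A a v)))" for m i u
        by (auto simp: Om_shift_def zshift_def product_wz_def is_field_zero[OF is_field_wfield] sgn_if_def)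
      moreover have "Om_diff_wz k (product_wz r (w_odd u) A (wfield u) v) a b =
          sgn_if (0 \<le> a) (scale ((- 1) ^ k) (Om_diff_part k (\<lambda>b a. product_wz r (w_odd u) A (wfield u) v a b) N b a))"
        if "(c, k, u) \<in> set D" for c k u using elim(2) that by blast
      ultimately have z: "scale c (Om_diff_wz k (product_wz r (w_odd u) A (wfield u) v) a b) = sgn_if (0 \<le> a) (sgn_if (r \<and> w_odd u) (sgn_if (0 \<le> a \<and> w_odd u) (scale c
         (scale ((- 1) ^ k) (\<Sum>i<N. scale (of_nat ((k + i) choose i)) (Om_shift_at (k + i) (wfield u) b (zshift_at i A a v)))))))" if "(c, k, u) \<in> set D" for c k u
        using that by (simp add: scale_sgn_if sgn_if_sum scale_sum_right)
      have "w_odd u = (s = x)" if "(c, k, u) \<in> set D" for c k u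
        using that w_odd_contractions[of c k u X y] unfolding s_def x_def D_def by blast
      then have "scale c (Om_diff_wz k (product_wz r (w_odd u) A (wfield u) v) a b) = sgn_if (0 \<le> a) (sgn_if (r \<and> (s = x)) (sgn_if (0 \<le> a \<and> (s = x)) (scale c
         (scale ((- 1) ^ k) (\<Sum>i<N. scale (of_nat ((k + i) choose i)) (Om_shift_at (k + i) (wfield u) b (zshift_at i A a v)))))))" if "(c, k, u) \<in> set D" for c k u
        using z[OF that] that by (simp only: refl)
      then show ?thesis
        unfolding W_def sum_list_sgn_if case_prod_unfold
        by (intro arg_cong[where f = sum_list] map_cong refl) auto
    qed
    show ?case
      unfolding 2 3 4 unfolding product_wz_def elim(1) x_def[symmetric] yl 1 Q
      by (cases x; cases r; cases s; cases "0 \<le> a"; cases "0 \<le> b") (simp_all add: 5)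
  qed
qed

text \<open>Induction on the letters of x, with y arbitrary because contractions shorten it. The words u of
  the finitely many contractions determine the bound of the pole order.\<close>

lemma word_fields_local: "\<exists>N. \<forall>v. local_pair N (product_zw (w_odd x) (wfield x) (wfield y) v) (product_wz (w_odd x) (w_odd y) (wfield x) (wfield y) v)"
proof (induction x arbitrary: y)
  case Nil
  have "local_pair 0 (product_zw (w_odd []) (wfield []) (wfield y) v) (product_wz (w_odd []) (w_odd y) (wfield []) (wfield y) v)" for v
  proof -
    obtain M where M: "vanishes_from (\<lambda>p. wfield y p v) M" using is_field_vanishes[OF is_field_wfield] by blast
    \<comment> \<open>\<open>B(w) v\<close> does not depend on z. G is its regular part, and each of its finitely many singular
      terms is a constant vector multiplied by \<open>Omega_w^n\<close>.\<close>
    define G where "G i j = (if i = 0 then wfield y (- int j - 1) v else 0)" for i j :: nat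
    define E where "E w a b = (if a < 0 \<and> b < 0 then if nat (- a - 1) = 0 \<and> nat (- b - 1) = 0 then w else 0 else 0)" for w :: 'v and a b :: int
    have E: "local_pair 0 (E w) (E w)" for w
      unfolding E_def using local_pair_reg[of 0 "\<lambda>i j. if i = 0 \<and> j = 0 then w else 0"] .
    have "local_pair 0 (\<lambda>a b. (if a < 0 \<and> b < 0 then G (nat (- a - 1)) (nat (- b - 1)) else 0) + (\<Sum>n<M. Om_shift n (\<lambda>b. E (wfield y (int n) v) a b) b))
      (\<lambda>a b. (if a < 0 \<and> b < 0 then G (nat (- a - 1)) (nat (- b - 1)) else 0) + (\<Sum>n<M. sgn_if (0 \<le> a) (Om_shift n (\<lambda>b. E (wfield y (int n) v) a b) b)))"
      by (intro local_pair_add local_pair_reg local_pair_sum local_pair_Om_w E)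
    moreover have "Om_shift n (\<lambda>b. E w a b) b = (if a = - 1 \<and> b = int n then w else 0)" for n w a b
      by (auto simp: Om_shift_def E_def)
    moreover have "(if a < 0 \<and> b < 0 then G (nat (- a - 1)) (nat (- b - 1)) else 0) + (\<Sum>n<M. if a = - 1 \<and> b = int n then wfield y (int n) v else 0)
      = id_field a (wfield y b v)" for a b
    proof (cases "a = - 1 \<and> 0 \<le> b")
      case True
      then have "(a = - 1 \<and> b = int n) = (n = nat b)" for n by auto
      with True M show ?thesis by (auto simp: id_field_def sum.delta vanishes_from_def)
    next
      case False
      then show ?thesis by (auto simp: id_field_def G_def intro!: sum.neutral)
    qed
    moreover have "sgn_if (0 \<le> a) (if a = - 1 \<and> b = int n then w else 0) = (if a = - 1 \<and> b = int n then w else 0)" for a b :: int and n and w :: 'v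
      by (cases "a = - 1") simp_all
    moreover have "product_zw False id_field (wfield y) v = (\<lambda>a b. id_field a (wfield y b v))"
      "product_wz False (w_odd y) id_field (wfield y) v = (\<lambda>a b. id_field a (wfield y b v))"
      by (auto simp: product_zw_def product_wz_def id_field_def is_field_zero[OF is_field_wfield] fun_eq_iff)
    ultimately show ?thesis by simp
  qed
  then show ?case by blast
next
  case (Cons X x)
  obtain N1 where N1: "\<And>v. local_pair N1 (product_zw (w_odd x) (wfield x) (wfield y) v) (product_wz (w_odd x) (w_odd y) (wfield x) (wfield y) v)"
    using Cons by blast
  have "\<forall>u. \<exists>N. \<forall>v. local_pair N (product_zw (w_odd x) (wfield x) (wfield u) v) (product_wz (w_odd x) (w_odd u) (wfield x) (wfield u) v)"
    using Cons by blast
  then obtain N2 where N2: "\<And>u v. local_pair (N2 u) (product_zw (w_odd x) (wfield x) (wfield u) v) (product_wz (w_odd x) (w_odd u) (wfield x) (wfield u) v)"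
    by metis
  have "\<forall>\<^sub>F N in sequentially. \<forall>(c, k, u)\<in>set (contractions X y). k < N \<and> N2 u \<le> N"
    by (rule eventually_ball_finite) (auto simp: eventually_conj_iff eventually_gt_at_top eventually_ge_at_top)
  then obtain N where N: "N1 \<le> N" "\<And>c k u. (c, k, u) \<in> set (contractions X y) \<Longrightarrow> k < N \<and> N2 u \<le> N"
    using eventually_happens'[OF sequentially_bot, OF eventually_conj[OF eventually_ge_at_top[of N1]]]
    by (metis (no_types, lifting) case_prodD)
  have "local_pair N (product_zw (w_odd (X # x)) (wfield (X # x)) (wfield y) v) (product_wz (w_odd (X # x)) (w_odd y) (wfield (X # x)) (wfield y) v)" for v
  proof -
    define r s where "r = w_odd x" and "s = w_odd y"
    let ?S = "product_zw (odd_l X \<noteq> r) (nprod X r (wfield x)) (wfield y) v" and ?S' = "product_wz (odd_l X \<noteq> r) s (nprod X r (wfield x)) (wfield y) v"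
    obtain M where M: "\<forall>m\<ge>M. an X m v = 0" using an_bnd by blast
    define S2 where "S2 a b = sgn_if (\<not> odd_l X \<and> (r \<noteq> s)) (\<Sum>m<M. sgn_if (0 \<le> b) (Om_shift m (\<lambda>a. product_zw r (wfield x) (wfield y) (an X m v) a b) a))" for a b
    define S2' where "S2' a b = sgn_if (\<not> odd_l X \<and> (r \<noteq> s)) (\<Sum>m<M. Om_shift m (\<lambda>a. product_wz r s (wfield x) (wfield y) (an X m v) a b) a)" for a b
    define S3 where "S3 a b = sgn_if (r \<and> \<not> odd_l X) (\<Sum>(c, k, u)\<leftarrow>contractions X y. scale c (Om_diff_zw k (product_zw r (wfield x) (wfield u) v) a b))" for a b
    define S3' where "S3' a b = sgn_if (r \<and> \<not> odd_l X) (\<Sum>(c, k, u)\<leftarrow>contractions X y. scale c (Om_diff_wz k (product_wz r (w_odd u) (wfield x) (wfield u) v) a b))" for a b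
    have 2: "local_pair N S2 S2'"
      unfolding S2_def S2'_def r_def s_def by (intro local_pair_sgn_if local_pair_sum local_pair_Om_z local_pair_mono[OF N1 N(1)])
    have 3: "local_pair N S3 S3'"
      unfolding S3_def S3'_def case_prod_unfold
      by (intro local_pair_sgn_if local_pair_sum_list local_pair_scale local_pair_Om_diff is_field_wfield, unfold r_def) (use N(2) local_pair_mono[OF N2] in fastforce)+
    define e where "e a b \<longleftrightarrow> odd_l X \<and> ((0 \<le> a) \<noteq> (0 \<le> b))" for a b :: int
    \<comment> \<open>What remains is the creation part of X, a series in z. The sign e comes from moving the odd
      modes \<open>X_n\<close> past the \<open>Omega\<close>'s, and it depends only on the parity of their number.\<close>
    have 1: "local_pair N (\<lambda>a b. sgn_if (e a b) (?S a b - S2 a b - S3 a b)) (\<lambda>a b. sgn_if (e a b) (?S' a b - S2' a b - S3' a b))"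
    proof (rule local_pair_series[OF local_pair_mono[OF N1[of v] N(1)] cr_linear[of X]])
      show "\<forall>\<^sub>F N in sequentially. sgn_if (e a b) (?S a b - S2 a b - S3 a b) = (\<Sum>n<N. cr X n (zshift n (\<lambda>a. product_zw (w_odd x) (wfield x) (wfield y) v a b) a))" for a b
        using local_zw_step[OF is_field_wfield M, of r x y a b] unfolding S2_def S3_def s_def e_def
        by eventually_elim (simp add: r_def sgn_if_sgn_if)
      show "\<forall>\<^sub>F N in sequentially. sgn_if (e a b) (?S' a b - S2' a b - S3' a b) = (\<Sum>n<N. cr X n (zshift n (\<lambda>a. product_wz (w_odd x) (w_odd y) (wfield x) (wfield y) v a b) a))" for a b
        using local_wz_step[OF is_field_wfield M, of r y x a b] unfolding S2'_def S3'_def s_def e_def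
        by eventually_elim (simp add: r_def sgn_if_sgn_if)
    qed
    have "local_pair N (\<lambda>a b. sgn_if (e a b) (sgn_if (e a b) (?S a b - S2 a b - S3 a b)) + S2 a b + S3 a b)
      (\<lambda>a b. sgn_if (e a b) (sgn_if (e a b) (?S' a b - S2' a b - S3' a b)) + S2' a b + S3' a b)"
      by (intro local_pair_add 2 3) (use local_pair_parity[OF 1, of "odd_l X"] in \<open>simp add: e_def\<close>)
    then show ?thesis by (simp add: sgn_if_sgn_if r_def s_def)
  qed
  then show ?case by blast
qed

lemma mutually_localI:
  assumes "\<And>v. local_pair N (product_zw (odd r) A B v) (product_wz (odd r) (odd s) A B v)"
  shows "mutually_local scale r s A B"
  unfolding mutually_local_def
proof (intro exI[of _ N] allI impI)
  fix v \<phi> assume l: "Vector_Spaces.linear scale (*) \<phi>"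
  then interpret \<phi>: functional scale \<phi> by (rule functionalI)
  obtain U where U: "\<forall>u\<in>U. \<forall>k\<ge>N. (Pzw, k) \<notin> set u" "local_with U (product_zw (odd r) A B v) (product_wz (odd r) (odd s) A B v)"
    using assms unfolding local_pair_def by blast
  from U(2) l obtain F where F: "\<And>a b. coeff2 (comb_zw U F) b a = \<phi> (product_zw (odd r) A B v a b)" "\<And>a b. coeff2 (comb_wz U F) a b = \<phi> (product_wz (odd r) (odd s) A B v a b)"
    unfolding local_with_def by meson
  show "\<exists>f. kzw_pole_le N f \<and>
     (\<forall>m n. rav_nth (rav_nth (expand_zw f) n) m = (if 0 \<le> n \<and> odd r then - 1 else 1) * \<phi> (A m (B n v))) \<and>
     (\<forall>m n. rav_nth (rav_nth (expand_wz f) m) n = koszul_sign r s * (if 0 \<le> m \<and> odd s then - 1 else 1) * \<phi> (B n (A m v)))"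
  proof (intro exI[of _ "abs_kzw (kzw_comb U F)"] conjI allI)
    show "kzw_pole_le N (abs_kzw (kzw_comb U F))"
      by (rule kzw_comb_pole) (use U in \<open>auto simp: local_with_def\<close>)
  qed (use F in \<open>simp_all add: expand_zw.abs_eq expand_wz.abs_eq expand_kzw_comb coeff2_def product_zw_def product_wz_def \<phi>.sgn_if[of True, simplified] koszul_sign_def sgn_if_def\<close>)
qed

lemma product_zw_add: "product_zw r (\<lambda>m v. A m v + A' m v) B v = (\<lambda>a b. product_zw r A B v a b + product_zw r A' B v a b)"
  "product_zw r (\<lambda>m v. scale c (A m v)) B v = (\<lambda>a b. scale c (product_zw r A B v a b))"
  "is_field A \<Longrightarrow> product_zw r A (\<lambda>m v. B m v + B' m v) v = (\<lambda>a b. product_zw r A B v a b + product_zw r A B' v a b)"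
  "is_field A \<Longrightarrow> product_zw r A (\<lambda>m v. scale c (B m v)) v = (\<lambda>a b. scale c (product_zw r A B v a b))"
  by (auto simp: product_zw_def fun_eq_iff sgn_if_add scale_sgn_if linear_rules[OF is_field_linear])

lemma product_wz_add: "is_field B \<Longrightarrow> product_wz r s (\<lambda>m v. A m v + A' m v) B v = (\<lambda>a b. product_wz r s A B v a b + product_wz r s A' B v a b)"
  "is_field B \<Longrightarrow> product_wz r s (\<lambda>m v. scale c (A m v)) B v = (\<lambda>a b. scale c (product_wz r s A B v a b))"
  "product_wz r s A (\<lambda>m v. B m v + B' m v) v = (\<lambda>a b. product_wz r s A B v a b + product_wz r s A B' v a b)"
  "product_wz r s A (\<lambda>m v. scale c (B m v)) v = (\<lambda>a b. scale c (product_wz r s A B v a b))"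
  by (auto simp: product_wz_def fun_eq_iff sgn_if_add scale_sgn_if linear_rules[OF is_field_linear])

definition local_fields :: "bool \<Rightarrow> bool \<Rightarrow> 'v modes \<Rightarrow> 'v modes \<Rightarrow> bool" where
  "local_fields r s A B \<longleftrightarrow> (\<exists>N. \<forall>v. local_pair N (product_zw r A B v) (product_wz r s A B v))"

lemma local_fields_wfield: "local_fields (w_odd x) (w_odd y) (wfield x) (wfield y)"
  using word_fields_local[of x y] by (simp add: local_fields_def)

lemma is_field_zero_field: "is_field (\<lambda>m v. 0)"
  by (auto simp: is_field_def vanishes_from_def intro!: linear_intro)

lemma is_field_combine: "is_field A \<Longrightarrow> is_field B \<Longrightarrow> is_field (\<lambda>m v. scale c (A m v) + B m v)"
  unfolding is_field_def
proof (intro conjI allI; elim conjE)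
  fix p assume "\<forall>p. lin_op (A p)" "\<forall>p. lin_op (B p)"
  then show "lin_op (\<lambda>v. scale c (A p v) + B p v)"
    by (intro linear_intro) (simp_all add: linear_rules scale_right_distrib mult.commute)
next
  fix v assume "\<forall>v. Ex (vanishes_from (\<lambda>p. A p v))" "\<forall>v. Ex (vanishes_from (\<lambda>p. B p v))"
  then obtain M N where "vanishes_from (\<lambda>p. A p v) M" "vanishes_from (\<lambda>p. B p v) N" by blast
  then have "vanishes_from (\<lambda>p. scale c (A p v) + B p v) (max M N)" by (simp add: vanishes_from_def)
  then show "Ex (vanishes_from (\<lambda>p. scale c (A p v) + B p v))" by blast
qed

lemma local_fields_combine:
  assumes "local_fields r s A B" "local_fields r s A' B" "is_field B"
  shows "local_fields r s (\<lambda>m v. scale c (A m v) + A' m v) B"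
proof -
  obtain M N where "\<And>v. local_pair M (product_zw r A B v) (product_wz r s A B v)" "\<And>v. local_pair N (product_zw r A' B v) (product_wz r s A' B v)"
    using assms unfolding local_fields_def by blast
  then have 1: "\<And>v. local_pair (max M N) (product_zw r A B v) (product_wz r s A B v)" "\<And>v. local_pair (max M N) (product_zw r A' B v) (product_wz r s A' B v)"
    by (meson local_pair_mono max.cobounded1 max.cobounded2)+
  show ?thesis
    unfolding local_fields_def product_zw_add(1,2) product_wz_add(1,2)[OF assms(3)]
    by (intro exI[of _ "max M N"] allI local_pair_add local_pair_scale 1)
qed

lemma local_fields_combine':
  assumes "local_fields r s A B" "local_fields r s A B'" "is_field A"
  shows "local_fields r s A (\<lambda>m v. scale c (B m v) + B' m v)"
proof -
  obtain M N where "\<And>v. local_pair M (product_zw r A B v) (product_wz r s A B v)" "\<And>v. local_pair N (product_zw r A B' v) (product_wz r s A B' v)"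
    using assms unfolding local_fields_def by blast
  then have 1: "\<And>v. local_pair (max M N) (product_zw r A B v) (product_wz r s A B v)" "\<And>v. local_pair (max M N) (product_zw r A B' v) (product_wz r s A B' v)"
    by (meson local_pair_mono max.cobounded1 max.cobounded2)+
  show ?thesis
    unfolding local_fields_def product_zw_add(3,4)[OF assms(3)] product_wz_add(3,4)
    by (intro exI[of _ "max M N"] allI local_pair_add local_pair_scale 1)
qed

lemma local_fields_zero1: "is_field B \<Longrightarrow> local_fields r s (\<lambda>m v. 0) B"
  by (simp add: local_fields_def product_zw_def[abs_def] product_wz_def[abs_def] is_field_zero local_pair_zero)

lemma local_fields_zero2: "is_field A \<Longrightarrow> local_fields r s A (\<lambda>m v. 0)"
  by (simp add: local_fields_def product_zw_def[abs_def] product_wz_def[abs_def] is_field_zero local_pair_zero)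

lemma raviolo_field_iff: "raviolo_field scale A \<longleftrightarrow> is_field A"
proof -
  have "(\<exists>N::int. \<forall>m\<ge>N. A m v = 0) \<longleftrightarrow> Ex (vanishes_from (\<lambda>p. A p v))" for v
  proof
    assume "\<exists>N::int. \<forall>m\<ge>N. A m v = 0"
    then obtain N where "\<forall>m\<ge>N. A m v = 0" by blast
    then have "vanishes_from (\<lambda>p. A p v) (nat N)" by (auto simp: vanishes_from_def)
    then show "Ex (vanishes_from (\<lambda>p. A p v))" ..
  next
    assume "Ex (vanishes_from (\<lambda>p. A p v))"
    then show "\<exists>N::int. \<forall>m\<ge>N. A m v = 0" unfolding vanishes_from_def by blast
  qed
  then show ?thesis by (simp add: raviolo_field_def is_field_def)
qed

end

section \<open>The induced module\<close>

lemma u_inc_add: "u_inc (x + y) = u_inc x + u_inc y"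
  unfolding u_inc.abs_eq plus_uea.abs_eq uea.abs_eq_iff
  using ideal_gen[OF uea_relsI(1)[of x y]] by (simp add: diff_diff_eq)

lemma u_inc_scale: "u_inc (h_scale c x) = u_scal c * u_inc x"
  unfolding u_inc.abs_eq u_scal.abs_eq times_uea.abs_eq uea.abs_eq_iff
  by (rule ideal_gen[OF uea_relsI(2)])

lemma u_inc_commutes:
  assumes "x \<in> h_deg r" "y \<in> h_deg s"
  shows "u_inc x * u_inc y = u_scal (koszul_sign r s) * (u_inc y * u_inc x) + u_inc (h_bracket x y)"
  unfolding u_inc.abs_eq u_scal.abs_eq times_uea.abs_eq plus_uea.abs_eq uea.abs_eq_iff
  using ideal_gen[OF uea_relsI(3)[OF assms]] by (simp add: mult.assoc diff_diff_eq)

lemma u_scal_hom: "u_scal 0 = 0" "u_scal 1 = 1" "u_scal (c + d) = u_scal c + u_scal d" "u_scal (c * d) = u_scal c * u_scal d"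
proof -
  have 1: "fscal (1 :: complex) = (1 :: (hhat, complex) free_alg)"
    using single_one[where 'a = "hhat list" and 'b = complex] by (simp add: fscal_def zero_list_def del: single_one)
  show "u_scal 0 = 0" "u_scal 1 = 1" "u_scal (c + d) = u_scal c + u_scal d" "u_scal (c * d) = u_scal c * u_scal d"
    by (simp_all only: u_scal.abs_eq zero_uea_def one_uea_def plus_uea.abs_eq times_uea.abs_eq 1)
      (simp_all add: fscal_def single_add mult_single plus_list_def)
qed

interpretation ucan: free_hom_ring u_scal u_inc
  by unfold_locales (rule u_scal_hom u_scal_central)+

lemma uea_surj: "\<exists>p. u = feval u_scal u_inc p"
proof -
  have "feval u_scal u_inc p = abs_uea p" for p
  proof (induction p rule: pm_induct)
    case zero
    then show ?case by (simp add: ucan.feval_zero zero_uea_def)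
  next
    case (add p q)
    then show ?case by (simp add: ucan.feval_add plus_uea.abs_eq)
  next
    case (single w c)
    have "abs_uea (Poly_Mapping.single w c) = u_scal c * prod_list (map u_inc w)"
    proof (induction w arbitrary: c)
      case Nil
      then show ?case by (simp add: u_scal.abs_eq fscal_def)
    next
      case (Cons x w)
      have "Poly_Mapping.single (x # w) c = fscal c * fgen x * Poly_Mapping.single w 1"
        by (simp add: fscal_def fgen_def mult_single plus_list_def)
      then show ?case using Cons[of 1]
        by (simp add: times_uea.abs_eq[symmetric] u_scal.abs_eq[symmetric] u_inc.abs_eq[symmetric] u_scal_hom mult.assoc)
    qed
    then show ?case by (simp add: ucan.feval_single)
  qed
  then show ?thesis by (induction u rule: uea.abs_induct) metis
qed

interpretation heis: complex_space heis_scale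
proof unfold_locales
  show "heis_scale a (x + y) = heis_scale a x + heis_scale a y" for a x y
    by transfer (simp add: pm.scale_right_distrib pm.span_zero)
  show "heis_scale (a + b) x = heis_scale a x + heis_scale b x" for a b x
    by transfer (simp add: pm.scale_left_distrib pm.span_zero)
  show "heis_scale a (heis_scale b x) = heis_scale (a * b) x" for a b x
    by transfer (simp add: pm.span_zero)
  show "heis_scale 1 x = x" for x
    by transfer (simp add: pm.span_zero)
qed

lemma tensor_eq:
  "heis_tensor (u + v) t = heis_tensor u t + heis_tensor v t"
  "heis_tensor (u_scal c * u) t = heis_scale c (heis_tensor u t)"
  "heis_tensor u (c * t) = heis_scale c (heis_tensor u t)"
  "x \<in> h_nonneg \<Longrightarrow> heis_tensor (u * u_inc x) t = heis_tensor u (h_char x * t)"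
proof -
  show "heis_tensor (u + v) t = heis_tensor u t + heis_tensor v t"
    by transfer (metis diff_diff_eq pm.span_base tensor_relsI(1))
  show "heis_tensor (u_scal c * u) t = heis_scale c (heis_tensor u t)"
    by transfer (rule pm.span_base[OF tensor_relsI(3)])
  show "heis_tensor u (c * t) = heis_scale c (heis_tensor u t)"
    by transfer (rule pm.span_base[OF tensor_relsI(4)])
  show "x \<in> h_nonneg \<Longrightarrow> heis_tensor (u * u_inc x) t = heis_tensor u (h_char x * t)"
    by transfer (rule pm.span_base[OF tensor_relsI(5)])
qed

text \<open>Scalars can be moved from the second factor to the first, and sums are then taken in the
  enveloping algebra.\<close>

lemma heis_surj: "\<exists>u. h = heis_tensor u 1"
proof -
  have "\<exists>u. abs_heis p = heis_tensor u 1" for p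
  proof (induction p rule: pm_induct)
    case zero
    have "abs_heis 0 = heis_tensor 0 1"
      using tensor_eq(1)[of 0 0 1] by (simp add: zero_heis.abs_eq)
    then show ?case by blast
  next
    case (add p q)
    then obtain u v where "abs_heis p = heis_tensor u 1" "abs_heis q = heis_tensor v 1" by blast
    then have "abs_heis (p + q) = heis_tensor (u + v) 1"
      by (simp add: plus_heis.abs_eq[symmetric] tensor_eq)
    then show ?case by blast
  next
    case (single k c)
    obtain u t where k: "k = (u, t)" by force
    have "Poly_Mapping.single k c = pm_scale c (basis (u, t))" by (simp add: k pm_scale_single)
    then have "abs_heis (Poly_Mapping.single k c) = heis_scale c (heis_tensor u (t * 1))"
      by (simp add: heis_scale.abs_eq heis_tensor.abs_eq)
    also have "\<dots> = heis_tensor (u_scal c * (u_scal t * u)) 1"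
      unfolding tensor_eq(2,3) by simp
    finally show ?case by blast
  qed
  then show ?thesis by (induction h rule: heis.abs_induct) blast
qed

lemma heis_vac_surj: "\<exists>u. h = heis_act u heis_vac"
  using heis_surj[of h] by (simp add: heis_vac_def heis_act_tensor)

lemma act_add_right: "heis_act u (h + h') = heis_act u h + heis_act u h'"
  by transfer (simp add: pm_push_add pm.span_zero)

lemma act_scale: "heis_act u (heis_scale c h) = heis_scale c (heis_act u h)"
  by transfer (simp add: pm_push_scale pm.span_zero)

lemma act_linear: "heis.lin_op (heis_act u)"
  by unfold_locales (simp_all add: act_add_right act_scale)

lemma act_mult: "heis_act (u * v) h = heis_act u (heis_act v h)"
  and act_add: "heis_act (u + v) h = heis_act u h + heis_act v h"
  and act_scal: "heis_act (u_scal c) h = heis_scale c h"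
  and act_one: "heis_act 1 h = h"
proof -
  obtain w where "h = heis_tensor w 1" using heis_surj by blast
  then show "heis_act (u * v) h = heis_act u (heis_act v h)"
    "heis_act (u + v) h = heis_act u h + heis_act v h"
    "heis_act (u_scal c) h = heis_scale c h"
    "heis_act 1 h = h"
    by (simp_all add: heis_act_tensor mult.assoc distrib_right tensor_eq)
qed

lemma trans_linear: "heis.lin_op heis_trans"
proof unfold_locales
  show "heis_trans (h + h') = heis_trans h + heis_trans h'" for h h'
    by transfer (simp add: pm_push_add pm.span_zero)
  show "heis_trans (heis_scale c h) = heis_scale c (heis_trans h)" for c h
    by transfer (simp add: pm_push_scale pm.span_zero)
qed

lemma trans_act: "heis_trans (heis_act u h) = heis_act (u_deriv u) h + heis_act u (heis_trans h)"
proof -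
  obtain w where "h = heis_tensor w 1" using heis_surj by blast
  then show ?thesis by (simp add: heis_act_tensor heis_trans_tensor u_deriv_mult tensor_eq)
qed

abbreviation h_act :: "hhat \<Rightarrow> heis \<Rightarrow> heis" where "h_act x \<equiv> heis_act (u_inc x)"

lemma h_act_simps:
  "h_act (x + y) h = h_act x h + h_act y h" "h_act (h_scale c x) h = heis_scale c (h_act x h)"
  "h_act 0 h = 0"
proof -
  show "h_act (x + y) h = h_act x h + h_act y h" "h_act (h_scale c x) h = heis_scale c (h_act x h)"
    by (simp_all add: u_inc_add u_inc_scale act_add act_mult act_scal)
  have "u_inc 0 = 0" using u_inc_add[of 0 0] by simp
  moreover have "heis_act 0 h = 0" using act_add[of 0 0 h] by simp
  ultimately show "h_act 0 h = 0" by simp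
qed

lemma h_act_vac: "x \<in> h_nonneg \<Longrightarrow> h_act x heis_vac = heis_scale (h_char x) heis_vac"
  using tensor_eq(4)[of x 1 1] by (simp add: heis_vac_def heis_act_tensor tensor_eq(3)[symmetric])

lemma trans_vac: "heis_trans heis_vac = 0"
proof -
  have "u_deriv 1 = 0" using u_deriv_scal[of 1] by (simp add: u_scal_hom)
  moreover have "heis_tensor 0 1 = 0" using tensor_eq(1)[of 0 0 1] by simp
  ultimately show ?thesis by (simp add: heis_vac_def heis_trans_tensor)
qed

lemma trans_h_act: "heis_trans (h_act x h) = h_act x (heis_trans h) + h_act (h_deriv x) h"
  by (simp add: trans_act u_deriv_inc)

text \<open>Homogeneous elements of which every element of the Lie algebra is a finite combination. Power
  series in u are kept whole, since they are infinite combinations of the \<open>c_n\<close> or \<open>phi_n\<close>.\<close>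

definition h_pure :: "hhat set" where
  "h_pure = range (\<lambda>f. (Rav f 0, 0, 0)) \<union> range (\<lambda>n. h_nu n) \<union> range (\<lambda>f. (0, Rav f 0, 0)) \<union> range (\<lambda>n. h_b n) \<union> {h_K}"

lemma sing_part:
  assumes W: "heis.subspace W" and nu: "\<And>n. h_act (F n) h \<in> W"
    and F: "\<And>c n. h_scale c (F n) = G (Poly_Mapping.single n c)" "\<And>p q. G (p + q) = G p + G q" "G 0 = 0"
  shows "h_act (G g) h \<in> W"
proof (induction g rule: pm_induct)
  case (single n c)
  then show ?case by (simp add: F(1)[symmetric] h_act_simps heis.subspace_scale[OF W] nu)
qed (simp_all add: F h_act_simps heis.subspace_0[OF W] heis.subspace_add[OF W])

lemma h_scale_basis: "h_scale c (h_nu n) = (Rav 0 (Poly_Mapping.single n c), 0, 0)"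
  "h_scale c (h_b n) = (0, Rav 0 (Poly_Mapping.single n c), 0)"
  "h_scale c h_K = (0, 0, c)"
proof -
  have "rav_const c * rav_Om n = Rav 0 (Poly_Mapping.single n c)"
  proof (rule rav_eqI)
    fix i
    have "Poly_Mapping.lookup (sing x) i = rav_nth x (int i)" for x :: "complex rav"
      by (simp add: rav_nth_def)
    then show "Poly_Mapping.lookup (sing (rav_const c * rav_Om n)) i = Poly_Mapping.lookup (sing (Rav 0 (Poly_Mapping.single n c))) i"
      by (simp only: rav_nth_const_mult) (simp add: rav_nth_def rav_Om_def pari_complex_def lookup_single when_def)
  qed (simp add: times_rav_def rav_const_def rav_Om_def)
  then show "h_scale c (h_nu n) = (Rav 0 (Poly_Mapping.single n c), 0, 0)"
    "h_scale c (h_b n) = (0, Rav 0 (Poly_Mapping.single n c), 0)"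
    "h_scale c h_K = (0, 0, c)"
    by (simp_all add: h_nu_def h_b_def h_K_def)
qed

lemma pure_closed:
  assumes W: "heis.subspace W" and p: "\<And>x. x \<in> h_pure \<Longrightarrow> h_act x h \<in> W"
  shows "h_act x h \<in> W"
proof -
  obtain k l t where x: "x = (k, l, t)" by (cases x)
  have dec: "x = (Rav (reg k) 0, 0, 0) + (Rav 0 (sing k), 0, 0) + (0, Rav (reg l) 0, 0) + (0, Rav 0 (sing l), 0) + h_scale t h_K"
    unfolding h_scale_basis x by (simp add: plus_rav_def zero_rav_def)
  have 1: "h_act (Rav 0 g, 0, 0) h \<in> W" for g
    by (rule sing_part[OF W, of h_nu h "\<lambda>g. (Rav 0 g, 0, 0)"])
      (auto simp: p h_pure_def h_scale_basis plus_rav_def zero_rav_def zero_prod_def)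
  have 2: "h_act (0, Rav 0 g, 0) h \<in> W" for g
    by (rule sing_part[OF W, of h_b h "\<lambda>g. (0, Rav 0 g, 0)"])
      (auto simp: p h_pure_def h_scale_basis plus_rav_def zero_rav_def zero_prod_def)
  show ?thesis
    by (subst dec, simp only: h_act_simps, intro heis.subspace_add[OF W] heis.subspace_scale[OF W] 1 2 p) (simp_all add: h_pure_def)
qed

text \<open>A subspace that contains the vacuum and is stable under the Lie algebra is everything.\<close>

lemma heis_induct:
  assumes W: "heis.subspace W" and vac: "heis_vac \<in> W" and p: "\<And>x h. x \<in> h_pure \<Longrightarrow> h \<in> W \<Longrightarrow> h_act x h \<in> W"
  shows "h \<in> W"
proof -
  have w: "heis_act (prod_list (map u_inc xs)) heis_vac \<in> W" for xs
  proof (induction xs)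
    case (Cons x xs)
    then show ?case by (simp add: act_mult) (rule pure_closed[OF W p])
  qed (simp add: act_one vac)
  obtain u where u: "h = heis_act u heis_vac" using heis_vac_surj by blast
  obtain q where q: "u = feval u_scal u_inc q" using uea_surj by blast
  have "heis_act 0 heis_vac = 0" using act_add[of 0 0 heis_vac] by simp
  then have "heis_act (feval u_scal u_inc q) heis_vac \<in> W"
    by (induction q rule: pm_induct)
      (simp_all add: ucan.feval_zero ucan.feval_add ucan.feval_single act_add act_mult act_scal w
        heis.subspace_0[OF W] heis.subspace_add[OF W] heis.subspace_scale[OF W])
  then show ?thesis by (simp add: u q)
qed

lemma deg_basis: "(Rav f 0, 0, 0) \<in> h_deg 0" "h_nu n \<in> h_deg 1" "(0, Rav f 0, 0) \<in> h_deg (- 1)" "h_b n \<in> h_deg 0" "h_K \<in> h_deg 0"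
  "h_c n \<in> h_deg 0" "h_phi n \<in> h_deg (- 1)"
  by (auto simp: h_deg_def h_nu_def h_b_def h_K_def rav_Om_def zero_rav_def h_c_def h_phi_def)

lemma h_act_commutes:
  assumes "x \<in> h_deg r" "y \<in> h_deg s"
  shows "h_act x (h_act y h) = heis_scale (koszul_sign r s) (h_act y (h_act x h)) + h_act (h_bracket x y) h"
  using arg_cong[OF u_inc_commutes[OF assms], of "\<lambda>u. heis_act u h"]
  by (simp add: act_mult act_add act_scal)

text \<open>K is central and acts by 1 on the vacuum.\<close>

lemma h_K_act: "h_act h_K h = h"
proof -
  have "h \<in> {h. h_act h_K h = h}"
  proof (rule heis_induct)
    show "heis.subspace {h. h_act h_K h = h}"
      by (rule heis.subspaceI) (auto simp: heis.linear_rules[OF act_linear])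
    have "h_K \<in> h_nonneg" by (simp add: h_nonneg_def h_K_def zero_rav_def)
    from h_act_vac[OF this] show "heis_vac \<in> {h. h_act h_K h = h}" by (simp add: h_K_def)
    fix x h assume "x \<in> h_pure" and h: "h \<in> {h. h_act h_K h = h}"
    then obtain r where "x \<in> h_deg r" using deg_basis unfolding h_pure_def by blast
    from h_act_commutes[OF deg_basis(5) this] h show "h_act x h \<in> {h. h_act h_K h = h}"
      by (simp add: h_bracket_basis_zero h_act_simps koszul_sign_def)
  qed
  then show ?thesis by simp
qed


section \<open>The modes as free fields\<close>

type_synonym letter = "bool \<times> nat"

text \<open>The truth value is the parity of the field: \<open>nu\<close>, with annihilation modes \<open>c_n\<close>, for \<open>True\<close>, and
  \<open>b\<close>, with annihilation modes \<open>phi_n\<close>, for \<open>False\<close>.\<close>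

definition cre :: "bool \<Rightarrow> nat \<Rightarrow> heis \<Rightarrow> heis" where
  "cre x n = h_act (if x then h_nu n else h_b n)"

definition ann :: "bool \<Rightarrow> nat \<Rightarrow> heis \<Rightarrow> heis" where
  "ann x n = h_act (if x then h_c n else h_phi n)"

lemma modes_linear: "heis.lin_op (cre x n)" "heis.lin_op (ann x n)"
  by (simp_all add: cre_def ann_def act_linear)

lemmas cre_rules = heis.linear_rules[OF modes_linear(1)] and ann_rules = heis.linear_rules[OF modes_linear(2)]

lemma h_bracket_zero: "h_bracket (h_b n) (h_nu m) = 0" "h_bracket (h_phi n) (h_c m) = 0" "h_bracket (h_b n) (h_phi m) = 0" "h_bracket (h_nu n) (h_c m) = 0"
  by (simp_all add: h_c_def h_b_def h_nu_def h_phi_def rav_Om_def zero_rav_def zero_prod_def du_pair_def[of _ 0] du_pair_def[of 0])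

lemma cre_commutes: "cre x n (cre y m h) = sgn_if (x \<and> y) (cre y m (cre x n h))"
  using h_act_commutes[OF deg_basis(2,2), of n m h] h_act_commutes[OF deg_basis(2,4), of n m h]
    h_act_commutes[OF deg_basis(4,2), of n m h] h_act_commutes[OF deg_basis(4,4), of n m h]
  by (auto simp: cre_def koszul_sign_def h_bracket_basis_zero h_bracket_zero h_act_simps)


lemma ann_cre: "ann x m (cre y n h) = sgn_if (\<not> x \<and> y) (cre y n (ann x m h)) +
   (if x \<noteq> y \<and> m = n + 1 then sgn_if x (heis_scale (of_nat m) h) else 0)"
  using h_act_commutes[OF deg_basis(6,2), of m n h] h_act_commutes[OF deg_basis(6,4), of m n h]
    h_act_commutes[OF deg_basis(7,2), of m n h] h_act_commutes[OF deg_basis(7,4), of m n h]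
  by (auto simp: cre_def ann_def koszul_sign_def h_bracket_basis h_bracket_basis_zero h_act_simps h_K_act heis.scale_minus_left simp del: of_nat_Suc)

lemma ann_commutes: "ann x m (ann y n h) = sgn_if (\<not> x \<and> \<not> y) (ann y n (ann x m h))"
  using h_act_commutes[OF deg_basis(6,6), of m n h] h_act_commutes[OF deg_basis(6,7), of m n h]
    h_act_commutes[OF deg_basis(7,6), of m n h] h_act_commutes[OF deg_basis(7,7), of m n h]
  by (auto simp: ann_def koszul_sign_def h_bracket_basis_zero h_bracket_zero h_act_simps)

fun mode_word :: "letter list \<Rightarrow> heis" where
  "mode_word [] = heis_vac" | "mode_word ((x, i) # w) = cre x i (mode_word w)"

lemma bracket_pure:
  "\<exists>c. h_bracket (Rav f 0, 0, 0) y = h_scale c h_K" "\<exists>c. h_bracket (0, Rav f 0, 0) y = h_scale c h_K"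
  by (cases y; simp add: h_scale_basis zero_prod_def)+

text \<open>Normal ordering: an element of \<open>h_nonneg\<close> is moved to the right through the creation modes. Each
  commutator is a scalar, and on the vacuum the element acts by its character.\<close>

lemma mode_word_span: "h \<in> heis.span (range mode_word)"
proof (rule heis_induct)
  let ?W = "heis.span (range mode_word)"
  have wv: "mode_word w \<in> ?W" for w by (rule heis.span_base) simp
  from wv[of "[]"] show vac: "heis_vac \<in> ?W" by simp
  have an: "h_act z (mode_word w) \<in> ?W" if z: "z \<in> h_deg r" "z \<in> h_nonneg" and b: "\<And>y. \<exists>c. h_bracket z y = h_scale c h_K" for z r w
  proof (induction w)
    case Nil
    show ?case using h_act_vac[OF z(2)] vac by (simp add: heis.span_scale)
  next
    case (Cons l w)
    obtain x i where l: "l = (x, i)" by force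
    define y where "y = (if x then h_nu i else h_b i)"
    have "\<exists>s. y \<in> h_deg s" using deg_basis unfolding y_def by metis
    then obtain s where s: "y \<in> h_deg s" by blast
    have c: "h \<in> ?W \<Longrightarrow> h_act y h \<in> ?W" for h
    proof (induction rule: heis.span_induct_alt)
      case (step c u v)
      then obtain w' where "u = mode_word w'" by blast
      then have "h_act y u = mode_word ((x, i) # w')" by (simp add: y_def cre_def)
      then have "h_act y u \<in> ?W" using wv by metis
      with step show ?case
        by (simp add: heis.linear_rules[OF act_linear] heis.span_add heis.span_scale)
    qed (simp add: heis.linear_rules[OF act_linear] heis.span_zero)
    obtain k where k: "h_bracket z y = h_scale k h_K" using b by blast
    have "h_act z (h_act y (mode_word w)) \<in> ?W"
      unfolding h_act_commutes[OF z(1) s] k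
      by (simp add: h_act_simps h_K_act) (intro heis.span_add heis.span_scale c Cons wv)
    then show ?case by (simp add: l cre_def y_def)
  qed
  have S: "h_act x h \<in> ?W" if "\<And>w. h_act x (mode_word w) \<in> ?W" "h \<in> ?W" for x h
    using that(2)
  proof (induction rule: heis.span_induct_alt)
    case (step c u v)
    then show ?case using that(1) by (auto simp: heis.linear_rules[OF act_linear] heis.span_add heis.span_scale)
  qed (simp add: heis.linear_rules[OF act_linear] heis.span_zero)
  have cr: "h_act (if x then h_nu i else h_b i) (mode_word w) \<in> ?W" for x i w
    using wv[of "(x, i) # w"] by (simp add: cre_def)
  fix x h assume x: "x \<in> h_pure" and h: "h \<in> ?W"
  have nn: "(Rav f 0, 0, 0) \<in> h_nonneg" "(0, Rav f 0, 0) \<in> h_nonneg" for f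
    by (simp_all add: h_nonneg_def zero_rav_def)
  from x consider f where "x = (Rav f 0, 0, 0)" | n where "x = h_nu n" | f where "x = (0, Rav f 0, 0)" | n where "x = h_b n" | "x = h_K"
    unfolding h_pure_def by blast
  then show "h_act x h \<in> ?W"
  proof cases
    case 1 then show ?thesis using S[OF an[OF deg_basis(1) nn(1) bracket_pure(1)] h] by simp
  next
    case 2 then show ?thesis using S[OF cr[of True n] h] by simp
  next
    case 3 then show ?thesis using S[OF an[OF deg_basis(3) nn(2) bracket_pure(2)] h] by simp
  next
    case 4 then show ?thesis using S[OF cr[of False n] h] by simp
  next
    case 5 then show ?thesis using h by (simp add: h_K_act)
  qed
qed (simp add: heis.subspace_span)

lemma ann_vac: "ann x n heis_vac = 0"
proof -
  have "h_c n \<in> h_nonneg" "h_phi n \<in> h_nonneg" by (auto simp: h_nonneg_def h_c_def h_phi_def zero_rav_def)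
  from this[THEN h_act_vac] show ?thesis by (auto simp: ann_def h_c_def h_phi_def)
qed

lemma ann_vanishes: "\<exists>N. \<forall>m\<ge>N. ann x m h = 0"
proof -
  have w: "\<exists>N. \<forall>m\<ge>N. ann x m (mode_word w) = 0" for w
  proof (induction w)
    case (Cons l w)
    obtain y i where l: "l = (y, i)" by force
    from Cons obtain N where "\<forall>m\<ge>N. ann x m (mode_word w) = 0" by blast
    then have "\<forall>m\<ge>max N (i + 2). ann x m (mode_word (l # w)) = 0" by (auto simp: l ann_cre cre_rules)
    then show ?case by blast
  qed (simp add: ann_vac)
  show ?thesis using mode_word_span[of h]
  proof (induction rule: heis.span_induct_alt)
    case (step c u v)
    then obtain M N where "\<forall>m\<ge>M. ann x m u = 0" "\<forall>m\<ge>N. ann x m v = 0" using w by blast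
    then have "\<forall>m\<ge>max M N. ann x m (heis_scale c u + v) = 0" by (simp add: ann_rules)
    then show ?case by blast
  qed (simp add: ann_rules)
qed

text \<open>The letter \<open>(x, i)\<close> is the divided derivative \<open>d^i / i!\<close> of \<open>b(z)\<close> or \<open>nu(z)\<close>. The binomial
  coefficients are those of \<open>z^(n+i)\<close> and \<open>Omega^(m-i)\<close>. In particular the constant term of the letter
  is the i-th creation mode.\<close>

definition l_cr :: "letter \<Rightarrow> nat \<Rightarrow> heis \<Rightarrow> heis" where
  "l_cr l n h = heis_scale (of_nat ((n + snd l) choose snd l)) (cre (fst l) (n + snd l) h)"

definition l_an :: "letter \<Rightarrow> nat \<Rightarrow> heis \<Rightarrow> heis" where
  "l_an l m h = heis_scale ((- 1) ^ snd l * of_nat (m choose snd l)) (ann (fst l) (m - snd l) h)"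

text \<open>Applying \<open>d_z^i / i!\<close> and \<open>d_w^j / j!\<close> to \<open>Omega_(z-w)^1\<close> gives this multiple of
  \<open>Omega_(z-w)^(i+j+1)\<close>.\<close>

definition l_ccoef :: "letter \<Rightarrow> letter \<Rightarrow> complex" where
  "l_ccoef l l' = (if fst l then - 1 else 1) * (- 1) ^ snd l * of_nat ((snd l + snd l' + 1) * ((snd l + snd l') choose snd l))"

definition l_cord :: "letter \<Rightarrow> letter \<Rightarrow> nat" where
  "l_cord l l' = snd l + snd l' + 1"

text \<open>Both sides are the multinomial coefficient \<open>(i + j + n + 1)! / (i! j! n!)\<close>.\<close>

lemma multinomial_identity:
  "of_nat ((i + j + n + 1) choose i) * of_nat ((n + j) choose j) * of_nat (n + j + 1) =
   (of_nat ((i + j + 1) * ((i + j) choose i)) * of_nat ((i + j + n + 1) choose (i + j + 1)) :: complex)"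
proof -
  have 1: "of_nat ((i + j + n + 1) choose i) = fact (i + j + n + 1) / (fact i * fact (n + j + 1) :: complex)"
    by (subst binomial_fact) (auto simp: algebra_simps)
  have 2: "of_nat ((n + j) choose j) = fact (n + j) / (fact j * fact n :: complex)"
    by (subst binomial_fact) (auto simp: algebra_simps)
  have 3: "of_nat ((i + j) choose i) = fact (i + j) / (fact i * fact j :: complex)"
    by (subst binomial_fact) (auto simp: algebra_simps)
  have 4: "of_nat ((i + j + n + 1) choose (i + j + 1)) = fact (i + j + n + 1) / (fact (i + j + 1) * fact n :: complex)"
    by (subst binomial_fact) (auto simp: algebra_simps)
  have 5: "fact (n + j + 1) = (of_nat (n + j + 1) * fact (n + j) :: complex)" "fact (i + j + 1) = (of_nat (i + j + 1) * fact (i + j) :: complex)"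
    by (simp_all add: algebra_simps)
  have 6: "of_nat (n + j + 1) \<noteq> (0::complex)" "of_nat (i + j + 1) \<noteq> (0::complex)" by (metis add_is_0 of_nat_eq_0_iff one_neq_zero)+
  show ?thesis
    unfolding of_nat_mult 1 2 3 4 5 using 6 by (simp add: field_simps del: of_nat_Suc of_nat_add fact_Suc)
qed

lemma binomial_swap: "(i + j) choose i = (j + i) choose (j::nat)"
  by (subst binomial_symmetric) (simp_all add: add.commute)

interpretation hf: free_fields heis_scale fst l_cr l_an l_ccoef l_cord
proof (intro free_fields.intro free_fields_axioms.intro heis.complex_space_axioms)
  fix l l' :: letter and n m :: nat and v :: heis
  show "heis.lin_op (l_cr l n)"
    by (rule heis.linear_intro) (simp_all add: l_cr_def cre_rules heis.scale_right_distrib mult.commute)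
  show "heis.lin_op (l_an l n)"
    by (rule heis.linear_intro) (simp_all add: l_an_def ann_rules heis.scale_right_distrib mult.commute)
  obtain N where N: "\<forall>m\<ge>N. ann (fst l) m v = 0" using ann_vanishes by blast
  then have "\<forall>m\<ge>N + snd l. l_an l m v = 0" by (simp add: l_an_def)
  then show "\<exists>N. \<forall>m\<ge>N. l_an l m v = 0" by blast
  show "l_cr l n (l_cr l' m v) = sgn_if (fst l \<and> fst l') (l_cr l' m (l_cr l n v))"
    by (simp add: l_cr_def cre_rules cre_commutes[of "fst l"] heis.scale_sgn_if mult.commute)
  show "l_an l n (l_an l' m v) = sgn_if (\<not> fst l \<and> \<not> fst l') (l_an l' m (l_an l n v))"
    by (simp add: l_an_def ann_rules ann_commutes[of "fst l"] heis.scale_sgn_if mult.commute)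
  obtain x i y j where l: "l = (x, i)" "l' = (y, j)" by (cases l; cases l') auto
  have m: "m - i = n' + 1 \<longleftrightarrow> m = i + n' + 1" for m i n' :: nat by auto
  show "l_an l m (l_cr l' n v) = sgn_if (\<not> fst l \<and> fst l') (l_cr l' n (l_an l m v)) +
    (if fst l \<noteq> fst l' \<and> m = l_cord l l' + n then heis_scale (l_ccoef l l' * of_nat (m choose l_cord l l')) v else 0)"
  proof (cases "x \<noteq> y \<and> m = i + j + n + 1")
    case True
    then have "(- 1) ^ i * of_nat (m choose i) * (of_nat ((n + j) choose j) * of_nat (n + j + 1))
      = (- 1) ^ i * (of_nat ((i + j + 1) * ((i + j) choose i)) * of_nat (m choose (i + j + 1)) :: complex)"
      using multinomial_identity[of i j n] by (simp only: mult.assoc)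
    with True show ?thesis
      by (auto simp: l l_an_def l_cr_def l_cord_def l_ccoef_def ann_cre ann_rules cre_rules heis.scale_right_distrib heis.scale_sgn_if mult.commute mult.left_commute
        heis.scale_minus_left add.commute[of j n] add.commute[of i n] simp del: of_nat_Suc of_nat_add of_nat_mult binomial_Suc_Suc)
  next
    case False
    then have "\<not> (x \<noteq> y \<and> m - i = n + j + 1)" by auto
    with False show ?thesis
      by (auto simp: l l_an_def l_cr_def l_cord_def ann_cre ann_rules cre_rules heis.scale_sgn_if mult.commute)
  qed
  have ca: "cre x p (ann y q v) = sgn_if (x \<and> \<not> y) (ann y q (cre x p v)) - (if x \<noteq> y \<and> q = p + 1 then sgn_if (x \<and> \<not> y) (sgn_if y (heis_scale (of_nat q) v)) else 0)" for x y p q v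
    by (auto simp: ann_cre sgn_if_def)
  show "l_cr l n (l_an l' m v) = sgn_if (fst l \<and> \<not> fst l') (l_an l' m (l_cr l n v)) -
    (if fst l \<noteq> fst l' \<and> m = l_cord l l' + n then sgn_if (fst l) (heis_scale (l_ccoef l l' * (- 1) ^ l_cord l l' * of_nat (m choose l_cord l l')) v) else 0)"
  proof (cases "x \<noteq> y \<and> m = j + i + n + 1")
    case True
    have "(- 1) ^ i * (- 1) ^ (i + j + 1) = - ((- 1) ^ j :: complex)"
      by (simp add: power_add mult.assoc[symmetric] flip: power_mult_distrib)
    then have "- ((- 1) ^ i * A * (- 1) ^ (i + j + 1) * B) = (- 1) ^ j * (A * B)" for A B :: complex
      by (metis (no_types, opaque_lifting) minus_mult_left mult.assoc mult.commute minus_minus)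
    moreover have "(j + i + 1) * ((j + i) choose j) = (i + j + 1) * ((i + j) choose i)" "j + i + n + 1 = m" "j + i + 1 = i + j + 1"
      using binomial_swap[of i j] True by (simp_all add: add.commute)
    ultimately have "(- 1) ^ j * of_nat (m choose j) * (of_nat ((n + i) choose i) * of_nat (n + i + 1))
      = - ((- 1) ^ i * of_nat ((i + j + 1) * ((i + j) choose i)) * (- 1) ^ (i + j + 1) * of_nat (m choose (i + j + 1)) :: complex)"
      using multinomial_identity[of j i n] by (simp only: mult.assoc)
    with True show ?thesis
      by (auto simp: l l_an_def l_cr_def l_cord_def l_ccoef_def ca ann_rules cre_rules heis.scale_right_diff_distrib heis.scale_sgn_if mult.commute mult.left_commute
        heis.scale_minus_left add.commute[of j n] add.commute[of i n] simp del: of_nat_Suc of_nat_add of_nat_mult binomial_Suc_Suc)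
  next
    case False
    then have "\<not> (x \<noteq> y \<and> m - j = n + i + 1)" by auto
    with False show ?thesis
      by (auto simp: l l_an_def l_cr_def l_cord_def ca ann_rules cre_rules heis.scale_sgn_if mult.commute)
  qed
qed

section \<open>Degree and spin as eigenspaces\<close>

context complex_space
begin

lemma two_powi_inj: "(2::complex) powi s = 2 powi t \<Longrightarrow> s = t"
proof -
  assume "(2::complex) powi s = 2 powi t"
  then have "(2::complex) powi (s - t) = 1" by (simp add: power_int_diff)
  then have "norm ((2::complex) powi (s - t)) = 1" by simp
  then have "(2::real) powi (s - t) = 1" by (simp add: norm_power_int)
  then show "s = t"
    using power_int_strict_increasing[of 0 "s - t" "2::real"] power_int_strict_increasing[of "s - t" 0 "2::real"] by fastforce
qed

text \<open>The eigenvalue of weight r is \<open>2^r\<close>, so that different weights have different eigenvalues.\<close>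

definition weight_space :: "('v \<Rightarrow> 'v) \<Rightarrow> int \<Rightarrow> 'v set" where
  "weight_space \<Gamma> r = {v. \<Gamma> v = scale (2 powi r) v}"

lemma weight_space_subspace: "lin_op \<Gamma> \<Longrightarrow> subspace (weight_space \<Gamma> r)"
  by (rule subspaceI) (auto simp: weight_space_def linear_rules scale_right_distrib mult.commute)

lemma weight_space_indep:
  assumes \<Gamma>: "lin_op \<Gamma>"
  shows "finite T \<Longrightarrow> (\<And>t. t \<in> T \<Longrightarrow> x t \<in> weight_space \<Gamma> t) \<Longrightarrow> (\<Sum>t\<in>T. x t) = 0 \<Longrightarrow> t \<in> T \<Longrightarrow> x t = 0"
proof (induction T arbitrary: x t rule: finite_induct)
  case (insert s T)
  \<comment> \<open>Applying \<open>\<Gamma> - 2^s\<close> to the relation kills the summand of weight s and rescales the others.\<close>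
  define y where "y t = scale (2 powi t - 2 powi s) (x t)" for t
  have "(\<Sum>t\<in>insert s T. scale (2 powi t) (x t)) = \<Gamma> (\<Sum>t\<in>insert s T. x t)"
    unfolding linear_rules(7)[OF \<Gamma>] using insert.prems(1) by (intro sum.cong) (auto simp: weight_space_def)
  also have "\<dots> = 0" using insert.prems(2) linear_rules(1)[OF \<Gamma>] by simp
  finally have 1: "(\<Sum>t\<in>insert s T. scale (2 powi t) (x t)) = 0" .
  have 2: "scale (2 powi s) (\<Sum>t\<in>insert s T. x t) = 0" using insert.prems(2) by simp
  have "(\<Sum>t\<in>insert s T. y t) = 0"
    unfolding y_def scale_left_diff_distrib sum_subtractf 1 scale_sum_right[symmetric] 2 by simp
  moreover have "y s = 0" by (simp add: y_def)
  ultimately have "(\<Sum>t\<in>T. y t) = 0" using insert.hyps by simp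
  moreover have "y t \<in> weight_space \<Gamma> t" if "t \<in> T" for t
    unfolding y_def using insert.prems(1) that by (intro subspace_scale[OF weight_space_subspace[OF \<Gamma>]]) auto
  ultimately have "y t = 0" if "t \<in> T" for t using insert.IH that by blast
  then have x: "x t = 0" if "t \<in> T" for t
    using that insert.hyps(2) two_powi_inj[of t s] by (auto simp: y_def)
  then have "x s = 0" using insert.prems(2) insert.hyps by simp
  with x insert.prems(3) show ?case by auto
qed simp

lemma weight_space_decomp:
  assumes \<Gamma>: "lin_op \<Gamma>" and B: "\<And>v. v \<in> B \<Longrightarrow> \<exists>r. v \<in> weight_space \<Gamma> r" and v: "v \<in> span B"
  shows "\<exists>x. (\<forall>i. x i \<in> span (B \<inter> weight_space \<Gamma> i)) \<and> finite {i. x i \<noteq> 0} \<and> v = (\<Sum>i | x i \<noteq> 0. x i)"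
  using v
proof (induction rule: span_induct_alt)
  case base
  show ?case by (rule exI[of _ "\<lambda>_. 0"]) (simp add: span_zero)
next
  case (step c u v)
  then obtain x where x: "\<And>i. x i \<in> span (B \<inter> weight_space \<Gamma> i)" "finite {i. x i \<noteq> 0}" "v = (\<Sum>i | x i \<noteq> 0. x i)" by blast
  obtain r where r: "u \<in> weight_space \<Gamma> r" using B step by blast
  define y where "y i = x i + (if i = r then scale c u else 0)" for i
  let ?T = "insert r {i. x i \<noteq> 0}"
  have T: "finite ?T" "{i. y i \<noteq> 0} \<subseteq> ?T" using x(2) by (auto simp: y_def)
  have "(\<Sum>i | y i \<noteq> 0. y i) = (\<Sum>i\<in>?T. y i)" by (rule sum.mono_neutral_left) (use T in auto)
  also have "\<dots> = (\<Sum>i\<in>?T. x i) + scale c u" using T(1) by (simp add: y_def sum.distrib sum.delta del: sum.insert)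
  also have "(\<Sum>i\<in>?T. x i) = v" unfolding x(3) by (rule sum.mono_neutral_right) (use T in auto)
  finally have "scale c u + v = (\<Sum>i | y i \<noteq> 0. y i)" by simp
  moreover have "y i \<in> span (B \<inter> weight_space \<Gamma> i)" for i
  proof -
    have "scale c u \<in> span (B \<inter> weight_space \<Gamma> r)" using r step(1) by (intro span_scale span_base) auto
    then show ?thesis using x(1)[of i] by (auto simp: y_def intro: span_add)
  qed
  moreover have "finite {i. y i \<noteq> 0}" using T finite_subset by blast
  ultimately show ?case by blast
qed

lemma weight_space_unique:
  assumes \<Gamma>: "lin_op \<Gamma>" and x: "\<And>i. x i \<in> weight_space \<Gamma> i" "finite {i. x i \<noteq> 0}"
    and y: "\<And>i. y i \<in> weight_space \<Gamma> i" "finite {i. y i \<noteq> 0}" and e: "(\<Sum>i | x i \<noteq> 0. x i) = (\<Sum>i | y i \<noteq> 0. y i)"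
  shows "x = y"
proof
  fix i
  let ?T = "insert i ({i. x i \<noteq> 0} \<union> {i. y i \<noteq> 0})"
  have f: "finite ?T" using x y by simp
  have "(\<Sum>i\<in>?T. x i) = (\<Sum>i | x i \<noteq> 0. x i)" "(\<Sum>i\<in>?T. y i) = (\<Sum>i | y i \<noteq> 0. y i)"
    by (rule sum.mono_neutral_right; use f in auto)+
  then have "(\<Sum>i\<in>?T. x i - y i) = 0" using e by (simp add: sum_subtractf del: sum.insert)
  moreover have "x t - y t \<in> weight_space \<Gamma> t" for t
    by (rule subspace_diff[OF weight_space_subspace[OF \<Gamma>] x(1) y(1)])
  ultimately have "x i - y i = 0"
    using weight_space_indep[OF \<Gamma> f, of "\<lambda>i. x i - y i" i] by blast
  then show "x i = y i" by simp
qed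

text \<open>If the space is spanned by eigenvectors, the eigenspaces form a grading, and each of them is
  spanned by the given vectors that it contains. The second statement follows from the first: the
  decomposition of an eigenvector into spans of given eigenvectors has one component only.\<close>

lemma weight_space_span:
  assumes \<Gamma>: "lin_op \<Gamma>" and B: "\<And>v. v \<in> B \<Longrightarrow> \<exists>r. v \<in> weight_space \<Gamma> r" and sp: "span B = UNIV"
  shows "graded_by scale (weight_space \<Gamma>)" "weight_space \<Gamma> r = span (B \<inter> weight_space \<Gamma> r)"
proof -
  have sub: "span (B \<inter> weight_space \<Gamma> r) \<subseteq> weight_space \<Gamma> r" for r
    by (rule span_minimal) (auto intro: weight_space_subspace[OF \<Gamma>])
  have dec: "\<exists>x. (\<forall>i. x i \<in> span (B \<inter> weight_space \<Gamma> i)) \<and> finite {i. x i \<noteq> 0} \<and> v = (\<Sum>i | x i \<noteq> 0. x i)" for v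
    by (rule weight_space_decomp[OF \<Gamma>]) (simp_all add: B sp)
  show "graded_by scale (weight_space \<Gamma>)"
    unfolding graded_by_def
  proof (intro conjI allI)
    fix v
    obtain x where x: "\<And>i. x i \<in> span (B \<inter> weight_space \<Gamma> i)" "finite {i. x i \<noteq> 0}" "v = (\<Sum>i | x i \<noteq> 0. x i)"
      using dec[of v] by blast
    show "\<exists>!x. (\<forall>i. x i \<in> weight_space \<Gamma> i) \<and> finite {i. x i \<noteq> 0} \<and> v = (\<Sum>i | x i \<noteq> 0. x i)"
    proof (rule ex1I[of _ x])
      show "(\<forall>i. x i \<in> weight_space \<Gamma> i) \<and> finite {i. x i \<noteq> 0} \<and> v = (\<Sum>i | x i \<noteq> 0. x i)" using x sub by blast
      fix y assume "(\<forall>i. y i \<in> weight_space \<Gamma> i) \<and> finite {i. y i \<noteq> 0} \<and> v = (\<Sum>i | y i \<noteq> 0. y i)"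
      then show "y = x" by (intro weight_space_unique[OF \<Gamma>]) (use x sub in auto)
    qed
  qed (rule weight_space_subspace[OF \<Gamma>])
  show "weight_space \<Gamma> r = span (B \<inter> weight_space \<Gamma> r)"
  proof (rule antisym[OF _ sub], rule subsetI)
    fix v assume v: "v \<in> weight_space \<Gamma> r"
    obtain x where x: "\<And>i. x i \<in> span (B \<inter> weight_space \<Gamma> i)" "finite {i. x i \<noteq> 0}" "v = (\<Sum>i | x i \<noteq> 0. x i)"
      using dec[of v] by blast
    have "{i. (if i = r then v else 0) \<noteq> 0} = (if v = 0 then {} else {r})" by auto
    then have "(\<lambda>i. if i = r then v else 0) = x"
      by (intro weight_space_unique[OF \<Gamma>]) (use v x sub in \<open>auto simp: subspace_0[OF weight_space_subspace[OF \<Gamma>]]\<close>)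
    from fun_cong[OF this, of r] show "v \<in> span (B \<inter> weight_space \<Gamma> r)" using x(1)[of r] by simp
  qed
qed

end

definition rav_rescale :: "(int \<Rightarrow> complex) \<Rightarrow> complex rav \<Rightarrow> complex rav" where
  "rav_rescale a k = Rav (Abs_fps (\<lambda>n. a (- int n - 1) * reg k $ n)) (Poly_Mapping.mapp (\<lambda>n x. a (int n) * x) (sing k))"

lemma sing_rav_rescale: "Poly_Mapping.lookup (sing (rav_rescale a k)) n = a (int n) * Poly_Mapping.lookup (sing k) n"
  by (simp add: rav_rescale_def mapp.rep_eq when_def in_keys_iff)

lemma reg_rav_rescale: "reg (rav_rescale a k) $ n = a (- int n - 1) * reg k $ n"
  by (simp add: rav_rescale_def)

lemma nth_rav_rescale: "rav_nth (rav_rescale a k) m = a m * rav_nth k m"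
  by (simp add: rav_nth_def sing_rav_rescale reg_rav_rescale)

lemma rav_nth_eqI: "(\<And>m. rav_nth x m = rav_nth y m) \<Longrightarrow> x = y"
proof (rule rav_eqI)
  assume *: "\<And>m. rav_nth x m = rav_nth y m"
  show "reg x $ n = reg y $ n" for n using *[of "- int n - 1"] by (simp add: rav_nth_def)
  show "Poly_Mapping.lookup (sing x) n = Poly_Mapping.lookup (sing y) n" for n using *[of "int n"] by (simp add: rav_nth_def)
qed

lemma rav_nth_scale: "rav_nth (rav_const c * k) m = c * rav_nth (k :: complex rav) m"
  by (simp add: rav_nth_const_mult pari_complex_def)

text \<open>The factors a and b rescale the modes of K and of K[1]. The Lie bracket pairs the index m of one
  summand with \<open>-m - 2\<close> of the other, so the conditions make the rescaling an automorphism that fixes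
  the central element.\<close>

locale h_rescaling =
  fixes a b :: "int \<Rightarrow> complex"
  assumes ab: "\<And>m. a (- int m - 2) * b (int m) = 1" "\<And>m. b (- int m - 2) * a (int m) = 1"
begin

definition h_rescale :: "hhat \<Rightarrow> hhat" where
  "h_rescale = (\<lambda>(k, l, t). (rav_rescale a k, rav_rescale b l, t))"

lemma rav_rescale_linear: "rav_rescale c (x + y) = rav_rescale c x + rav_rescale c y" "rav_rescale c (rav_const d * x) = rav_const d * rav_rescale c x"
  by (rule rav_nth_eqI, simp add: nth_rav_rescale rav_nth_add rav_nth_scale algebra_simps)+

lemma h_rescale_linear: "h_rescale (x + y) = h_rescale x + h_rescale y" "h_rescale (h_scale c x) = h_scale c (h_rescale x)"
  by (cases x; cases y; simp add: h_rescale_def rav_rescale_linear)+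

lemma du_pair_rescale:
  assumes "\<And>m. c (- int m - 2) * d (int m) = 1"
  shows "du_pair (reg (rav_rescale c k)) (sing (rav_rescale d l)) = du_pair (reg k) (sing l)"
proof -
  obtain N where N: "\<And>m. m \<ge> N \<Longrightarrow> Poly_Mapping.lookup (sing l) m = 0"
    using sing_bound by blast
  then have N': "\<And>m. m \<ge> N \<Longrightarrow> Poly_Mapping.lookup (sing (rav_rescale d l)) m = 0" by (simp add: sing_rav_rescale)
  have "c (- int (m + 1) - 1) = c (- int m - 2)" for m by (rule arg_cong[where f = c]) simp
  then have "c (- int (m + 1) - 1) * d (int m) = 1" for m using assms[of m] by simp
  moreover have "n * (C * x) * (D * y) = C * D * (n * x * y)" for n x y C D :: complex by simp
  ultimately have e: "of_nat (m + 1) * (c (- int (m + 1) - 1) * x) * (d (int m) * y) = of_nat (m + 1) * x * y" for m x y by simp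
  have "du_pair (reg (rav_rescale c k)) (sing (rav_rescale d l)) = (\<Sum>m<N. of_nat (m + 1) * reg (rav_rescale c k) $ (m + 1) * Poly_Mapping.lookup (sing (rav_rescale d l)) m)"
    by (rule du_pair_bound) (rule N')
  also have "\<dots> = (\<Sum>m<N. of_nat (m + 1) * reg k $ (m + 1) * Poly_Mapping.lookup (sing l) m)"
    unfolding sing_rav_rescale reg_rav_rescale e ..
  also have "\<dots> = du_pair (reg k) (sing l)"
    by (rule du_pair_bound[symmetric]) (rule N)
  finally show ?thesis .
qed

lemma h_rescale_bracket: "h_bracket (h_rescale x) (h_rescale y) = h_bracket x y" "h_rescale (h_bracket x y) = h_bracket x y"
proof -
  have "rav_rescale c 0 = 0" for c by (rule rav_nth_eqI) (simp add: nth_rav_rescale)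
  then show "h_bracket (h_rescale x) (h_rescale y) = h_bracket x y" "h_rescale (h_bracket x y) = h_bracket x y"
    by (cases x; cases y; simp add: h_rescale_def du_pair_rescale ab)+
qed

lemma rav_rescale_zero: "reg k = 0 \<Longrightarrow> reg (rav_rescale c k) = 0" "sing k = 0 \<Longrightarrow> sing (rav_rescale c k) = 0"
  by (auto intro!: fps_ext poly_mapping_eqI simp: reg_rav_rescale sing_rav_rescale)

lemma h_rescale_deg: "x \<in> h_deg r \<Longrightarrow> h_rescale x \<in> h_deg r"
  unfolding h_deg_def h_rescale_def using rav_rescale_zero by (cases x) fastforce

lemma h_rescale_nonneg: "x \<in> h_nonneg \<Longrightarrow> h_rescale x \<in> h_nonneg" "h_char (h_rescale x) = h_char x"
  unfolding h_nonneg_def h_rescale_def by (cases x; auto simp: rav_rescale_zero)+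

sublocale wt: free_hom_ring u_scal "\<lambda>x. u_inc (h_rescale x)"
  by unfold_locales (rule u_scal_hom u_scal_central)+

lemma rescale_rels: "p - q \<in> two_sided_ideal uea_rels \<Longrightarrow> feval u_scal (\<lambda>x. u_inc (h_rescale x)) p = feval u_scal (\<lambda>x. u_inc (h_rescale x)) q"
proof -
  assume a: "p - q \<in> two_sided_ideal uea_rels"
  have "feval u_scal (\<lambda>x. u_inc (h_rescale x)) r = 0" if "r \<in> uea_rels" for r
    using that
  proof (cases rule: uea_rels_cases)
    case (3 x y r s)
    then show ?thesis
      using u_inc_commutes[OF h_rescale_deg[OF 3(2)] h_rescale_deg[OF 3(3)]]
      by (simp add: wt.feval_diff wt.feval_mult wt.feval_fgen wt.feval_fscal h_rescale_bracket mult.assoc)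
  qed (simp_all add: wt.feval_diff wt.feval_mult wt.feval_fgen wt.feval_fscal h_rescale_linear u_inc_add u_inc_scale)
  from wt.feval_ideal[OF this a] show ?thesis by (simp add: wt.feval_diff)
qed

text \<open>The induced automorphism of the enveloping algebra.\<close>

definition u_rescale :: "uea \<Rightarrow> uea" where
  "u_rescale u = feval u_scal (\<lambda>x. u_inc (h_rescale x)) (rep_uea u)"

lemma u_rescale_abs: "u_rescale (abs_uea p) = feval u_scal (\<lambda>x. u_inc (h_rescale x)) p"
proof -
  have "rep_uea (abs_uea p) - p \<in> two_sided_ideal uea_rels"
    using Quotient_rep_abs[OF Quotient_uea, of p] by (simp add: two_sided_ideal.zero)
  from rescale_rels[OF this] show ?thesis by (simp add: u_rescale_def)
qed

lemma u_rescale_simps: "u_rescale (u + v) = u_rescale u + u_rescale v" "u_rescale (u * v) = u_rescale u * u_rescale v" "u_rescale (u_inc x) = u_inc (h_rescale x)"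
  "u_rescale (u_scal c) = u_scal c" "u_rescale 1 = 1"
proof -
  show "u_rescale (u + v) = u_rescale u + u_rescale v" "u_rescale (u * v) = u_rescale u * u_rescale v"
    by (induction u rule: uea.abs_induct; induction v rule: uea.abs_induct;
      simp add: plus_uea.abs_eq times_uea.abs_eq u_rescale_abs wt.feval_add wt.feval_mult)+
  show "u_rescale (u_inc x) = u_inc (h_rescale x)" for x
    by (subst u_inc.abs_eq) (simp add: u_rescale_abs wt.feval_fgen)
  show *: "u_rescale (u_scal c) = u_scal c" for c
    by (subst u_scal.abs_eq) (simp add: u_rescale_abs wt.feval_fscal)
  show "u_rescale 1 = 1" using *[of 1] by (simp add: u_scal_hom)
qed

lemma heis_tensor_one: "heis_tensor u 1 = heis_act u heis_vac"
  by (simp add: heis_vac_def heis_act_tensor)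

definition rescale_op :: "heis \<Rightarrow> heis" where
  "rescale_op h = abs_heis (pm_push (\<lambda>(u, t). (u_rescale u, t)) (rep_heis h))"

lemma rescale_op_abs: "rescale_op (abs_heis p) = abs_heis (pm_push (\<lambda>(u, t). (u_rescale u, t)) p)"
proof -
  let ?f = "\<lambda>(u, t). (u_rescale u, t) :: uea \<times> complex"
  have "pm_push ?f r \<in> pm.span tensor_rels" if "r \<in> tensor_rels" for r
    using that
  proof (cases rule: tensor_rels_cases)
    case (5 v x t)
    then show ?thesis
      using tensor_relsI(5)[OF h_rescale_nonneg(1)[OF 5(2)], of "u_rescale v" t]
      by (simp add: pm_push_diff pm_push_single u_rescale_simps h_rescale_nonneg(2) pm.span_base)
  qed (simp_all add: pm_push_diff pm_push_single pm_push_scale u_rescale_simps pm.span_base tensor_relsI)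
  moreover have "rep_heis (abs_heis p) - p \<in> pm.span tensor_rels"
    using Quotient_rep_abs[OF Quotient_heis, of p] by (simp add: pm.span_zero)
  ultimately have "pm_push ?f (rep_heis (abs_heis p) - p) \<in> pm.span tensor_rels"
    by (rule pm_push_span)
  then show ?thesis by (simp add: rescale_op_def heis.abs_eq_iff pm_push_diff)
qed

lemma rescale_op_linear: "heis.lin_op rescale_op"
proof (rule heis.linear_intro)
  show "rescale_op (u + v) = rescale_op u + rescale_op v" for u v
    by (induction u rule: heis.abs_induct; induction v rule: heis.abs_induct)
      (simp add: plus_heis.abs_eq rescale_op_abs pm_push_add)
  show "rescale_op (heis_scale c v) = heis_scale c (rescale_op v)" for c v
    by (induction v rule: heis.abs_induct) (simp add: heis_scale.abs_eq rescale_op_abs pm_push_scale)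
qed

lemma rescale_op_tensor: "rescale_op (heis_tensor u t) = heis_tensor (u_rescale u) t"
  by (simp add: heis_tensor.abs_eq rescale_op_abs pm_push_single)

lemma rescale_op_act: "rescale_op (heis_act u h) = heis_act (u_rescale u) (rescale_op h)"
proof -
  obtain w where "h = heis_tensor w 1" using heis_surj by blast
  then show ?thesis by (simp add: heis_act_tensor rescale_op_tensor u_rescale_simps)
qed

lemma rescale_op_vac: "rescale_op heis_vac = heis_vac"
  by (simp add: heis_vac_def rescale_op_tensor u_rescale_simps)

lemma h_act_weight_space:
  assumes "h_rescale x = h_scale (2 powi s) x" "h \<in> heis.weight_space rescale_op t"
  shows "h_act x h \<in> heis.weight_space rescale_op (t + s)"
  using assms by (simp add: heis.weight_space_def rescale_op_act u_rescale_simps h_act_simps act_scale power_int_add mult.commute)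

lemma vac_weight_space: "heis_vac \<in> heis.weight_space rescale_op 0"
  by (simp add: heis.weight_space_def rescale_op_vac)

text \<open>If the rescaling multiplies the elements of \<open>G r\<close> by \<open>2^r\<close>, the induced grading of \<open>H\<close> consists of
  its eigenspaces: products of homogeneous elements give eigenvectors, and conversely an eigenspace
  is spanned by the monomials in it, which are such products.\<close>

lemma grading_weight_space:
  assumes G: "\<And>x r. x \<in> G r \<Longrightarrow> h_rescale x = h_scale (2 powi r) x"
    and cr: "\<And>x i. (if x then h_nu i else h_b i) \<in> G (wt (x, i))"
  shows "heis_grading G = heis.weight_space rescale_op" "mode_word w \<in> heis.weight_space rescale_op (sum_list (map wt w))"
proof -
  have 1: "heis_act (prod_list (map u_inc xs)) heis_vac \<in> heis.weight_space rescale_op (sum_list rs)" if "list_all2 (\<lambda>x i. x \<in> G i) xs rs" for xs rs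
    using that
  proof (induction rule: list_all2_induct)
    case (Cons x xs r rs)
    then show ?case using h_act_weight_space[OF G] by (simp add: act_mult add.commute)
  qed (simp add: act_one vac_weight_space)
  define L where "L = (\<lambda>(x, i). if x then h_nu i else h_b i)"
  have 2: "mode_word w = heis_act (prod_list (map u_inc (map L w))) heis_vac" for w
    by (induction w rule: mode_word.induct) (simp_all add: act_one cre_def L_def act_mult)
  have 3: "list_all2 (\<lambda>x i. x \<in> G i) (map L w) (map wt w)" for w
    using cr by (auto simp: list_all2_conv_all_nth L_def split: prod.split)
  show w: "mode_word w \<in> heis.weight_space rescale_op (sum_list (map wt w))" for w
    unfolding 2 by (rule 1[OF 3])
  show "heis_grading G = heis.weight_space rescale_op"
  proof
    fix r
    note T = heis_tensor_one
    show "heis_grading G r = heis.weight_space rescale_op r"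
    proof (rule antisym)
      show "heis_grading G r \<subseteq> heis.weight_space rescale_op r"
        unfolding heis_grading_def
        by (rule heis.span_minimal) (use 1 in \<open>auto simp: T heis.weight_space_subspace[OF rescale_op_linear]\<close>)
      have "range mode_word \<inter> heis.weight_space rescale_op r \<subseteq> heis_grading G r"
      proof
        fix v assume v: "v \<in> range mode_word \<inter> heis.weight_space rescale_op r"
        then obtain w where w': "v = mode_word w" by blast
        show "v \<in> heis_grading G r"
        proof (cases "v = 0")
          case True
          then show ?thesis unfolding heis_grading_def using heis.span_zero by simp
        next
          case False
          have "heis_scale (2 powi r - 2 powi (sum_list (map wt w))) v = 0"
            using w[of w] v by (auto simp: w' heis.weight_space_def heis.scale_left_diff_distrib)
          then have "r = sum_list (map wt w)" using False heis.two_powi_inj by auto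
          then show ?thesis
            unfolding heis_grading_def w' 2 T[symmetric] using 3 by (intro heis.span_base) blast
        qed
      qed
      then have "heis.span (range mode_word \<inter> heis.weight_space rescale_op r) \<subseteq> heis_grading G r"
        by (rule heis.span_minimal) (simp add: heis_grading_def)
      moreover have "heis.weight_space rescale_op r = heis.span (range mode_word \<inter> heis.weight_space rescale_op r)"
        by (rule heis.weight_space_span(2)[OF rescale_op_linear]) (use w mode_word_span in blast)+
      ultimately show "heis.weight_space rescale_op r \<subseteq> heis_grading G r" by simp
    qed
  qed
qed

end

interpretation deg_rescaling: h_rescaling "\<lambda>m. if m < 0 then 1 else 2" "\<lambda>m. if m < 0 then 1 / 2 else 1"
  by unfold_locales auto

interpretation spin_rescaling: h_rescaling "\<lambda>m. 2 powi (m + 1)" "\<lambda>m. 2 powi (m + 1)"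
  by unfold_locales (simp_all add: power_int_add[symmetric])

lemma h_deg_weight: "x \<in> h_deg r \<Longrightarrow> deg_rescaling.h_rescale x = h_scale (2 powi r) x"
proof -
  assume x: "x \<in> h_deg r"
  obtain k l t where klt: "x = (k, l, t)" by (cases x)
  have nz: "rav_nth y m \<noteq> 0 \<Longrightarrow> m < 0 \<Longrightarrow> reg y \<noteq> 0" "rav_nth y m \<noteq> 0 \<Longrightarrow> 0 \<le> m \<Longrightarrow> sing y \<noteq> 0" for y :: "complex rav" and m
    by (auto simp: rav_nth_def)
  have "rav_rescale (\<lambda>m. if m < 0 then 1 else 2) k = rav_const (2 powi r) * k"
  proof (rule rav_nth_eqI)
    show "rav_nth (rav_rescale (\<lambda>m. if m < 0 then 1 else 2) k) m = rav_nth (rav_const (2 powi r) * k) m" for m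
      using x nz[of k m] by (cases "rav_nth k m = 0"; cases "m < 0") (auto simp: nth_rav_rescale rav_nth_scale h_deg_def klt)
  qed
  moreover have "rav_rescale (\<lambda>m. if m < 0 then 1 / 2 else 1) l = rav_const (2 powi r) * l"
  proof (rule rav_nth_eqI)
    show "rav_nth (rav_rescale (\<lambda>m. if m < 0 then 1 / 2 else 1) l) m = rav_nth (rav_const (2 powi r) * l) m" for m
      using x nz[of l m] by (cases "rav_nth l m = 0"; cases "m < 0") (auto simp: nth_rav_rescale rav_nth_scale h_deg_def klt power_int_minus)
  qed
  moreover have "t = 2 powi r * t" using x by (auto simp: klt h_deg_def)
  ultimately show ?thesis by (simp add: deg_rescaling.h_rescale_def klt)
qed

lemma h_spin_weight: "x \<in> h_spin r \<Longrightarrow> spin_rescaling.h_rescale x = h_scale (2 powi r) x"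
proof -
  assume x: "x \<in> h_spin r"
  obtain k l t where klt: "x = (k, l, t)" by (cases x)
  have "rav_rescale (\<lambda>m. 2 powi (m + 1)) y = rav_const (2 powi r) * y" if "\<forall>m. rav_nth y m \<noteq> 0 \<longrightarrow> r = m + 1" for y
    by (rule rav_nth_eqI) (use that in \<open>auto simp: nth_rav_rescale rav_nth_scale\<close>)
  moreover have "t = 2 powi r * t" using x by (auto simp: klt h_spin_def)
  ultimately show ?thesis using x by (auto simp: spin_rescaling.h_rescale_def klt h_spin_def)
qed

lemma spin_basis: "h_nu n \<in> h_spin (int n + 1)" "h_b n \<in> h_spin (int n + 1)" "h_c n \<in> h_spin (- int n)" "h_phi n \<in> h_spin (- int n)"
proof -
  have "rav_nth (rav_Om n) m \<noteq> (0 :: complex) \<Longrightarrow> m = int n" "rav_nth (Rav (fps_X ^ n) 0) m \<noteq> (0 :: complex) \<Longrightarrow> m = - int n - 1" for m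
    by (auto simp: rav_nth_def rav_Om_def lookup_single when_def fps_X_power_nth split: if_splits)
  then show "h_nu n \<in> h_spin (int n + 1)" "h_b n \<in> h_spin (int n + 1)" "h_c n \<in> h_spin (- int n)" "h_phi n \<in> h_spin (- int n)"
    by (force simp: h_spin_def h_nu_def h_b_def h_c_def h_phi_def)+
qed

definition letter_deg :: "letter \<Rightarrow> int" where "letter_deg l = (if fst l then 1 else 0)"
definition letter_spin :: "letter \<Rightarrow> int" where "letter_spin l = int (snd l) + 1"

abbreviation heis_deg :: "int \<Rightarrow> heis set" where "heis_deg \<equiv> heis_grading h_deg"
abbreviation heis_spin :: "int \<Rightarrow> heis set" where "heis_spin \<equiv> heis_grading h_spin"

lemma heis_deg_weight_space: "heis_deg = heis.weight_space deg_rescaling.rescale_op" "mode_word w \<in> heis_deg (sum_list (map letter_deg w))"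
proof -
  have "(if x then h_nu i else h_b i) \<in> h_deg (letter_deg (x, i))" for x i
    by (simp add: letter_deg_def deg_basis)
  note * = deg_rescaling.grading_weight_space[where G = h_deg and wt = letter_deg, OF h_deg_weight this]
  show "heis_deg = heis.weight_space deg_rescaling.rescale_op" "mode_word w \<in> heis_deg (sum_list (map letter_deg w))" using * by simp_all
qed

lemma heis_spin_weight_space: "heis_spin = heis.weight_space spin_rescaling.rescale_op" "mode_word w \<in> heis_spin (sum_list (map letter_spin w))"
proof -
  have "(if x then h_nu i else h_b i) \<in> h_spin (letter_spin (x, i))" for x i
    by (simp add: letter_spin_def spin_basis)
  note * = spin_rescaling.grading_weight_space[where G = h_spin and wt = letter_spin, OF h_spin_weight this]
  show "heis_spin = heis.weight_space spin_rescaling.rescale_op" "mode_word w \<in> heis_spin (sum_list (map letter_spin w))" using * by simp_all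
qed

lemma deg_act: "x \<in> h_deg s \<Longrightarrow> h \<in> heis_deg t \<Longrightarrow> h_act x h \<in> heis_deg (t + s)"
  unfolding heis_deg_weight_space by (rule deg_rescaling.h_act_weight_space[OF h_deg_weight])

lemma spin_act: "x \<in> h_spin s \<Longrightarrow> h \<in> heis_spin t \<Longrightarrow> h_act x h \<in> heis_spin (t + s)"
  unfolding heis_spin_weight_space by (rule spin_rescaling.h_act_weight_space[OF h_spin_weight])

lemma deg_subspace: "heis.subspace (heis_deg r)" and spin_subspace: "heis.subspace (heis_spin r)"
  unfolding heis_deg_weight_space heis_spin_weight_space by (rule heis.weight_space_subspace deg_rescaling.rescale_op_linear spin_rescaling.rescale_op_linear)+

lemma l_cr_zero: "l_cr (x, i) 0 h = cre x i h"
  by (simp add: l_cr_def)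

lemma mode_word_eq: "hf.word_vec heis_vac w = mode_word w"
  by (induction w rule: mode_word.induct) (simp_all add: l_cr_zero)

lemma field_deg:
  assumes "v \<in> heis_deg t"
  shows "hf.wfield w p v \<in> heis_deg (t + sum_list (map letter_deg w) + (if p < 0 then 0 else - 1))"
proof (rule hf.word_field_weight[where \<mu> = "\<lambda>p. if p < 0 then 0 else - 1", OF deg_subspace])
  show "l_cr X n v \<in> heis_deg (t + letter_deg X + (if - 1 - int n < 0 then 0 else - 1))" if "v \<in> heis_deg t" for X n t v
    unfolding l_cr_def cre_def letter_deg_def
    by (intro heis.subspace_scale[OF deg_subspace]) (use deg_act[OF _ that] deg_basis in simp)
  show "l_an X m v \<in> heis_deg (t + letter_deg X + (if int m < 0 then 0 else - 1))" if "v \<in> heis_deg t" for X m t v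
    unfolding l_an_def ann_def letter_deg_def
    by (intro heis.subspace_scale[OF deg_subspace]) (use deg_act[OF deg_basis(6) that] deg_act[OF deg_basis(7) that] in simp)
qed (use assms in auto)

lemma field_spin:
  assumes "v \<in> heis_spin t"
  shows "hf.wfield w p v \<in> heis_spin (t + sum_list (map letter_spin w) + (- p - 1))"
proof (rule hf.word_field_weight[where \<mu> = "\<lambda>p. - p - 1", OF spin_subspace])
  show "l_cr X n v \<in> heis_spin (t + letter_spin X + (- (- 1 - int n) - 1))" if "v \<in> heis_spin t" for X n t v
  proof -
    have "(if fst X then h_nu (n + snd X) else h_b (n + snd X)) \<in> h_spin (letter_spin X + int n)"
      using spin_basis(1,2)[of "n + snd X"] by (simp add: letter_spin_def add_ac)
    from spin_act[OF this that] show ?thesis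
      unfolding l_cr_def cre_def by (intro heis.subspace_scale[OF spin_subspace]) (simp add: add.assoc)
  qed
  show "l_an X m v \<in> heis_spin (t + letter_spin X + (- int m - 1))" if "v \<in> heis_spin t" for X m t v
  proof (cases "snd X \<le> m")
    case True
    have "(if fst X then h_c (m - snd X) else h_phi (m - snd X)) \<in> h_spin (letter_spin X + (- int m - 1))"
      using spin_basis(3,4)[of "m - snd X"] True by (simp add: letter_spin_def of_nat_diff)
    from spin_act[OF this that] show ?thesis
      unfolding l_an_def ann_def by (intro heis.subspace_scale[OF spin_subspace]) (simp add: add.assoc)
  next
    case False
    then show ?thesis by (simp add: l_an_def binomial_eq_0 heis.subspace_0[OF spin_subspace])
  qed
qed (use assms in auto)

lemma word_field_heis_trans: "heis_trans (hf.wfield w p v) = hf.wfield w p (heis_trans v) + heis_scale (- of_int p) (hf.wfield w (p - 1) v)"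
proof (rule hf.wfield_translation[OF trans_linear])
  fix X :: letter and n m v
  obtain x i where X: "X = (x, i)" by force
  have 1: "heis_trans (cre x n v) = cre x n (heis_trans v) + heis_scale (of_nat (n + 1)) (cre x (n + 1) v)" for n
    by (auto simp: cre_def trans_h_act h_deriv_basis h_act_simps)
  have 2: "heis_trans (ann x n v) = ann x n (heis_trans v) - heis_scale (of_nat n) (ann x (n - 1) v)" for n
    by (auto simp: ann_def trans_h_act h_deriv_basis h_act_simps heis.scale_minus_left)
  have e1: "of_nat ((n + i) choose i) * of_nat (n + i + 1) = (of_nat (n + 1) * of_nat ((n + 1 + i) choose i) :: complex)"
    unfolding of_nat_mult[symmetric] using choose_id1[of n i] by (simp add: mult.commute)
  show "heis_trans (l_cr X n v) = l_cr X n (heis_trans v) + heis_scale (of_nat (n + 1)) (l_cr X (n + 1) v)"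
    using e1 by (simp add: X l_cr_def heis.linear_rules[OF trans_linear] 1 cre_rules heis.scale_right_distrib add.commute[of i] mult.commute del: of_nat_Suc binomial_Suc_Suc)
  have e2: "of_nat (m choose i) * of_nat (m - i) = (of_nat m * of_nat ((m - 1) choose i) :: complex)"
    unfolding of_nat_mult[symmetric] using binomial_absorb_comp[of m i] by (simp add: mult.commute)
  have e3: "m - i - 1 = m - 1 - i" by simp
  show "heis_trans (l_an X m v) = l_an X m (heis_trans v) - heis_scale (of_nat m) (l_an X (m - 1) v)"
    using e2 unfolding X l_an_def fst_conv snd_conv heis.linear_rules[OF trans_linear] 2 e3
    by (simp add: ann_rules heis.scale_right_diff_distrib mult.assoc mult.left_commute[of _ "(- 1) ^ i"])
qed

section \<open>The state-field correspondence\<close>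

lemma wfield_letter: "hf.wfield [(x, 0)] = raviolo_series (cre x) (ann x)"
proof (intro ext)
  fix m :: int and v
  have "\<forall>\<^sub>F N in sequentially. hf.nprod (x, 0) False hf.id_field m v = raviolo_series (cre x) (ann x) m v"
    using hf.nprod_eventually[OF hf.is_field_id_field, of "(x, 0)" False m v] eventually_gt_at_top[of "nat (- m)"] eventually_gt_at_top[of "nat m"]
  proof eventually_elim
    case (elim N)
    have 1: "l_cr (x, 0) n (zshift_at n hf.id_field m v) = (if m < 0 \<and> n = nat (- m - 1) then cre x n v else 0)" for n
      by (auto simp: zshift_def hf.id_field_def l_cr_def cre_rules)
    have 2: "Om_shift_at n hf.id_field m (l_an (x, 0) n v) = (if 0 \<le> m \<and> n = nat m then ann x n v else 0)" for n
      by (auto simp: Om_shift_def hf.id_field_def l_an_def)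
    have "nat (- m - 1) < N" "nat m < N" using elim(2,3) by auto
    then show ?case
      unfolding elim(1) 1 2 by (cases "m < 0") (simp_all add: raviolo_series_def)
  qed
  then show "hf.wfield [(x, 0)] m v = raviolo_series (cre x) (ann x) m v" by simp
qed

abbreviation b_vac :: heis where "b_vac \<equiv> cre False 0 heis_vac"
abbreviation nu_vac :: heis where "nu_vac \<equiv> cre True 0 heis_vac"

lemma heis_trivial: "heis_vac = 0 \<Longrightarrow> h = (h' :: heis)"
  using heis_vac_surj[of h] heis_vac_surj[of h'] heis.linear_rules[OF act_linear] by auto

text \<open>The vectors \<open>b_0|0>\<close> and \<open>nu_0|0>\<close> are distinguished from the span of the preceding ones by \<open>c_1\<close> and
  \<open>phi_1\<close>, which send them to nonzero multiples of the vacuum; so the three vectors extend to a basis.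
  If the vacuum were 0, then \<open>H = 0\<close>, and the empty set would be a basis.\<close>

lemma exists_word_basis:
  obtains Bas word_of where "heis.independent Bas" "heis.span Bas = UNIV" "\<And>\<beta>. \<beta> \<in> Bas \<Longrightarrow> mode_word (word_of \<beta>) = \<beta>"
    "heis_vac \<noteq> 0 \<Longrightarrow> {heis_vac, b_vac, nu_vac} \<subseteq> Bas \<and> word_of heis_vac = [] \<and> word_of b_vac = [(False, 0)] \<and> word_of nu_vac = [(True, 0)]"
proof (cases "heis_vac = 0")
  case True
  have "h = 0" for h :: heis by (rule heis_trivial[OF True])
  then have "heis.span {} = (UNIV :: heis set)" by auto
  then show ?thesis using True by (intro that[of "{}"]) (auto simp: heis.independent_empty)
next
  case False
  have ker: "heis.subspace {h. ann x n h = 0}" for x n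
    by (rule heis.subspaceI) (simp_all add: ann_rules)
  have i1: "heis.independent {heis_vac}" using False by simp
  have "heis.span {heis_vac} \<subseteq> {h. ann True 1 h = 0}"
    by (rule heis.span_minimal[OF _ ker]) (simp add: ann_vac)
  moreover have "ann True 1 b_vac \<noteq> 0" using False by (simp add: ann_cre ann_vac cre_rules)
  ultimately have n1: "b_vac \<notin> heis.span {heis_vac}" by blast
  then have i2: "heis.independent {b_vac, heis_vac}" using i1 by (rule heis.independent_insertI)
  have "heis.span {b_vac, heis_vac} \<subseteq> {h. ann False 1 h = 0}"
    by (rule heis.span_minimal[OF _ ker]) (simp add: ann_vac ann_cre cre_rules)
  moreover have "ann False 1 nu_vac \<noteq> 0" using False by (simp add: ann_cre ann_vac cre_rules)
  ultimately have n2: "nu_vac \<notin> heis.span {b_vac, heis_vac}" by blast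
  then have i3: "heis.independent {nu_vac, b_vac, heis_vac}" using i2 by (rule heis.independent_insertI)
  have ne: "b_vac \<noteq> heis_vac" "nu_vac \<noteq> heis_vac" "nu_vac \<noteq> b_vac"
    using n1 n2 heis.span_base[of heis_vac "{heis_vac}"] heis.span_base[of heis_vac "{b_vac, heis_vac}"]
      heis.span_base[of b_vac "{b_vac, heis_vac}"] by auto
  have w: "mode_word [] = heis_vac" "mode_word [(False, 0)] = b_vac" "mode_word [(True, 0)] = nu_vac" by simp_all
  have "{nu_vac, b_vac, heis_vac} \<subseteq> range mode_word" using rangeI[of mode_word "[]"] rangeI[of mode_word "[(False, 0)]"] rangeI[of mode_word "[(True, 0)]"] unfolding w by simp
  then obtain Bas where B: "{nu_vac, b_vac, heis_vac} \<subseteq> Bas" "Bas \<subseteq> range mode_word" "heis.independent Bas" "range mode_word \<subseteq> heis.span Bas"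
    using heis.maximal_independent_subset_extend[OF _ i3] by blast
  have "heis.span (range mode_word) \<subseteq> heis.span Bas" by (rule heis.span_minimal[OF B(4)]) simp
  then have sp: "heis.span Bas = UNIV" using mode_word_span by blast
  define word_of where "word_of \<beta> = (if \<beta> = heis_vac then [] else if \<beta> = b_vac then [(False, 0)] else if \<beta> = nu_vac then [(True, 0)]
     else (SOME w. mode_word w = \<beta>))" for \<beta>
  have "mode_word (SOME w. mode_word w = \<beta>) = \<beta>" if "\<beta> \<in> Bas" for \<beta>
    by (rule someI_ex) (use that B(2) in auto)
  then have "mode_word (word_of \<beta>) = \<beta>" if "\<beta> \<in> Bas" for \<beta>
    using that w unfolding word_of_def by simp
  then show ?thesis
    using B sp ne by (intro that[of Bas word_of]) (auto simp: word_of_def)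
qed

interpretation heis2: vector_space_pair heis_scale heis_scale
  by unfold_locales

locale word_basis =
  fixes Bas :: "heis set" and word_of :: "heis \<Rightarrow> letter list"
  assumes indep: "heis.independent Bas" and spans: "heis.span Bas = UNIV" and word_of: "\<beta> \<in> Bas \<Longrightarrow> mode_word (word_of \<beta>) = \<beta>"
    and wd_gen: "heis_vac \<noteq> 0 \<Longrightarrow> {heis_vac, b_vac, nu_vac} \<subseteq> Bas \<and> word_of heis_vac = [] \<and> word_of b_vac = [(False, 0)] \<and> word_of nu_vac = [(True, 0)]"
begin

definition Y :: "heis \<Rightarrow> int \<Rightarrow> heis \<Rightarrow> heis" where
  "Y a m v = heis2.construct Bas (\<lambda>\<beta>. hf.wfield (word_of \<beta>) m v) a"

lemma Y_linear: "heis.lin_op (\<lambda>a. Y a m v)"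
  unfolding Y_def by (rule heis2.linear_construct[OF indep])

lemma Y_add: "Y (heis_scale c a + b) = (\<lambda>m v. heis_scale c (Y a m v) + Y b m v)" and Y_zero: "Y 0 = (\<lambda>m v. 0)"
  by (simp_all add: fun_eq_iff heis.linear_rules[OF Y_linear])

lemma Y_basis: "\<beta> \<in> Bas \<Longrightarrow> Y \<beta> = hf.wfield (word_of \<beta>)"
  by (simp add: Y_def fun_eq_iff heis2.construct_basis[OF indep])

lemma span_UNIV: "a \<in> heis.span Bas" using spans by simp

lemma basis_nonzero: "\<beta> \<in> Bas \<Longrightarrow> \<beta> \<noteq> 0"
  using indep heis.dependent_zero by blast

text \<open>Basis vectors are monomials and hence homogeneous; as they are not 0, the weight of the word is
  the weight of the vector.\<close>

lemma basis_weights: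
  assumes \<Gamma>: "heis.lin_op \<Gamma>" and w: "\<And>w. mode_word w \<in> heis.weight_space \<Gamma> (f w)"
  shows "graded_by heis_scale (heis.weight_space \<Gamma>)" "heis.weight_space \<Gamma> r = heis.span (Bas \<inter> heis.weight_space \<Gamma> r)"
    "\<beta> \<in> Bas \<inter> heis.weight_space \<Gamma> r \<Longrightarrow> f (word_of \<beta>) = r"
proof -
  have "\<exists>r. v \<in> heis.weight_space \<Gamma> r" if "v \<in> Bas" for v using w[of "word_of v"] word_of[OF that] by auto
  then show "graded_by heis_scale (heis.weight_space \<Gamma>)" "heis.weight_space \<Gamma> r = heis.span (Bas \<inter> heis.weight_space \<Gamma> r)"
    by (intro heis.weight_space_span[OF \<Gamma> _ spans]; blast)+
  assume b: "\<beta> \<in> Bas \<inter> heis.weight_space \<Gamma> r"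
  then have "heis_scale (2 powi r) \<beta> = heis_scale (2 powi (f (word_of \<beta>))) \<beta>"
    using w[of "word_of \<beta>"] word_of[of \<beta>] by (simp add: heis.weight_space_def)
  then show "f (word_of \<beta>) = r" using basis_nonzero[of \<beta>] b heis.two_powi_inj by auto
qed

lemmas deg_basis_weights = basis_weights[OF deg_rescaling.rescale_op_linear heis_deg_weight_space(2)[unfolded heis_deg_weight_space(1)], folded heis_deg_weight_space(1)]
lemmas spin_basis_weights = basis_weights[OF spin_rescaling.rescale_op_linear heis_spin_weight_space(2)[unfolded heis_spin_weight_space(1)], folded heis_spin_weight_space(1)]

lemma w_odd_deg: "hf.w_odd w \<longleftrightarrow> odd (sum_list (map letter_deg w))"
  by (induction w) (auto simp: letter_deg_def)

lemma span_induct: "a \<in> heis.span S \<Longrightarrow> P 0 \<Longrightarrow> (\<And>c \<beta> b. \<beta> \<in> S \<Longrightarrow> P b \<Longrightarrow> P (heis_scale c \<beta> + b)) \<Longrightarrow> P a"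
  by (rule heis.span_induct_alt)

lemma Y_is_field: "hf.is_field (Y a)"
  using span_UNIV[of a]
  by (rule span_induct) (simp_all add: Y_zero hf.is_field_zero_field Y_add Y_basis hf.is_field_combine hf.is_field_wfield)

lemma Y_weight:
  assumes S: "heis.subspace S" and a: "a \<in> heis.span B" and B: "B \<subseteq> Bas" "\<And>\<beta>. \<beta> \<in> B \<Longrightarrow> hf.wfield (word_of \<beta>) m v \<in> S"
  shows "Y a m v \<in> S"
  using a
proof (rule span_induct)
  fix c \<beta> b assume "\<beta> \<in> B" "Y b m v \<in> S"
  then show "Y (heis_scale c \<beta> + b) m v \<in> S"
    using B by (auto simp: Y_add Y_basis intro!: heis.subspace_add[OF S] heis.subspace_scale[OF S])
qed (simp add: Y_zero heis.subspace_0[OF S])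

lemma Y_deg:
  assumes "a \<in> heis_deg r" "v \<in> heis_deg i"
  shows "Y a m v \<in> heis_deg (i + (if m < 0 then r else r - 1))"
proof (rule Y_weight[OF deg_subspace])
  show "a \<in> heis.span (Bas \<inter> heis_deg r)" using assms(1) deg_basis_weights(2) by blast
  have "i + r + (if m < 0 then 0 else - 1) = i + (if m < 0 then r else r - 1)" by simp
  then show "hf.wfield (word_of \<beta>) m v \<in> heis_deg (i + (if m < 0 then r else r - 1))" if "\<beta> \<in> Bas \<inter> heis_deg r" for \<beta>
    using field_deg[OF assms(2), of "word_of \<beta>" m] deg_basis_weights(3)[OF that] by metis
qed simp

lemma Y_spin:
  assumes "a \<in> heis_spin s" "v \<in> heis_spin t"
  shows "Y a n v \<in> heis_spin (t + (s - n - 1))"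
proof (rule Y_weight[OF spin_subspace])
  show "a \<in> heis.span (Bas \<inter> heis_spin s)" using assms(1) spin_basis_weights(2) by blast
  have "t + s + (- n - 1) = t + (s - n - 1)" by simp
  then show "hf.wfield (word_of \<beta>) n v \<in> heis_spin (t + (s - n - 1))" if "\<beta> \<in> Bas \<inter> heis_spin s" for \<beta>
    using field_spin[OF assms(2), of "word_of \<beta>" n] spin_basis_weights(3)[OF that] by metis
qed simp

lemma Y_trans: "heis_trans (Y a m v) - Y a m (heis_trans v) = heis_scale (- of_int m) (Y a (m - 1) v)"
  using span_UNIV[of a]
proof (rule span_induct)
  fix c \<beta> b assume "\<beta> \<in> Bas" "heis_trans (Y b m v) - Y b m (heis_trans v) = heis_scale (- of_int m) (Y b (m - 1) v)"
  then show "heis_trans (Y (heis_scale c \<beta> + b) m v) - Y (heis_scale c \<beta> + b) m (heis_trans v) = heis_scale (- of_int m) (Y (heis_scale c \<beta> + b) (m - 1) v)"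
    by (simp only: Y_add Y_basis heis.linear_rules[OF trans_linear] word_field_heis_trans heis.scale_right_distrib heis.scale_left_commute[of c])
      (simp add: algebra_simps)
qed (simp add: Y_zero heis.linear_rules[OF trans_linear])

lemma Y_creation: "Y a (- 1) heis_vac = a" "0 \<le> m \<Longrightarrow> Y a m heis_vac = 0"
proof -
  have v: "l_an l m heis_vac = 0" for l m by (simp add: l_an_def ann_vac)
  show "Y a (- 1) heis_vac = a"
    using span_UNIV[of a]
    by (rule span_induct) (simp_all add: Y_zero Y_add Y_basis hf.word_field_vacuum[OF v] mode_word_eq word_of)
  show "0 \<le> m \<Longrightarrow> Y a m heis_vac = 0"
    using span_UNIV[of a]
    by (rule span_induct) (simp_all add: Y_zero Y_add Y_basis hf.word_field_vacuum[OF v])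
qed

lemma Y_local:
  assumes "a \<in> heis_deg r" "b \<in> heis_deg s"
  shows "mutually_local heis_scale r s (Y a) (Y b)"
proof -
  have a: "a \<in> heis.span (Bas \<inter> heis_deg r)" and b: "b \<in> heis.span (Bas \<inter> heis_deg s)" using assms deg_basis_weights(2) by blast+
  have l: "hf.local_fields (odd r) (odd s) (Y a) (Y \<beta>)" if "\<beta> \<in> Bas \<inter> heis_deg s" for \<beta>
    using a
  proof (rule span_induct)
    fix c \<alpha> a' assume x: "\<alpha> \<in> Bas \<inter> heis_deg r" "hf.local_fields (odd r) (odd s) (Y a') (Y \<beta>)"
    have "hf.local_fields (odd r) (odd s) (hf.wfield (word_of \<alpha>)) (hf.wfield (word_of \<beta>))"
      using hf.local_fields_wfield[of "word_of \<alpha>" "word_of \<beta>"] deg_basis_weights(3)[OF x(1)] deg_basis_weights(3)[OF that] by (simp add: w_odd_deg)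
    then show "hf.local_fields (odd r) (odd s) (Y (heis_scale c \<alpha> + a')) (Y \<beta>)"
      using x that unfolding Y_add by (intro hf.local_fields_combine Y_is_field) (simp_all add: Y_basis)
  qed (simp add: Y_zero hf.local_fields_zero1 Y_is_field)
  have "hf.local_fields (odd r) (odd s) (Y a) (Y b)"
    using b
  proof (rule span_induct)
    fix c \<beta> b' assume "\<beta> \<in> Bas \<inter> heis_deg s" "hf.local_fields (odd r) (odd s) (Y a) (Y b')"
    then show "hf.local_fields (odd r) (odd s) (Y a) (Y (heis_scale c \<beta> + b'))"
      unfolding Y_add by (rule hf.local_fields_combine'[OF l _ Y_is_field])
  qed (simp add: Y_zero hf.local_fields_zero2 Y_is_field)
  then show ?thesis
    unfolding hf.local_fields_def using hf.mutually_localI by blast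
qed

lemma Y_vac: "Y heis_vac m v = (if m = - 1 then v else 0)"
proof (cases "heis_vac = 0")
  case True
  then show ?thesis by (rule heis_trivial)
next
  case False
  then show ?thesis using wd_gen by (simp add: Y_basis hf.id_field_def)
qed

lemma Y_generator: "Y (cre x 0 heis_vac) = raviolo_series (cre x) (ann x)"
proof (cases "heis_vac = 0")
  case True
  then show ?thesis by (intro ext) (rule heis_trivial)
next
  case False
  then have "cre x 0 heis_vac \<in> Bas" "word_of (cre x 0 heis_vac) = [(x, 0)]" using wd_gen by (cases x; simp)+
  then show ?thesis by (simp only: Y_basis wfield_letter)
qed

lemma vac_deg: "heis_vac \<in> heis_deg 0" and vac_spin: "heis_vac \<in> heis_spin 0"
  using heis_deg_weight_space(2)[of "[]"] heis_spin_weight_space(2)[of "[]"] by simp_all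

text \<open>The translation operator is itself expressed by modes, so its effect on degree and spin follows
  from that of the fields.\<close>

lemma trans_eq: "heis_trans a = Y a (- 2) heis_vac"
  using Y_trans[of a "- 1" heis_vac] by (simp add: trans_vac Y_creation hf.is_field_zero[OF Y_is_field])

lemma Y_vertex: "raviolo_vertex_algebra heis_scale heis_deg heis_vac heis_trans Y"
proof (intro raviolo_vertex_algebra.intro raviolo_vertex_algebra_axioms.intro heis.vector_space_axioms)
  show "heis_vac \<in> heis_deg 0" by (rule vac_deg)
  show "heis_trans v \<in> heis_deg r" if "v \<in> heis_deg r" for v r
    using Y_deg[OF that vac_deg, of "- 2"] by (simp add: trans_eq)
  show "raviolo_field heis_scale (Y a)" for a by (simp add: hf.raviolo_field_iff Y_is_field)
  show "field_degree heis_deg r (Y a)" if "a \<in> heis_deg r" for a r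
    unfolding field_degree_def using Y_deg[OF that] by blast
  show "heis_trans (Y a m v) - Y a m (heis_trans v) = field_deriv heis_scale (Y a) m v" for a m v
    by (simp add: field_deriv_def Y_trans)
qed (fact deg_basis_weights(1) trans_linear Y_linear trans_vac Y_vac Y_creation Y_local)+

lemma Y_spin_grading: "spin_grading heis_scale heis_deg heis_vac heis_trans Y heis_spin"
  unfolding spin_grading_def
proof (intro conjI allI ballI)
  show "graded_by heis_scale heis_spin" by (rule spin_basis_weights)
  show "heis_vac \<in> heis_spin 0" by (rule vac_spin)
  show "heis_trans v \<in> heis_spin (s + 1)" if "v \<in> heis_spin s" for s v
    using Y_spin[OF that vac_spin, of "- 2"] by (simp add: trans_eq add.commute)
  show "Y a n v \<in> heis_spin (t + (s - n - 1))" if "a \<in> heis_spin s" "v \<in> heis_spin t" for s t n a v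
    using that by (rule Y_spin)
  fix s
  show "heis_spin s = heis.span (\<Union>r. heis_spin s \<inter> heis_deg r)"
  proof (rule antisym)
    have "Bas \<inter> heis_spin s \<subseteq> (\<Union>r. heis_spin s \<inter> heis_deg r)"
    proof
      fix \<beta> assume b: "\<beta> \<in> Bas \<inter> heis_spin s"
      then have "\<beta> \<in> heis_deg (sum_list (map letter_deg (word_of \<beta>)))" using heis_deg_weight_space(2)[of "word_of \<beta>"] word_of[of \<beta>] by simp
      with b show "\<beta> \<in> (\<Union>r. heis_spin s \<inter> heis_deg r)" by blast
    qed
    then show "heis_spin s \<subseteq> heis.span (\<Union>r. heis_spin s \<inter> heis_deg r)"
      using spin_basis_weights(2)[of s] heis.span_mono by blast
    show "heis.span (\<Union>r. heis_spin s \<inter> heis_deg r) \<subseteq> heis_spin s"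
      by (rule heis.span_minimal) (auto simp: spin_subspace)
  qed
qed

text \<open>The mode of index \<open>-i - 1\<close> of \<open>b(z)\<close> or \<open>nu(z)\<close> is the i-th creation mode.\<close>

lemma Y_strong: "strongly_generated heis_scale heis_vac Y {b_vac, nu_vac}"
proof -
  have "\<exists>u. mode_word w = mode_monomial Y heis_vac u \<and> (\<forall>(a, j)\<in>set u. a \<in> {b_vac, nu_vac} \<and> j < 0)" for w
  proof (induction w rule: mode_word.induct)
    case 1
    show ?case by (rule exI[of _ "[]"]) simp
  next
    case (2 x i w)
    then obtain u where u: "mode_word w = mode_monomial Y heis_vac u" "\<forall>(a, j)\<in>set u. a \<in> {b_vac, nu_vac} \<and> j < 0" by blast
    have "Y (cre x 0 heis_vac) (- int i - 1) = cre x i" by (simp add: Y_generator raviolo_series_def)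
    with u show ?case
      by (intro exI[of _ "(cre x 0 heis_vac, - int i - 1) # u"]) (cases x; simp)
  qed
  then have "range mode_word \<subseteq> {mode_monomial Y heis_vac u |u. \<forall>(a, j)\<in>set u. a \<in> {b_vac, nu_vac} \<and> j < 0}" by blast
  then show ?thesis
    unfolding strongly_generated_def using heis.span_mono mode_word_span by blast
qed

end

theorem proposition4p2p1:
  shows "\<exists>Y :: heis \<Rightarrow> int \<Rightarrow> heis \<Rightarrow> heis.
      raviolo_vertex_algebra heis_scale (heis_grading h_deg) heis_vac heis_trans Y \<and>
      spin_grading heis_scale (heis_grading h_deg) heis_vac heis_trans Y (heis_grading h_spin) \<and>
      Y (heis_act (u_inc (h_b 0)) heis_vac) =
        raviolo_series (\<lambda>n. heis_act (u_inc (h_b n))) (\<lambda>n. heis_act (u_inc (h_phi n))) \<and>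
      Y (heis_act (u_inc (h_nu 0)) heis_vac) =
        raviolo_series (\<lambda>n. heis_act (u_inc (h_nu n))) (\<lambda>n. heis_act (u_inc (h_c n))) \<and>
      strongly_generated heis_scale heis_vac Y
        {heis_act (u_inc (h_b 0)) heis_vac, heis_act (u_inc (h_nu 0)) heis_vac}"
proof -
  obtain Bas word_of where "word_basis Bas word_of"
    using exists_word_basis word_basis.intro by metis
  then interpret word_basis Bas word_of .
  have "cre False = (\<lambda>n. h_act (h_b n))" "cre True = (\<lambda>n. h_act (h_nu n))"
    "ann False = (\<lambda>n. h_act (h_phi n))" "ann True = (\<lambda>n. h_act (h_c n))"
    by (auto simp: cre_def ann_def)
  with Y_vertex Y_spin_grading Y_generator[of False] Y_generator[of True] Y_strong show ?thesis
    by (intro exI[of _ Y]) simp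
qed

end
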